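(* Let $d\in\{2,3\}$, let $\Omega\subseteq\mathbb R^d$ be a bounded, open, contractible polytopal Lipschitz domain with a regular simplicial triangulation $\mathcal T$, and let the spaces, forms and constants be as defined in the context. Given $f\in H(\operatorname{div}^0,\Omega)$, let $u\in V$ solve $$a(u,v)=b(f,v)\quad\text{for all }v\in V$$ and let $u_h\in V_h$ solve $$a(u_h,v_h)=b(f,v_h)\quad\text{for all }v_h\in V_h.$$ Let $\hat M_h$ be a real number with $$\hat M_h\ \ge\ \bigl(h_{\max}\hat C+\kappa_hC_{1,\operatorname{div}}\bigr)\sqrt{C_{\mathit{OL}}}.$$ Then $$\|u-u_h\|_a\le\hat M_h\|f\|_{L^2(\Omega)}.$$ In particular, $M_h\le\hat M_h$.
   Context: All functions are real-valued. **Differential operators.** For $d=2$: $\operatorname{rot}v=\partial_1v_2-\partial_2v_1$ for vector fields $v$, and $\operatorname{Curl}\phi=(-\partial_2\phi,\partial_1\phi)^T$ for scalar $\phi$. For $d=3$: $\operatorname{rot}$ is the usual curl, and $\operatorname{Curl}=\operatorname{rot}$. **Spaces and forms.** $H(\operatorname{div},\Omega)$ is the space of $L^2$ vector fields with weak divergence in $L^2$; $H(\operatorname{div}^0,\Omega)$ is its subspace of divergence-free fields; $H(\operatorname{rot},\Omega)$ is the space of $L^2$ vector fields with weak $\operatorname{rot}$ in $L^2$; $H_0(\operatorname{rot},\Omega)$ is its subspace with vanishing tangential trace on $\partial\Omega$. Set $H(\operatorname{Curl},\Omega)=H^1(\Omega)$ if $d=2$ and $H(\operatorname{Curl},\Omega)=H(\operatorname{rot},\Omega)$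 if $d=3$. Let $b(\cdot,\cdot)=(\cdot,\cdot)_{L^2(\Omega)}$ with norm $\|\cdot\|_b$, let $a(v,w)=(\operatorname{rot}v,\operatorname{rot}w)_{L^2(\Omega)}$ with (semi)norm $\|\cdot\|_a=\sqrt{a(\cdot,\cdot)}$, and $V=H_0(\operatorname{rot},\Omega)\cap H(\operatorname{div}^0,\Omega)$. The form $a$ is an inner product on $V$. **Discrete spaces.** $\mathcal T$ is a regular (face-to-face) simplicial triangulation of $\Omega$ into closed simplices, $h_T$ is the diameter of $T\in\mathcal T$, $h_{\max}=\max_{T\in\mathcal T}h_T$. $S^1(\mathcal T)$ is the space of $H^1(\Omega)$ functions that are affine on each $T\in\mathcal T$, and $S^1_0(\mathcal T)=S^1(\mathcal T)\cap H^1_0(\Omega)$. $\mathcal N_0(\mathcal T)$ (lowest-order edge elements) is the space of $v\in H(\operatorname{rot},\Omega)$ such that for each $T\in\mathcal T$ there are $\alpha_T\in\mathbb R^d$ and $\beta_T\in P_1(T)^d$ (affine vector field) with $v(x)=\alpha_T+\beta_T(x)$ and $\beta_T(x)\cdot x=0$ for all $x\in T$; $\mathcal N_{0,D}(\mathcal T)=\mathcal N_0(\mathcal T)\cap H_0(\operatorname{rot},\Omega)$. $\mathit{RT}_0(\mathcal T)$ is the space of $v\in H(\operatorname{div},\Omega)$ such that for each $T\in\mathcal T$, $v|_T(x)=\alpha_T+\beta_Tx$ with some $\alpha_T\in\mathbb R^d$, $\beta_T\in\mathbb R$. Set $$V_h=\{\psi_h\in\mathcal N_{0,D}(\mathcal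 T):(\nabla v_h,\psi_h)_{L^2(\Omega)}=0\ \text{for all }v_h\in S^1_0(\mathcal T)\}$$ (in general $V_h\not\subseteq V$; $a$ is an inner product on $V_h$), $\mathcal S_h=S^1(\mathcal T)$ if $d=2$ and $\mathcal S_h=\mathcal N_0(\mathcal T)$ if $d=3$, $X_h=\mathit{RT}_0(\mathcal T)\cap H(\operatorname{div}^0,\Omega)$. **Galerkin projection and $M_h$.** For $u\in V$, $G_hu\in V_h$ is defined by $a(u-G_hu,v_h)=0$ for all $v_h\in V_h$. $M_h$ is the smallest number such that $\|u-G_hu\|_a\le M_h\|f\|_b$ for all $f\in H(\operatorname{div}^0,\Omega)$, where $u\in V$ is the solution of $a(u,v)=b(f,v)$ for all $v\in V$. (This $u$ satisfies the equation even for all $v\in H_0(\operatorname{rot},\Omega)$, so that $u_h=G_hu$.) **Element patches.** For $T\in\mathcal T$, $\omega_T=\operatorname{int}\bigl(\bigcup\{K\in\mathcal T:K\cap T\ne\emptyset\}\bigr)$, and $C_{\mathit{OL}}=\max_{T\in\mathcal T}\operatorname{card}\{K\in\mathcal T:T\subseteq\overline{\omega_K}\}$. **Falk–Winther projections.** $\pi^{\operatorname{div}}:H(\operatorname{div},\Omega)\to\mathit{RT}_0(\mathcal T)$ and $\pi^{\operatorname{Curl}}:H(\operatorname{Curl},\Omega)\to\mathcal S_h$ are fixed linear projections (the Falk–Winther quasi-interpolations) with $\pi^{\operatorname{div}}\operatorname{Curl}=\operatorname{Curl}\pi^{\operatorname{Curl}}$ and with constants $C_{1,\operatorname{div}},C_{2,\operatorname{div}},C_{1,\operatorname{Curl}},C_{2,\operatorname{Curl}}$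 such that for all $T\in\mathcal T$ $$\|\pi^{\operatorname{div}}v\|_{L^2(T)}\le C_{1,\operatorname{div}}\|v\|_{L^2(\omega_T)}+h_TC_{2,\operatorname{div}}\|\operatorname{div}v\|_{L^2(\omega_T)}\quad(v\in H(\operatorname{div},\Omega)),$$ $$\|\pi^{\operatorname{Curl}}v\|_{L^2(T)}\le C_{1,\operatorname{Curl}}\|v\|_{L^2(\omega_T)}+h_TC_{2,\operatorname{Curl}}\|\operatorname{Curl}v\|_{L^2(\omega_T)}\quad(v\in H(\operatorname{Curl},\Omega)).$$ **Further constants.** $C_{RD}$ is a constant such that for every $f\in H(\operatorname{div}^0,\Omega)$ there is $\beta\in H^1(\Omega;\mathbb R^{2d-3})$ with $\operatorname{Curl}\beta=f$ and $\|D\beta\|_{L^2(\Omega)}\le C_{RD}\|f\|_{L^2(\Omega)}$, where $D\beta$ is the Jacobian (such a constant exists; $C_{RD}=1$ if $d=2$). $\tilde c$ is the smallest constant such that $\|v\|_{L^2(\omega_T)}\le h_T\tilde c\|Dv\|_{L^2(\omega_T)}$ for all $T\in\mathcal T$ and all $H^1$ functions $v$ on $\omega_T$ with vanishing average over $\omega_T$. Further $$\hat C=\begin{cases}(1+C_{1,\operatorname{Curl}})\tilde c+C_{2,\operatorname{Curl}}&\text{if }d=2,\\ \sqrt{2\bigl(((1+C_{1,\operatorname{Curl}})\tilde c\,C_{RD})^2+C_{2,\operatorname{Curl}}^2\bigr)}&\text{if }d=3,\end{cases}$$ and, with $\mathcal S_{f_h}=\{v_h\in\mathcal S_h:\operatorname{Curl}v_h=(-1)^{d-1}f_h\}$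 for $f_h\in X_h$, $$\kappa_h=\max_{f_h\in X_h\setminus\{0\}}\ \min_{v_h\in V_h}\ \min_{\tau_h\in\mathcal S_{f_h}}\frac{\|\tau_h-\operatorname{rot}v_h\|_{L^2(\Omega)}}{\|f_h\|_{L^2(\Omega)}}.$$ *)

theory Defs
  imports "HOL-Analysis.Analysis"
begin

text \<open>
  A function on a set \<open>S\<close> is represented by a total function of which only the values on \<open>S\<close>
  matter; elements of \<open>L\<^sup>2\<close> are represented by measurable functions, and equality in \<open>L\<^sup>2\<close>
  is equality almost everywhere.  The space dimension \<open>d\<close> is \<open>CARD('n)\<close>.
\<close>

section \<open>Lebesgue and Sobolev spaces\<close>

definition ae_eq :: "(real^'n) set \<Rightarrow> (real^'n \<Rightarrow> 'b) \<Rightarrow> (real^'n \<Rightarrow> 'b) \<Rightarrow> bool" where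
  "ae_eq S v w \<longleftrightarrow> (AE x in lebesgue_on S. v x = w x)"

definition L2 :: "(real^'n) set \<Rightarrow> (real^'n \<Rightarrow> 'b::euclidean_space) set" where
  "L2 S = {v \<in> borel_measurable (lebesgue_on S). integrable (lebesgue_on S) (\<lambda>x. (norm (v x))\<^sup>2)}"

definition L2_inner :: "(real^'n) set \<Rightarrow> (real^'n \<Rightarrow> 'b::euclidean_space) \<Rightarrow> (real^'n \<Rightarrow> 'b) \<Rightarrow> real" where
  "L2_inner S v w = integral\<^sup>L (lebesgue_on S) (\<lambda>x. v x \<bullet> w x)"

definition L2_norm :: "(real^'n) set \<Rightarrow> (real^'n \<Rightarrow> 'b::euclidean_space) \<Rightarrow> real" where
  "L2_norm S v = sqrt (integral\<^sup>L (lebesgue_on S) (\<lambda>x. (norm (v x))\<^sup>2))"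

definition pd :: "'n \<Rightarrow> (real^'n \<Rightarrow> 'b::euclidean_space) \<Rightarrow> real^'n \<Rightarrow> 'b" where
  "pd i f x = frechet_derivative f (at x) (axis i 1)"

primrec C_k :: "nat \<Rightarrow> (real^'n \<Rightarrow> 'b::euclidean_space) \<Rightarrow> bool" where
  "C_k 0 f \<longleftrightarrow> continuous_on UNIV f"
| "C_k (Suc k) f \<longleftrightarrow> (\<forall>x. f differentiable (at x)) \<and> (\<forall>i. C_k k (pd i f))"

text \<open>\<open>C\<^sub>c\<^sup>\<infinity>(S)\<close>, extended by zero.\<close>

definition test_functions :: "(real^'n) set \<Rightarrow> (real^'n \<Rightarrow> 'b::euclidean_space) set" where
  "test_functions S = {\<phi>. (\<forall>k. C_k k \<phi>) \<and>
     compact (closure {x. \<phi> x \<noteq> 0}) \<and> closure {x. \<phi> x \<noteq> 0} \<subseteq> S}"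

definition is_weak_pd ::
  "(real^'n) set \<Rightarrow> 'n \<Rightarrow> (real^'n \<Rightarrow> 'b::euclidean_space) \<Rightarrow> (real^'n \<Rightarrow> 'b) \<Rightarrow> bool" where
  "is_weak_pd S i v w \<longleftrightarrow> (\<forall>\<phi>::real^'n \<Rightarrow> real. \<phi> \<in> test_functions S \<longrightarrow>
     integral\<^sup>L (lebesgue_on S) (\<lambda>x. pd i \<phi> x *\<^sub>R v x) =
     - integral\<^sup>L (lebesgue_on S) (\<lambda>x. \<phi> x *\<^sub>R w x))"

definition weak_pd :: "(real^'n) set \<Rightarrow> 'n \<Rightarrow> (real^'n \<Rightarrow> 'b::euclidean_space) \<Rightarrow> real^'n \<Rightarrow> 'b" where
  "weak_pd S i v = (SOME w. w \<in> L2 S \<and> is_weak_pd S i v w)"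

definition H1 :: "(real^'n) set \<Rightarrow> (real^'n \<Rightarrow> 'b::euclidean_space) set" where
  "H1 S = {v \<in> L2 S. \<forall>i. \<exists>w \<in> L2 S. is_weak_pd S i v w}"

text \<open>The \<open>L\<^sup>2\<close> norm of the Jacobian (Frobenius norm pointwise).\<close>

definition D_norm :: "(real^'n) set \<Rightarrow> (real^'n \<Rightarrow> 'b::euclidean_space) \<Rightarrow> real" where
  "D_norm S v = sqrt (\<Sum>i\<in>UNIV. (L2_norm S (weak_pd S i v))\<^sup>2)"

definition weak_grad :: "(real^'n) set \<Rightarrow> (real^'n \<Rightarrow> real) \<Rightarrow> real^'n \<Rightarrow> real^'n" where
  "weak_grad S v x = (\<chi> i. weak_pd S i v x)"

text \<open>The closure of \<open>C\<^sub>c\<^sup>\<infinity>(S)\<close> in \<open>H\<^sup>1(S)\<close>.\<close>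

definition H1_0 :: "(real^'n) set \<Rightarrow> (real^'n \<Rightarrow> real) set" where
  "H1_0 S = {v \<in> H1 S. \<forall>\<epsilon>>0. \<exists>\<phi> \<in> test_functions S.
     L2_norm S (\<lambda>x. v x - \<phi> x) < \<epsilon> \<and> D_norm S (\<lambda>x. v x - \<phi> x) < \<epsilon>}"

definition is_weak_div :: "(real^'n) set \<Rightarrow> (real^'n \<Rightarrow> real^'n) \<Rightarrow> (real^'n \<Rightarrow> real) \<Rightarrow> bool" where
  "is_weak_div S v w \<longleftrightarrow> (\<forall>\<phi> \<in> test_functions S.
     L2_inner S v (\<lambda>x. \<chi> i. pd i \<phi> x) = - L2_inner S w \<phi>)"

definition weak_div :: "(real^'n) set \<Rightarrow> (real^'n \<Rightarrow> real^'n) \<Rightarrow> real^'n \<Rightarrow> real" where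
  "weak_div S v = (SOME w. w \<in> L2 S \<and> is_weak_div S v w)"

definition H_div :: "(real^'n) set \<Rightarrow> (real^'n \<Rightarrow> real^'n) set" where
  "H_div S = {v \<in> L2 S. \<exists>w \<in> L2 S. is_weak_div S v w}"

definition H_div0 :: "(real^'n) set \<Rightarrow> (real^'n \<Rightarrow> real^'n) set" where
  "H_div0 S = {v \<in> H_div S. is_weak_div S v (\<lambda>x. 0)}"


section \<open>Domain, triangulation and element patches\<close>

text \<open>
  Near each boundary point, \<open>\<Omega>\<close> is the set of points below the graph of a Lipschitz function
  \<open>\<gamma>\<close> over the hyperplane orthogonal to some unit vector \<open>\<nu>\<close>.
\<close>

definition lipschitz_boundary :: "(real^'n) set \<Rightarrow> bool" where
  "lipschitz_boundary \<Omega> \<longleftrightarrow> (\<forall>p \<in> frontier \<Omega>. \<exists>\<nu> r \<gamma> L. norm \<nu> = 1 \<and> 0 < r \<and>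
     L-lipschitz_on UNIV (\<gamma> :: real^'n \<Rightarrow> real) \<and>
     \<Omega> \<inter> ball p r = {y \<in> ball p r. y \<bullet> \<nu> < \<gamma> (y - (y \<bullet> \<nu>) *\<^sub>R \<nu>)})"

definition polytopal :: "(real^'n) set \<Rightarrow> bool" where
  "polytopal \<Omega> \<longleftrightarrow> (\<exists>P. finite P \<and> (\<forall>p\<in>P. polytope p) \<and> closure \<Omega> = \<Union>P)"

definition regular_triangulation :: "(real^'n) set \<Rightarrow> (real^'n) set set \<Rightarrow> bool" where
  "regular_triangulation \<Omega> \<T> \<longleftrightarrow>
     triangulation \<T> \<and> (\<forall>T\<in>\<T>. int CARD('n) simplex T) \<and> \<Union>\<T> = closure \<Omega>"

definition h_max :: "(real^'n) set set \<Rightarrow> real" where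
  "h_max \<T> = Max (diameter ` \<T>)"

definition patch :: "(real^'n) set set \<Rightarrow> (real^'n) set \<Rightarrow> (real^'n) set" where
  "patch \<T> T = interior (\<Union>{K \<in> \<T>. K \<inter> T \<noteq> {}})"

definition C_OL :: "(real^'n) set set \<Rightarrow> nat" where
  "C_OL \<T> = Max ((\<lambda>T. card {K \<in> \<T>. T \<subseteq> closure (patch \<T> K)}) ` \<T>)"

definition patch_poincare_bound :: "(real^'n) set set \<Rightarrow> real \<Rightarrow> bool" where
  "patch_poincare_bound \<T> c \<longleftrightarrow> (\<forall>T\<in>\<T>. \<forall>v::real^'n \<Rightarrow> real. v \<in> H1 (patch \<T> T) \<longrightarrow>
     integral\<^sup>L (lebesgue_on (patch \<T> T)) v = 0 \<longrightarrow>
     L2_norm (patch \<T> T) v \<le> diameter T * c * D_norm (patch \<T> T) v)"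

definition is_patch_poincare_constant :: "(real^'n) set set \<Rightarrow> real \<Rightarrow> bool" where
  "is_patch_poincare_constant \<T> c \<longleftrightarrow>
     patch_poincare_bound \<T> c \<and> (\<forall>c'. patch_poincare_bound \<T> c' \<longrightarrow> c \<le> c')"


section \<open>Finite element spaces independent of the rotation operator\<close>

text \<open>
  Piecewise conditions are imposed almost everywhere on each element, because the
  functions are only determined up to null sets (and two closed elements may overlap in a face).
\<close>

definition S1 :: "(real^'n) set \<Rightarrow> (real^'n) set set \<Rightarrow> (real^'n \<Rightarrow> real) set" where
  "S1 \<Omega> \<T> = {v \<in> H1 \<Omega>. \<forall>T\<in>\<T>. \<exists>a c. AE x in lebesgue_on T. v x = a \<bullet> x + c}"

definition S1_0 :: "(real^'n) set \<Rightarrow> (real^'n) set set \<Rightarrow> (real^'n \<Rightarrow> real) set" where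
  "S1_0 \<Omega> \<T> = S1 \<Omega> \<T> \<inter> H1_0 \<Omega>"

definition RT0 :: "(real^'n) set \<Rightarrow> (real^'n) set set \<Rightarrow> (real^'n \<Rightarrow> real^'n) set" where
  "RT0 \<Omega> \<T> = {v \<in> H_div \<Omega>. \<forall>T\<in>\<T>. \<exists>\<alpha> \<beta>. AE x in lebesgue_on T. v x = \<alpha> + \<beta> *\<^sub>R x}"

definition X_h :: "(real^'n) set \<Rightarrow> (real^'n) set set \<Rightarrow> (real^'n \<Rightarrow> real^'n) set" where
  "X_h \<Omega> \<T> = RT0 \<Omega> \<T> \<inter> H_div0 \<Omega>"

text \<open>
  A linear projection of the space \<open>X\<close> onto the subspace \<open>Y\<close>, both consisting of
  almost-everywhere equivalence classes.
\<close>

definition linear_projection ::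
  "(real^'n) set \<Rightarrow> (real^'n \<Rightarrow> 'b::euclidean_space) set \<Rightarrow> (real^'n \<Rightarrow> 'b) set \<Rightarrow>
    ((real^'n \<Rightarrow> 'b) \<Rightarrow> real^'n \<Rightarrow> 'b) \<Rightarrow> bool" where
  "linear_projection \<Omega> X Y P \<longleftrightarrow>
     (\<forall>v\<in>X. P v \<in> Y) \<and>
     (\<forall>v\<in>X. \<forall>w\<in>X. ae_eq \<Omega> v w \<longrightarrow> ae_eq \<Omega> (P v) (P w)) \<and>
     (\<forall>v\<in>X. \<forall>w\<in>X. \<forall>r s. ae_eq \<Omega> (P (\<lambda>x. r *\<^sub>R v x + s *\<^sub>R w x)) (\<lambda>x. r *\<^sub>R P v x + s *\<^sub>R P w x)) \<and>
     (\<forall>v\<in>Y. ae_eq \<Omega> (P v) v)"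


section \<open>Rotation operators\<close>

text \<open>
  The parameters are the classical operators, acting on smooth functions.  The target type
  \<open>'b\<close> of \<open>rot\<close> is \<open>real\<close> for \<open>d = 2\<close> and \<open>real^3\<close> for \<open>d = 3\<close>.  In both
  cases \<open>(-1)\<^sup>d\<^sup>-\<^sup>1 Curl\<close> and \<open>rot\<close> are formally adjoint to each other:
  \<open>\<integral> rot v \<bullet> \<phi> = (-1)\<^sup>d\<^sup>-\<^sup>1 \<integral> v \<bullet> Curl \<phi>\<close> if \<open>v\<close> or \<open>\<phi>\<close> has compact support.
\<close>

locale curl_operators =
  fixes rot :: "(real^'n \<Rightarrow> real^'n) \<Rightarrow> real^'n \<Rightarrow> 'b::euclidean_space"
    and Curl :: "(real^'n \<Rightarrow> 'b) \<Rightarrow> real^'n \<Rightarrow> real^'n"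
begin

definition sgn_d :: real where
  "sgn_d = (-1) ^ (CARD('n) - 1)"

definition is_weak_rot :: "(real^'n) set \<Rightarrow> (real^'n \<Rightarrow> real^'n) \<Rightarrow> (real^'n \<Rightarrow> 'b) \<Rightarrow> bool" where
  "is_weak_rot \<Omega> v w \<longleftrightarrow>
     (\<forall>\<phi> \<in> test_functions \<Omega>. L2_inner \<Omega> v (Curl \<phi>) = sgn_d * L2_inner \<Omega> w \<phi>)"

definition weak_rot :: "(real^'n) set \<Rightarrow> (real^'n \<Rightarrow> real^'n) \<Rightarrow> real^'n \<Rightarrow> 'b" where
  "weak_rot \<Omega> v = (SOME w. w \<in> L2 \<Omega> \<and> is_weak_rot \<Omega> v w)"

definition is_weak_Curl :: "(real^'n) set \<Rightarrow> (real^'n \<Rightarrow> 'b) \<Rightarrow> (real^'n \<Rightarrow> real^'n) \<Rightarrow> bool" where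
  "is_weak_Curl \<Omega> \<phi> w \<longleftrightarrow>
     (\<forall>\<psi> \<in> test_functions \<Omega>. L2_inner \<Omega> \<phi> (rot \<psi>) = sgn_d * L2_inner \<Omega> w \<psi>)"

definition weak_Curl :: "(real^'n) set \<Rightarrow> (real^'n \<Rightarrow> 'b) \<Rightarrow> real^'n \<Rightarrow> real^'n" where
  "weak_Curl \<Omega> \<phi> = (SOME w. w \<in> L2 \<Omega> \<and> is_weak_Curl \<Omega> \<phi> w)"

definition H_rot :: "(real^'n) set \<Rightarrow> (real^'n \<Rightarrow> real^'n) set" where
  "H_rot \<Omega> = {v \<in> L2 \<Omega>. \<exists>w \<in> L2 \<Omega>. is_weak_rot \<Omega> v w}"

definition N0 :: "(real^'n) set \<Rightarrow> (real^'n) set set \<Rightarrow> (real^'n \<Rightarrow> real^'n) set" where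
  "N0 \<Omega> \<T> = {v \<in> H_rot \<Omega>. \<forall>T\<in>\<T>. \<exists>\<alpha> \<beta>. (\<exists>A b. \<forall>x. \<beta> x = A *v x + b) \<and>
     (\<forall>x\<in>T. \<beta> x \<bullet> x = 0) \<and> (AE x in lebesgue_on T. v x = \<alpha> + \<beta> x)}"

text \<open>\<open>C\<close> bounds the Jacobian of suitable \<open>Curl\<close> potentials of divergence-free fields.\<close>

definition is_potential_constant :: "(real^'n) set \<Rightarrow> real \<Rightarrow> bool" where
  "is_potential_constant \<Omega> C \<longleftrightarrow> (\<forall>f \<in> H_div0 \<Omega>. \<exists>\<beta> \<in> H1 \<Omega>.
     is_weak_Curl \<Omega> \<beta> f \<and> D_norm \<Omega> \<beta> \<le> C * L2_norm \<Omega> f)"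

end


section \<open>The Maxwell problem and its edge element discretization\<close>

text \<open>
  \<open>H_Curl\<close> is \<open>H\<^sup>1\<close> for \<open>d = 2\<close> and \<open>H(rot)\<close> for \<open>d = 3\<close>; correspondingly
  \<open>S_h\<close> is \<open>S\<^sup>1\<close> or \<open>N\<^sub>0\<close>.
\<close>

locale edge_elements = curl_operators rot Curl
  for rot :: "(real^'n \<Rightarrow> real^'n) \<Rightarrow> real^'n \<Rightarrow> 'b::euclidean_space"
    and Curl :: "(real^'n \<Rightarrow> 'b) \<Rightarrow> real^'n \<Rightarrow> real^'n" +
  fixes H_Curl :: "(real^'n) set \<Rightarrow> (real^'n \<Rightarrow> 'b) set"
    and S_h :: "(real^'n) set \<Rightarrow> (real^'n) set set \<Rightarrow> (real^'n \<Rightarrow> 'b) set"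
begin

text \<open>
  The tangential trace of \<open>v \<in> H(rot)\<close>, a functional on \<open>H(Curl)\<close> defined as usual by
  Green's formula; for smooth functions it is the boundary integral pairing the tangential
  component of \<open>v\<close> with \<open>\<phi>\<close>.
\<close>

definition tangential_trace :: "(real^'n) set \<Rightarrow> (real^'n \<Rightarrow> real^'n) \<Rightarrow> (real^'n \<Rightarrow> 'b) \<Rightarrow> real" where
  "tangential_trace \<Omega> v \<phi> =
     L2_inner \<Omega> (weak_rot \<Omega> v) \<phi> - sgn_d * L2_inner \<Omega> v (weak_Curl \<Omega> \<phi>)"

definition H0_rot :: "(real^'n) set \<Rightarrow> (real^'n \<Rightarrow> real^'n) set" where
  "H0_rot \<Omega> = {v \<in> H_rot \<Omega>. \<forall>\<phi> \<in> H_Curl \<Omega>. tangential_trace \<Omega> v \<phi> = 0}"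

definition a :: "(real^'n) set \<Rightarrow> (real^'n \<Rightarrow> real^'n) \<Rightarrow> (real^'n \<Rightarrow> real^'n) \<Rightarrow> real" where
  "a \<Omega> v w = L2_inner \<Omega> (weak_rot \<Omega> v) (weak_rot \<Omega> w)"

definition a_norm :: "(real^'n) set \<Rightarrow> (real^'n \<Rightarrow> real^'n) \<Rightarrow> real" where
  "a_norm \<Omega> v = sqrt (a \<Omega> v v)"

definition V :: "(real^'n) set \<Rightarrow> (real^'n \<Rightarrow> real^'n) set" where
  "V \<Omega> = H0_rot \<Omega> \<inter> H_div0 \<Omega>"

definition N0_D :: "(real^'n) set \<Rightarrow> (real^'n) set set \<Rightarrow> (real^'n \<Rightarrow> real^'n) set" where
  "N0_D \<Omega> \<T> = N0 \<Omega> \<T> \<inter> H0_rot \<Omega>"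

definition V_h :: "(real^'n) set \<Rightarrow> (real^'n) set set \<Rightarrow> (real^'n \<Rightarrow> real^'n) set" where
  "V_h \<Omega> \<T> = {\<psi> \<in> N0_D \<Omega> \<T>. \<forall>v \<in> S1_0 \<Omega> \<T>. L2_inner \<Omega> (weak_grad \<Omega> v) \<psi> = 0}"

text \<open>\<open>u \<in> W\<close> solves \<open>a(u, v) = (f, v)\<close> for all \<open>v \<in> W\<close>.\<close>

definition solves ::
  "(real^'n) set \<Rightarrow> (real^'n \<Rightarrow> real^'n) set \<Rightarrow> (real^'n \<Rightarrow> real^'n) \<Rightarrow> (real^'n \<Rightarrow> real^'n) \<Rightarrow> bool" where
  "solves \<Omega> W f u \<longleftrightarrow> u \<in> W \<and> (\<forall>v\<in>W. a \<Omega> u v = L2_inner \<Omega> f v)"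

definition G_h :: "(real^'n) set \<Rightarrow> (real^'n) set set \<Rightarrow> (real^'n \<Rightarrow> real^'n) \<Rightarrow> real^'n \<Rightarrow> real^'n" where
  "G_h \<Omega> \<T> u = (SOME w. w \<in> V_h \<Omega> \<T> \<and> (\<forall>v \<in> V_h \<Omega> \<T>. a \<Omega> (\<lambda>x. u x - w x) v = 0))"

definition M_h :: "(real^'n) set \<Rightarrow> (real^'n) set set \<Rightarrow> real" where
  "M_h \<Omega> \<T> = (LEAST M. \<forall>f \<in> H_div0 \<Omega>. \<forall>u. solves \<Omega> (V \<Omega>) f u \<longrightarrow>
     a_norm \<Omega> (\<lambda>x. u x - G_h \<Omega> \<T> u x) \<le> M * L2_norm \<Omega> f)"

definition S_f :: "(real^'n) set \<Rightarrow> (real^'n) set set \<Rightarrow> (real^'n \<Rightarrow> real^'n) \<Rightarrow> (real^'n \<Rightarrow> 'b) set" where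
  "S_f \<Omega> \<T> f = {\<tau> \<in> S_h \<Omega> \<T>. is_weak_Curl \<Omega> \<tau> (\<lambda>x. sgn_d *\<^sub>R f x)}"

text \<open>All spaces involved are finite-dimensional, so the extrema are attained.\<close>

definition kappa_h :: "(real^'n) set \<Rightarrow> (real^'n) set set \<Rightarrow> real" where
  "kappa_h \<Omega> \<T> = (SUP f \<in> {f \<in> X_h \<Omega> \<T>. \<not> ae_eq \<Omega> f (\<lambda>x. 0)}.
     INF v \<in> V_h \<Omega> \<T>. INF \<tau> \<in> S_f \<Omega> \<T> f.
       L2_norm \<Omega> (\<lambda>x. \<tau> x - weak_rot \<Omega> v x) / L2_norm \<Omega> f)"

text \<open>
  The properties of the Falk-Winther quasi-interpolations: commuting linear projections that
  are locally bounded with constants \<open>C1div\<close>, \<open>C2div\<close>, \<open>C1Curl\<close>, \<open>C2Curl\<close>.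
\<close>

definition commuting_projections ::
  "(real^'n) set \<Rightarrow> (real^'n) set set \<Rightarrow>
    ((real^'n \<Rightarrow> real^'n) \<Rightarrow> real^'n \<Rightarrow> real^'n) \<Rightarrow> ((real^'n \<Rightarrow> 'b) \<Rightarrow> real^'n \<Rightarrow> 'b) \<Rightarrow>
    real \<Rightarrow> real \<Rightarrow> real \<Rightarrow> real \<Rightarrow> bool" where
  "commuting_projections \<Omega> \<T> \<pi>div \<pi>Curl C1div C2div C1Curl C2Curl \<longleftrightarrow>
     linear_projection \<Omega> (H_div \<Omega>) (RT0 \<Omega> \<T>) \<pi>div \<and>
     linear_projection \<Omega> (H_Curl \<Omega>) (S_h \<Omega> \<T>) \<pi>Curl \<and>
     (\<forall>v \<in> H_Curl \<Omega>. ae_eq \<Omega> (\<pi>div (weak_Curl \<Omega> v)) (weak_Curl \<Omega> (\<pi>Curl v))) \<and>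
     (\<forall>T\<in>\<T>. \<forall>v \<in> H_div \<Omega>.
        L2_norm T (\<pi>div v) \<le> C1div * L2_norm (patch \<T> T) v
          + diameter T * C2div * L2_norm (patch \<T> T) (weak_div \<Omega> v)) \<and>
     (\<forall>T\<in>\<T>. \<forall>v \<in> H_Curl \<Omega>.
        L2_norm T (\<pi>Curl v) \<le> C1Curl * L2_norm (patch \<T> T) v
          + diameter T * C2Curl * L2_norm (patch \<T> T) (weak_Curl \<Omega> v))"

end


section \<open>The two- and three-dimensional cases\<close>

definition rot2 :: "(real^2 \<Rightarrow> real^2) \<Rightarrow> real^2 \<Rightarrow> real" where
  "rot2 v x = pd 1 v x $ 2 - pd 2 v x $ 1"

definition Curl2 :: "(real^2 \<Rightarrow> real) \<Rightarrow> real^2 \<Rightarrow> real^2" where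
  "Curl2 \<phi> x = vector [- pd 2 \<phi> x, pd 1 \<phi> x]"

definition curl3 :: "(real^3 \<Rightarrow> real^3) \<Rightarrow> real^3 \<Rightarrow> real^3" where
  "curl3 v x = vector [pd 2 v x $ 3 - pd 3 v x $ 2,
                       pd 3 v x $ 1 - pd 1 v x $ 3,
                       pd 1 v x $ 2 - pd 2 v x $ 1]"

interpretation d2: edge_elements rot2 Curl2 H1 S1 .

interpretation d3: curl_operators curl3 curl3 .

interpretation d3: edge_elements curl3 curl3 d3.H_rot d3.N0 .

end

theory Submission
  imports Defs
begin

text \<open>
  The proof is a Prager-Synge argument that needs no auxiliary continuous problem.  If \<open>\<tau>\<close> lies in
  \<open>H(Curl)\<close> and \<open>Curl \<tau> = (-1)\<^sup>d\<^sup>-\<^sup>1 f\<close>, then \<open>rot u - \<tau>\<close> is \<open>L\<^sup>2\<close>-orthogonal to \<open>rot v\<close> for every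
  \<open>v \<in> H\<^sub>0(rot)\<close>; hence \<open>\<parallel>u - u\<^sub>h\<parallel>\<^sub>a \<le> \<parallel>\<tau> - rot v\<^sub>h\<parallel>\<close> for all \<open>v\<^sub>h \<in> V\<^sub>h\<close>.  With a potential \<open>\<beta>\<close> of \<open>f\<close> and
  \<open>f\<^sub>h = \<pi>\<^sup>d\<^sup>i\<^sup>v f\<close> one takes \<open>\<tau> = (-1)\<^sup>d\<^sup>-\<^sup>1 (\<beta> - \<pi>\<^sup>C\<^sup>u\<^sup>r\<^sup>l \<beta>) + \<tau>\<^sub>h\<close> with \<open>\<tau>\<^sub>h\<close> nearly optimal in the definition of
  \<open>\<kappa>\<^sub>h\<close>.  The first summand is bounded by local stability of \<open>\<pi>\<^sup>C\<^sup>u\<^sup>r\<^sup>l\<close> and the Poincare inequality on patches,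
  the second by \<open>\<kappa>\<^sub>h \<parallel>f\<^sub>h\<parallel>\<close>.  That the equation for \<open>u\<close> extends from \<open>V\<close> to \<open>H\<^sub>0(rot)\<close> follows from the
  Helmholtz decomposition, obtained by projecting in \<open>L\<^sup>2\<close> onto the closure of the gradients of test functions.
\<close>

section \<open>The space \<open>L\<^sup>2\<close>\<close>

text \<open>Elements of L2 are plain functions and weak operators are chosen by \<open>SOME\<close>,
  so linearity and uniqueness hold only almost everywhere; the fundamental lemma makes the choice
  harmless. The extrema carry obligations of their own. \<open>kappa_h\<close> is a supremum of
  reals and has content only once it is bounded above; the bound comes from the projections together
  with a Poincare inequality on all of \<Omega>, chained from patch to patch by connectedness.
  \<open>M_h\<close> is a \<open>LEAST\<close>, so an infimum must be attained, which needs a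
  solvable problem with nonzero \<open>f\<close>; and \<open>G_h\<close> must be shown to exist. No
  constant is assumed nonnegative: either testing with constant functions yields the sign, or a bad
  sign forces the data to vanish. The Lipschitz boundary keeps patches inside \<Omega>. For d = 2
  the weak Curl is a rotated gradient, so the Jacobian of the potential has the norm of
  \<open>f\<close> on every patch and both error terms add before squaring; for d = 3 the Jacobian
  is bounded only globally, whence the factor 2 under the root.\<close>

lemma L2_measurable: "v \<in> L2 S \<Longrightarrow> v \<in> borel_measurable (lebesgue_on S)"
  by (simp add: L2_def)

lemma L2_integrable_power2: "v \<in> L2 S \<Longrightarrow> integrable (lebesgue_on S) (\<lambda>x. (norm (v x))\<^sup>2)"
  by (simp add: L2_def)

lemma L2_integrable_inner:
  assumes "v \<in> L2 S" "w \<in> L2 S"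
  shows "integrable (lebesgue_on S) (\<lambda>x. v x \<bullet> w x)"
proof (rule Bochner_Integration.integrable_bound)
  show "integrable (lebesgue_on S) (\<lambda>x. (norm (v x))\<^sup>2 + (norm (w x))\<^sup>2)"
    using assms by (simp add: L2_integrable_power2)
  show "(\<lambda>x. v x \<bullet> w x) \<in> borel_measurable (lebesgue_on S)"
    using assms[THEN L2_measurable] by simp
  have "norm (a \<bullet> b) \<le> norm ((norm a)\<^sup>2 + (norm b)\<^sup>2)" for a b :: 'b
  proof -
    have "norm (a \<bullet> b) \<le> norm a * norm b" using Cauchy_Schwarz_ineq2[of a b] by simp
    moreover have "2 * (norm a * norm b) \<le> (norm a)\<^sup>2 + (norm b)\<^sup>2"
      using sum_squares_bound[of "norm a" "norm b"] by (simp add: algebra_simps)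
    moreover have "0 \<le> norm a * norm b" by simp
    ultimately show ?thesis by auto
  qed
  then show "AE x in lebesgue_on S. norm (v x \<bullet> w x) \<le> norm ((norm (v x))\<^sup>2 + (norm (w x))\<^sup>2)"
    by simp
qed

lemma L2_add:
  assumes "v \<in> L2 S" "w \<in> L2 S"
  shows "(\<lambda>x. v x + w x) \<in> L2 S"
proof -
  have "integrable (lebesgue_on S) (\<lambda>x. (norm (v x))\<^sup>2 + 2 * (v x \<bullet> w x) + (norm (w x))\<^sup>2)"
    using assms by (simp add: L2_integrable_power2 L2_integrable_inner)
  moreover have "(norm (v x + w x))\<^sup>2 = (norm (v x))\<^sup>2 + 2 * (v x \<bullet> w x) + (norm (w x))\<^sup>2" for x
    by (simp add: power2_norm_eq_inner inner_add_left inner_add_right inner_commute)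
  ultimately show ?thesis
    using assms[THEN L2_measurable] by (simp add: L2_def)
qed

lemma L2_scaleR: "v \<in> L2 S \<Longrightarrow> (\<lambda>x. r *\<^sub>R v x) \<in> L2 S"
  by (auto simp: L2_def power_mult_distrib intro!: borel_measurable_scaleR)

lemma L2_uminus: "v \<in> L2 S \<Longrightarrow> (\<lambda>x. - v x) \<in> L2 S"
  using L2_scaleR[of v S "-1"] by simp

lemma L2_diff: "v \<in> L2 S \<Longrightarrow> w \<in> L2 S \<Longrightarrow> (\<lambda>x. v x - w x) \<in> L2 S"
  using L2_add[OF _ L2_uminus, of v S w] by simp

lemma L2_zero [simp]: "(\<lambda>x. 0) \<in> L2 S"
  by (simp add: L2_def)

lemmas L2_lincomb = L2_add[OF L2_scaleR L2_scaleR]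

lemma L2_linear_image:
  assumes "v \<in> L2 S" "bounded_linear F"
  shows "(\<lambda>x. F (v x)) \<in> L2 S"
proof -
  obtain K where K: "\<And>x. norm (F x) \<le> norm x * K"
    using bounded_linear.bounded[OF assms(2)] by blast
  have F: "F \<in> borel_measurable borel"
    using assms(2) by (intro borel_measurable_continuous_onI linear_continuous_on)
  have m: "(\<lambda>x. F (v x)) \<in> borel_measurable (lebesgue_on S)"
    using measurable_compose[OF L2_measurable[OF assms(1)] F] by simp
  have "integrable (lebesgue_on S) (\<lambda>x. (norm (F (v x)))\<^sup>2)"
  proof (rule Bochner_Integration.integrable_bound)
    show "integrable (lebesgue_on S) (\<lambda>x. K\<^sup>2 * (norm (v x))\<^sup>2)"
      using assms(1) by (simp add: L2_integrable_power2)
    show "(\<lambda>x. (norm (F (v x)))\<^sup>2) \<in> borel_measurable (lebesgue_on S)" using m by simp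
    have "(norm (F y))\<^sup>2 \<le> K\<^sup>2 * (norm y)\<^sup>2" for y
      using power_mono[OF K norm_ge_zero, of y 2] by (simp add: power_mult_distrib mult.commute)
    then show "AE x in lebesgue_on S. norm ((norm (F (v x)))\<^sup>2) \<le> norm (K\<^sup>2 * (norm (v x))\<^sup>2)"
      by (auto simp: abs_mult)
  qed
  with m show ?thesis by (simp add: L2_def)
qed

lemma L2_component: "v \<in> L2 S \<Longrightarrow> (\<lambda>x. v x \<bullet> b) \<in> L2 S"
  by (rule L2_linear_image) (auto intro: bounded_linear_inner_left)

lemma L2_nth:
  fixes v :: "real^'n \<Rightarrow> real^'m"
  shows "v \<in> L2 S \<Longrightarrow> (\<lambda>x. v x $ i) \<in> L2 S"
  by (rule L2_linear_image) (auto intro: bounded_linear_vec_nth)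

lemma L2_vecI:
  fixes v :: "real^'n \<Rightarrow> real^'m"
  assumes "\<And>i. (\<lambda>x. v x $ i) \<in> L2 S"
  shows "v \<in> L2 S"
proof -
  have "(\<lambda>x. \<Sum>i\<in>UNIV. v x $ i *\<^sub>R axis i (1::real)) \<in> borel_measurable (lebesgue_on S)"
    using assms by (intro borel_measurable_sum borel_measurable_scaleR) (auto simp: L2_def)
  moreover have "v x = (\<Sum>i\<in>UNIV. v x $ i *\<^sub>R axis i (1::real))" for x
    by (simp add: vec_eq_iff axis_def if_distrib cong: if_cong)
  moreover have "integrable (lebesgue_on S) (\<lambda>x. \<Sum>i\<in>UNIV. (norm (v x $ i))\<^sup>2)"
    using assms[THEN L2_integrable_power2] by simp
  moreover have "(norm (v x))\<^sup>2 = (\<Sum>i\<in>UNIV. (norm (v x $ i))\<^sup>2)" for x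
    unfolding norm_vec_def L2_set_def by (simp add: sum_nonneg)
  ultimately show ?thesis by (simp add: L2_def)
qed

lemma L2_bounded_mult:
  assumes w: "w \<in> L2 S" and m: "g \<in> borel_measurable (lebesgue_on S)" and b: "\<And>x. \<bar>g x\<bar> \<le> B"
  shows "(\<lambda>x. g x *\<^sub>R w x) \<in> L2 S"
proof -
  have "integrable (lebesgue_on S) (\<lambda>x. (norm (g x *\<^sub>R w x))\<^sup>2)"
  proof (rule Bochner_Integration.integrable_bound)
    show "integrable (lebesgue_on S) (\<lambda>x. B\<^sup>2 * (norm (w x))\<^sup>2)"
      using w by (simp add: L2_integrable_power2)
    show "(\<lambda>x. (norm (g x *\<^sub>R w x))\<^sup>2) \<in> borel_measurable (lebesgue_on S)"
      using w m by (auto simp: L2_def)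
    have "(g x)\<^sup>2 \<le> B\<^sup>2" for x using power_mono[OF b abs_ge_zero, of x 2] by simp
    then show "AE x in lebesgue_on S. norm ((norm (g x *\<^sub>R w x))\<^sup>2) \<le> norm (B\<^sup>2 * (norm (w x))\<^sup>2)"
      by (simp add: power_mult_distrib mult_right_mono)
  qed
  then show ?thesis using w m by (auto simp: L2_def)
qed

lemma L2_subset:
  assumes "v \<in> L2 S" "T \<subseteq> S" "T \<in> sets lebesgue" "S \<in> sets lebesgue"
  shows "v \<in> L2 T"
proof -
  have r: "lebesgue_on T = restrict_space (lebesgue_on S) T"
    using assms by (simp add: restrict_restrict_space Int_absorb1)
  have T: "T \<inter> space (lebesgue_on S) \<in> sets (lebesgue_on S)"
    using assms by (simp add: sets_restrict_space_iff)
  have "v \<in> borel_measurable (lebesgue_on T)"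
    using L2_measurable[OF assms(1)] unfolding r by (rule measurable_restrict_space1)
  moreover have "integrable (lebesgue_on T) (\<lambda>x. (norm (v x))\<^sup>2)"
    unfolding r integrable_restrict_space[OF T]
    using integrable_mult_indicator[OF _ L2_integrable_power2[OF assms(1)], of T] T assms(2)
    by (simp add: Int_absorb2)
  ultimately show ?thesis by (simp add: L2_def)
qed

lemma L2_inner_commute: "L2_inner S v w = L2_inner S w v"
  by (simp add: L2_inner_def inner_commute)

lemma L2_inner_add_left:
  "\<lbrakk>u \<in> L2 S; v \<in> L2 S; w \<in> L2 S\<rbrakk> \<Longrightarrow> L2_inner S (\<lambda>x. u x + v x) w = L2_inner S u w + L2_inner S v w"
  by (simp add: L2_inner_def inner_add_left L2_integrable_inner)

lemma L2_inner_diff_left: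
  "\<lbrakk>u \<in> L2 S; v \<in> L2 S; w \<in> L2 S\<rbrakk> \<Longrightarrow> L2_inner S (\<lambda>x. u x - v x) w = L2_inner S u w - L2_inner S v w"
  by (simp add: L2_inner_def inner_diff_left L2_integrable_inner)

lemma L2_inner_scaleR_left: "L2_inner S (\<lambda>x. r *\<^sub>R v x) w = r * L2_inner S v w"
  by (simp add: L2_inner_def)

lemma L2_inner_add_right:
  "\<lbrakk>u \<in> L2 S; v \<in> L2 S; w \<in> L2 S\<rbrakk> \<Longrightarrow> L2_inner S w (\<lambda>x. u x + v x) = L2_inner S w u + L2_inner S w v"
  by (simp add: L2_inner_def inner_add_right L2_integrable_inner)

lemma L2_inner_diff_right:
  "\<lbrakk>u \<in> L2 S; v \<in> L2 S; w \<in> L2 S\<rbrakk> \<Longrightarrow> L2_inner S w (\<lambda>x. u x - v x) = L2_inner S w u - L2_inner S w v"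
  by (simp add: L2_inner_def inner_diff_right L2_integrable_inner)

lemma L2_inner_scaleR_right: "L2_inner S w (\<lambda>x. r *\<^sub>R v x) = r * L2_inner S w v"
  by (simp add: L2_inner_def)

lemma L2_inner_zero [simp]: "L2_inner S (\<lambda>x. 0) w = 0" "L2_inner S w (\<lambda>x. 0) = 0"
  by (simp_all add: L2_inner_def)

lemma L2_norm_power2: "(L2_norm S v)\<^sup>2 = integral\<^sup>L (lebesgue_on S) (\<lambda>x. (norm (v x))\<^sup>2)"
  unfolding L2_norm_def by (rule real_sqrt_pow2) (simp add: integral_nonneg_AE)

lemma L2_norm_power2_inner: "(L2_norm S v)\<^sup>2 = L2_inner S v v"
  by (simp add: L2_norm_power2 L2_inner_def power2_norm_eq_inner)

lemma L2_norm_nonneg [simp]: "0 \<le> L2_norm S v"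
  unfolding L2_norm_def by (simp add: integral_nonneg_AE)

lemma L2_norm_scaleR: "L2_norm S (\<lambda>x. r *\<^sub>R v x) = \<bar>r\<bar> * L2_norm S v"
  by (simp add: L2_norm_def power_mult_distrib real_sqrt_mult)

lemma L2_norm_diff_power2:
  assumes "v \<in> L2 S" "w \<in> L2 S"
  shows "(L2_norm S (\<lambda>x. v x - w x))\<^sup>2 = (L2_norm S v)\<^sup>2 - 2 * L2_inner S v w + (L2_norm S w)\<^sup>2"
  using assms by (simp add: L2_norm_power2_inner L2_inner_diff_left L2_inner_diff_right L2_diff
      L2_inner_commute[of S w v])

lemma L2_norm_add_power2:
  assumes "v \<in> L2 S" "w \<in> L2 S"
  shows "(L2_norm S (\<lambda>x. v x + w x))\<^sup>2 = (L2_norm S v)\<^sup>2 + 2 * L2_inner S v w + (L2_norm S w)\<^sup>2"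
  using assms by (simp add: L2_norm_power2_inner L2_inner_add_left L2_inner_add_right L2_add
      L2_inner_commute[of S w v])

text \<open>Discriminant argument for the nonnegative quadratic in \<open>t\<close>.
  \<open>L2_norm\<close> is only a seminorm on functions, so the case of vanishing
  \<open>L2_norm S w\<close> needs its own treatment.\<close>

lemma L2_Cauchy_Schwarz:
  assumes v: "v \<in> L2 S" and w: "w \<in> L2 S"
  shows "\<bar>L2_inner S v w\<bar> \<le> L2_norm S v * L2_norm S w"
proof -
  have q: "0 \<le> (L2_norm S v)\<^sup>2 - 2 * t * L2_inner S v w + t\<^sup>2 * (L2_norm S w)\<^sup>2" for t
  proof -
    have "(L2_norm S (\<lambda>x. v x - t *\<^sub>R w x))\<^sup>2 = (L2_norm S v)\<^sup>2 - 2 * t * L2_inner S v w + t\<^sup>2 * (L2_norm S w)\<^sup>2"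
      unfolding L2_norm_diff_power2[OF v L2_scaleR[OF w]] L2_norm_scaleR L2_inner_scaleR_right
      by (simp add: power_mult_distrib)
    then show ?thesis by (metis zero_le_power2)
  qed
  have "(L2_inner S v w)\<^sup>2 \<le> (L2_norm S v)\<^sup>2 * (L2_norm S w)\<^sup>2"
  proof (cases "L2_norm S w = 0")
    case True
    have "L2_inner S v w = 0"
    proof (rule ccontr)
      assume ne: "L2_inner S v w \<noteq> 0"
      \<comment> \<open>With \<open>L2_norm S w = 0\<close> the quadratic is affine in
        \<open>t\<close>; this \<open>t\<close> gives it the value -1.\<close>
      show False
        using q[of "((L2_norm S v)\<^sup>2 + 1) / (2 * L2_inner S v w)"] ne True by (simp add: field_simps)
    qed
    then show ?thesis by simp
  next
    case False
    define N where "N = (L2_norm S w)\<^sup>2"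
    have N: "N > 0" using False by (simp add: N_def)
    have "0 \<le> N * ((L2_norm S v)\<^sup>2 - 2 * (L2_inner S v w / N) * L2_inner S v w + (L2_inner S v w / N)\<^sup>2 * N)"
      using q[of "L2_inner S v w / N"] N unfolding N_def[symmetric] by simp
    also have "\<dots> = (L2_norm S v)\<^sup>2 * N - (L2_inner S v w)\<^sup>2"
      using N by (simp add: field_simps power2_eq_square)
    finally show ?thesis by (simp add: N_def)
  qed
  then show ?thesis
    by (metis L2_norm_nonneg abs_le_square_iff abs_of_nonneg mult_nonneg_nonneg power_mult_distrib)
qed

lemma L2_norm_triangle:
  assumes v: "v \<in> L2 S" and w: "w \<in> L2 S"
  shows "L2_norm S (\<lambda>x. v x + w x) \<le> L2_norm S v + L2_norm S w"
proof (rule power2_le_imp_le)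
  show "(L2_norm S (\<lambda>x. v x + w x))\<^sup>2 \<le> (L2_norm S v + L2_norm S w)\<^sup>2"
    using L2_Cauchy_Schwarz[OF v w] unfolding L2_norm_add_power2[OF v w] by (simp add: power2_sum)
qed simp

lemma L2_norm_uminus: "L2_norm S (\<lambda>x. - v x) = L2_norm S v"
  by (simp add: L2_norm_def)

lemma L2_norm_triangle_diff:
  assumes "v \<in> L2 S" "w \<in> L2 S"
  shows "L2_norm S (\<lambda>x. v x - w x) \<le> L2_norm S v + L2_norm S w"
  using L2_norm_triangle[OF assms(1) L2_uminus[OF assms(2)]] by (simp add: L2_norm_uminus)

lemma L2_norm_eq_0_iff:
  assumes "v \<in> L2 S"
  shows "L2_norm S v = 0 \<longleftrightarrow> ae_eq S v (\<lambda>x. 0)"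
  using integral_nonneg_eq_0_iff_AE[OF L2_integrable_power2[OF assms]]
  by (simp add: L2_norm_def ae_eq_def)

lemma ae_eq_sym: "ae_eq S v w \<Longrightarrow> ae_eq S w v"
  by (auto simp: ae_eq_def)

lemma ae_eq_refl [simp]: "ae_eq S v v"
  by (simp add: ae_eq_def)

lemma ae_eq_trans: "ae_eq S u v \<Longrightarrow> ae_eq S v w \<Longrightarrow> ae_eq S u w"
  unfolding ae_eq_def by auto

lemma L2_inner_cong:
  assumes "ae_eq S v v'" "v \<in> L2 S" "v' \<in> L2 S" "w \<in> L2 S"
  shows "L2_inner S v w = L2_inner S v' w"
  unfolding L2_inner_def using assms
  by (intro integral_cong_AE) (auto simp: L2_def ae_eq_def)

lemma L2_norm_cong:
  assumes "ae_eq S v v'" "v \<in> L2 S" "v' \<in> L2 S"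
  shows "L2_norm S v = L2_norm S v'"
  unfolding L2_norm_def using assms
  by (intro arg_cong[where f=sqrt] integral_cong_AE) (auto simp: L2_def ae_eq_def)

lemma L2_const: "S \<in> lmeasurable \<Longrightarrow> (\<lambda>x. c) \<in> L2 S"
  using finite_measure.integrable_const[OF finite_measure_lebesgue_on] by (auto simp: L2_def)

lemma L2_bounded_function:
  assumes S: "S \<in> lmeasurable" and m: "g \<in> borel_measurable (lebesgue_on S)" and b: "\<And>x. norm (g x) \<le> B"
  shows "g \<in> L2 S"
proof -
  have "integrable (lebesgue_on S) (\<lambda>x. (norm (g x))\<^sup>2)"
  proof (rule finite_measure.integrable_const_bound[OF finite_measure_lebesgue_on[OF S], where B="B\<^sup>2"])
    show "AE x in lebesgue_on S. norm ((norm (g x))\<^sup>2) \<le> B\<^sup>2" using power_mono[OF b norm_ge_zero, of _ 2] by simp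
    show "(\<lambda>x. (norm (g x))\<^sup>2) \<in> borel_measurable (lebesgue_on S)" using m by simp
  qed
  with m show ?thesis by (simp add: L2_def)
qed

lemma L2_integrable:
  assumes "S \<in> lmeasurable" "v \<in> L2 S"
  shows "integrable (lebesgue_on S) v"
proof (rule Bochner_Integration.integrable_bound)
  show "integrable (lebesgue_on S) (\<lambda>x. (norm (v x))\<^sup>2 + 1)"
    by (rule Bochner_Integration.integrable_add[OF L2_integrable_power2[OF assms(2)]
        finite_measure.integrable_const[OF finite_measure_lebesgue_on[OF assms(1)]]])
  show "v \<in> borel_measurable (lebesgue_on S)" using assms by (simp add: L2_def)
  have "a \<le> a\<^sup>2 + 1" if "a \<ge> 0" for a :: real
  proof -
    have "0 \<le> (a - 1)\<^sup>2" by simp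
    then show ?thesis using that by (simp only: power2_diff power_one mult_1_right)
  qed
  then show "AE x in lebesgue_on S. norm (v x) \<le> norm ((norm (v x))\<^sup>2 + 1)"
    by simp
qed

lemma L2_norm_mono_set:
  assumes "v \<in> L2 S" "T \<subseteq> S" "T \<in> sets lebesgue" "S \<in> sets lebesgue"
  shows "L2_norm T v \<le> L2_norm S v"
proof -
  have "(\<integral>x. (norm (v x))\<^sup>2 \<partial>lebesgue_on T) \<le> (\<integral>x. (norm (v x))\<^sup>2 \<partial>lebesgue_on S)"
  proof -
    have "(\<integral>x. indicator T x *\<^sub>R (norm (v x))\<^sup>2 \<partial>lebesgue) \<le> (\<integral>x. indicator S x *\<^sub>R (norm (v x))\<^sup>2 \<partial>lebesgue)"
    proof (rule integral_mono)
      show "integrable lebesgue (\<lambda>x. indicator S x *\<^sub>R (norm (v x))\<^sup>2)"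
        using L2_integrable_power2[OF assms(1)] assms(4) by (simp add: integrable_restrict_space)
      show "integrable lebesgue (\<lambda>x. indicator T x *\<^sub>R (norm (v x))\<^sup>2)"
        using L2_integrable_power2[OF L2_subset[OF assms]] assms(3) by (simp add: integrable_restrict_space)
      show "indicator T x *\<^sub>R (norm (v x))\<^sup>2 \<le> indicator S x *\<^sub>R (norm (v x))\<^sup>2" for x
        using assms(2) by (auto simp: indicator_def)
    qed
    then show ?thesis
      using assms by (simp add: integral_restrict_space)
  qed
  then show ?thesis by (simp add: L2_norm_def)
qed

section \<open>Test functions\<close>

lemma pd_eqI: "(f has_derivative f') (at x) \<Longrightarrow> pd i f x = f' (axis i 1)"
  unfolding pd_def by (simp add: frechet_derivative_at[symmetric])

lemma differentiable_has_derivative_pd: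
  "f differentiable (at x) \<Longrightarrow> (f has_derivative frechet_derivative f (at x)) (at x)"
  by (simp add: frechet_derivative_works)

lemma C_k_continuous: "C_k k f \<Longrightarrow> continuous_on UNIV f"
  by (cases k) (auto simp: continuous_on_eq_continuous_at differentiable_imp_continuous_within)

lemma C_k_mono: "C_k (Suc k) f \<Longrightarrow> C_k k f"
proof (induction k arbitrary: f)
  case 0
  then show ?case using C_k_continuous by fastforce
next
  case (Suc k)
  then show ?case by (metis C_k.simps(2))
qed

lemma pd_add:
  assumes "f differentiable (at x)" "g differentiable (at x)"
  shows "pd i (\<lambda>x. f x + g x) x = pd i f x + pd i g x"
  using pd_eqI[OF has_derivative_add[OF assms[THEN differentiable_has_derivative_pd]]]
  by (simp add: pd_def)

lemma pd_bounded_linear: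
  assumes F: "bounded_linear F" and "f differentiable (at x)"
  shows "pd i (\<lambda>x. F (f x)) x = F (pd i f x)"
  using pd_eqI[OF bounded_linear.has_derivative[OF F differentiable_has_derivative_pd[OF assms(2)]]]
  by (simp add: pd_def)

lemma pd_mult:
  fixes f g :: "real^'n \<Rightarrow> real"
  assumes "f differentiable (at x)" "g differentiable (at x)"
  shows "pd i (\<lambda>x. f x * g x) x = f x * pd i g x + pd i f x * g x"
  using pd_eqI[OF has_derivative_mult[OF assms[THEN differentiable_has_derivative_pd]]]
  by (simp add: pd_def)

lemma pd_const [simp]: "pd i (\<lambda>x. c) x = 0"
  by (rule pd_eqI[OF has_derivative_const])

lemma C_k_const [simp]: "C_k k (\<lambda>x. c)"
proof (induction k arbitrary: c)
  case (Suc k)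
  have "pd i (\<lambda>x::real^'a. c) = (\<lambda>x. 0)" for i by (rule ext) simp
  then show ?case using Suc by simp
qed simp

lemma C_k_add: "C_k k f \<Longrightarrow> C_k k g \<Longrightarrow> C_k k (\<lambda>x. f x + g x)"
proof (induction k arbitrary: f g)
  case 0 then show ?case by (auto intro: continuous_on_add)
next
  case (Suc k)
  then have "pd i (\<lambda>x. f x + g x) = (\<lambda>x. pd i f x + pd i g x)" for i
    by (intro ext pd_add) auto
  then show ?case using Suc by (auto intro: differentiable_add)
qed

lemma C_k_bounded_linear: "bounded_linear F \<Longrightarrow> C_k k f \<Longrightarrow> C_k k (\<lambda>x. F (f x))"
proof (induction k arbitrary: f)
  case 0 then show ?case by (auto intro: bounded_linear.continuous_on)
next
  case (Suc k)
  then have "pd i (\<lambda>x. F (f x)) = (\<lambda>x. F (pd i f x))" for i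
    by (intro ext pd_bounded_linear) auto
  then show ?case using Suc by (auto intro: differentiable_compose[where f=F] bounded_linear_imp_differentiable)
qed

lemma C_k_mult:
  fixes f g :: "real^'n \<Rightarrow> real"
  shows "C_k k f \<Longrightarrow> C_k k g \<Longrightarrow> C_k k (\<lambda>x. f x * g x)"
proof (induction k arbitrary: f g)
  case 0 then show ?case by (auto intro: continuous_on_mult)
next
  case (Suc k)
  then have "pd i (\<lambda>x. f x * g x) = (\<lambda>x. f x * pd i g x + pd i f x * g x)" for i
    by (intro ext pd_mult) auto
  moreover have "C_k k f" "C_k k g" using Suc.prems C_k_mono by auto
  ultimately show ?case using Suc by (auto intro!: C_k_add differentiable_mult)
qed

lemma C_k_prod:
  fixes f :: "'i \<Rightarrow> real^'n \<Rightarrow> real"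
  assumes "\<And>i. i \<in> I \<Longrightarrow> C_k k (f i)"
  shows "C_k k (\<lambda>x. \<Prod>i\<in>I. f i x)"
  using assms by (induction I rule: infinite_finite_induct) (auto intro: C_k_mult)

lemma pd_line:
  fixes f :: "real^'n \<Rightarrow> real"
  assumes "\<And>x. f differentiable (at x)"
  shows "((\<lambda>t. f (y + t *\<^sub>R axis i 1)) has_real_derivative pd i f (y + t *\<^sub>R axis i 1)) (at t)"
proof -
  have "((\<lambda>t. f (y + t *\<^sub>R axis i 1)) has_derivative
      (\<lambda>h. frechet_derivative f (at (y + t *\<^sub>R axis i 1)) (h *\<^sub>R axis i 1))) (at t)"
    by (rule has_derivative_compose[of "\<lambda>t. y + t *\<^sub>R axis i 1" "\<lambda>h. h *\<^sub>R axis i 1", OF _ differentiable_has_derivative_pd[OF assms]])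
       (auto intro!: derivative_eq_intros)
  moreover have "linear (frechet_derivative f (at (y + t *\<^sub>R axis i 1)))"
    using assms by (rule linear_frechet_derivative)
  ultimately show ?thesis
    by (simp add: has_field_derivative_def pd_def linear_cmul mult_commute_abs)
qed

text \<open>Two mean value steps: first along \<open>i\<close> for the increment of \<open>f\<close>
  in direction \<open>j\<close>, then along \<open>j\<close> for \<open>pd i f\<close>.\<close>

lemma pd_pd_second_difference:
  fixes f :: "real^'n \<Rightarrow> real"
  assumes "C_k (Suc (Suc 0)) f" "0 < h"
  shows "\<exists>s t. 0 < s \<and> s < h \<and> 0 < t \<and> t < h \<and>
    f (x + h *\<^sub>R axis i 1 + h *\<^sub>R axis j 1) - f (x + h *\<^sub>R axis i 1) - f (x + h *\<^sub>R axis j 1) + f x =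
    h\<^sup>2 * pd j (pd i f) (x + s *\<^sub>R axis i 1 + t *\<^sub>R axis j 1)"
proof -
  have df: "\<And>x. f differentiable (at x)" and dp: "\<And>x. pd i f differentiable (at x)"
    using assms(1) by auto
  define g where "g t = f ((x + h *\<^sub>R axis j 1) + t *\<^sub>R axis i 1) - f (x + t *\<^sub>R axis i 1)" for t
  define g' where "g' t = pd i f ((x + h *\<^sub>R axis j 1) + t *\<^sub>R axis i 1) - pd i f (x + t *\<^sub>R axis i 1)" for t
  have "(g has_real_derivative g' t) (at t)" for t
    unfolding g_def[abs_def] g'_def by (intro DERIV_diff pd_line df)
  then obtain s where s: "0 < s" "s < h" "g h - g 0 = (h - 0) * g' s"
    using MVT2[of 0 h g g'] assms(2) by auto
  define k where "k t = pd i f ((x + s *\<^sub>R axis i 1) + t *\<^sub>R axis j 1)" for t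
  have "(k has_real_derivative pd j (pd i f) ((x + s *\<^sub>R axis i 1) + t *\<^sub>R axis j 1)) (at t)" for t
    unfolding k_def[abs_def] by (intro pd_line dp)
  then obtain t where t: "0 < t" "t < h"
    "k h - k 0 = (h - 0) * pd j (pd i f) ((x + s *\<^sub>R axis i 1) + t *\<^sub>R axis j 1)"
    using MVT2[of 0 h k "\<lambda>t. pd j (pd i f) ((x + s *\<^sub>R axis i 1) + t *\<^sub>R axis j 1)"] assms(2) by auto
  have "g' s = k h - k 0" by (simp add: g'_def k_def add.commute add.left_commute)
  moreover have "g h - g 0 = f (x + h *\<^sub>R axis i 1 + h *\<^sub>R axis j 1) - f (x + h *\<^sub>R axis i 1) - f (x + h *\<^sub>R axis j 1) + f x"
    by (simp add: g_def add.commute add.left_commute)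
  ultimately show ?thesis using s t
    by (intro exI[of _ s] exI[of _ t]) (simp add: power2_eq_square)
qed

text \<open>The second difference is symmetric in \<open>i\<close> and \<open>j\<close>, so both
  mixed derivatives agree at suitable points within distance \<open>2 * h\<close> of
  \<open>x\<close>; continuity carries the equality to \<open>x\<close> itself. It is what makes the
  rotation of a gradient vanish.\<close>

lemma pd_pd_commute:
  fixes f :: "real^'n \<Rightarrow> real"
  assumes "C_k (Suc (Suc 0)) f"
  shows "pd i (pd j f) x = pd j (pd i f) x"
proof -
  have c: "isCont (pd i (pd j f)) x" "isCont (pd j (pd i f)) x"
    using assms by (auto simp: continuous_on_eq_continuous_at)
  have "\<bar>pd i (pd j f) x - pd j (pd i f) x\<bar> \<le> 2 * e" if "e > 0" for e
  proof -
    obtain d1 where d1: "d1 > 0" "\<And>y. dist y x < d1 \<Longrightarrow> \<bar>pd i (pd j f) y - pd i (pd j f) x\<bar> < e"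
      using c(1) \<open>e > 0\<close> by (auto simp: continuous_at_eps_delta dist_real_def)
    obtain d2 where d2: "d2 > 0" "\<And>y. dist y x < d2 \<Longrightarrow> \<bar>pd j (pd i f) y - pd j (pd i f) x\<bar> < e"
      using c(2) \<open>e > 0\<close> by (auto simp: continuous_at_eps_delta dist_real_def)
    define h where "h = min d1 d2 / 2"
    have h: "h > 0" "2 * h \<le> d1" "2 * h \<le> d2" using d1 d2 by (auto simp: h_def)
    obtain s t where st: "0 < s" "s < h" "0 < t" "t < h"
      "f (x + h *\<^sub>R axis i 1 + h *\<^sub>R axis j 1) - f (x + h *\<^sub>R axis i 1) - f (x + h *\<^sub>R axis j 1) + f x =
       h\<^sup>2 * pd j (pd i f) (x + s *\<^sub>R axis i 1 + t *\<^sub>R axis j 1)"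
      using pd_pd_second_difference[OF assms h(1)] by blast
    obtain s' t' where st': "0 < s'" "s' < h" "0 < t'" "t' < h"
      "f (x + h *\<^sub>R axis j 1 + h *\<^sub>R axis i 1) - f (x + h *\<^sub>R axis j 1) - f (x + h *\<^sub>R axis i 1) + f x =
       h\<^sup>2 * pd i (pd j f) (x + s' *\<^sub>R axis j 1 + t' *\<^sub>R axis i 1)"
      using pd_pd_second_difference[OF assms h(1)] by blast
    have "h\<^sup>2 * pd j (pd i f) (x + s *\<^sub>R axis i 1 + t *\<^sub>R axis j 1) =
        h\<^sup>2 * pd i (pd j f) (x + s' *\<^sub>R axis j 1 + t' *\<^sub>R axis i 1)"
      unfolding st(5)[symmetric] st'(5)[symmetric] by (simp add: algebra_simps)
    then have eq: "pd j (pd i f) (x + s *\<^sub>R axis i 1 + t *\<^sub>R axis j 1) =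
        pd i (pd j f) (x + s' *\<^sub>R axis j 1 + t' *\<^sub>R axis i 1)"
      using h(1) by simp
    have near: "dist (x + a *\<^sub>R axis k 1 + b *\<^sub>R axis l 1) x < 2 * h"
      if "0 < a" "a < h" "0 < b" "b < h" for a b and k l :: 'n
    proof -
      have "norm (a *\<^sub>R axis k 1 + b *\<^sub>R axis l (1::real)) \<le> a + b"
        by (rule order_trans[OF norm_triangle_ineq]) (use that in simp)
      then show ?thesis using that by (simp add: dist_norm add.assoc)
    qed
    have "\<bar>pd j (pd i f) (x + s *\<^sub>R axis i 1 + t *\<^sub>R axis j 1) - pd j (pd i f) x\<bar> < e"
      using near[of s t i j] st h by (intro d2) simp
    moreover have "\<bar>pd i (pd j f) (x + s' *\<^sub>R axis j 1 + t' *\<^sub>R axis i 1) - pd i (pd j f) x\<bar> < e"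
      using near[of s' t' j i] st' h by (intro d1) simp
    ultimately show ?thesis using eq by linarith
  qed
  \<comment> \<open>A quarter of the gap as \<epsilon> bounds the gap by half of itself.\<close>
  from this[of "\<bar>pd i (pd j f) x - pd j (pd i f) x\<bar> / 4"] show ?thesis
    by (cases "pd i (pd j f) x = pd j (pd i f) x") auto
qed

section \<open>Compactly supported smooth functions\<close>

lemma test_functions_smooth: "\<phi> \<in> test_functions S \<Longrightarrow> C_k k \<phi>"
  by (simp add: test_functions_def)

lemma test_functions_differentiable: "\<phi> \<in> test_functions S \<Longrightarrow> \<phi> differentiable (at x)"
  using test_functions_smooth[of \<phi> S "Suc 0"] by simp

lemma test_functions_continuous: "\<phi> \<in> test_functions S \<Longrightarrow> continuous_on UNIV \<phi>"
  using test_functions_smooth[of \<phi> S 0] by simp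

lemma test_functions_zero_outside: "\<phi> \<in> test_functions S \<Longrightarrow> x \<notin> S \<Longrightarrow> \<phi> x = 0"
  using closure_subset[of "{x. \<phi> x \<noteq> 0}"] by (force simp: test_functions_def)

text \<open>Supports are compared with that of a known test function, from which compactness and
  inclusion in \<open>S\<close> are inherited.\<close>

lemma test_functionsI:
  assumes "\<phi> \<in> test_functions S" "\<And>k. C_k k \<psi>" "\<And>x. x \<notin> closure {x. \<phi> x \<noteq> 0} \<Longrightarrow> \<psi> x = 0"
  shows "\<psi> \<in> test_functions S"
proof -
  have "{x. \<psi> x \<noteq> 0} \<subseteq> closure {x. \<phi> x \<noteq> 0}" using assms(3) by blast
  then have s: "closure {x. \<psi> x \<noteq> 0} \<subseteq> closure {x. \<phi> x \<noteq> 0}" by (simp add: closure_minimal)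
  moreover have "compact (closure {x. \<psi> x \<noteq> 0})"
    using assms(1) s unfolding test_functions_def
    by (metis (mono_tags, lifting) closed_closure compact_Int_closed inf.absorb_iff2 mem_Collect_eq)
  ultimately show ?thesis using assms by (auto simp: test_functions_def)
qed

lemma test_functions_mono: "S \<subseteq> S' \<Longrightarrow> \<phi> \<in> test_functions S \<Longrightarrow> \<phi> \<in> test_functions S'"
  by (auto simp: test_functions_def)

lemma zero_not_in_support: "x \<notin> closure {x. \<phi> x \<noteq> 0} \<Longrightarrow> \<phi> x = 0"
  using closure_subset[of "{x. \<phi> x \<noteq> 0}"] by blast

lemma test_functions_pd:
  assumes "\<phi> \<in> test_functions S"
  shows "pd i \<phi> \<in> test_functions S"
proof (rule test_functionsI[OF assms])
  show "C_k k (pd i \<phi>)" for k using test_functions_smooth[OF assms, of "Suc k"] by simp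
  fix x assume x: "x \<notin> closure {x. \<phi> x \<noteq> 0}"
  have "(\<phi> has_derivative (\<lambda>h. 0)) (at x)"
  proof (rule has_derivative_transform_within_open[where f="\<lambda>x. 0"])
    show "open (- closure {x. \<phi> x \<noteq> 0})" by (intro open_Compl closed_closure)
    show "0 = \<phi> y" if "y \<in> - closure {x. \<phi> x \<noteq> 0}" for y using that zero_not_in_support by fastforce
  qed (use x in auto)
  then show "pd i \<phi> x = 0" by (simp add: pd_eqI)
qed

lemma test_functions_bounded_linear:
  assumes "\<phi> \<in> test_functions S" "bounded_linear F"
  shows "(\<lambda>x. F (\<phi> x)) \<in> test_functions S"
proof (rule test_functionsI[OF assms(1)])
  show "C_k k (\<lambda>x. F (\<phi> x))" for k
    by (rule C_k_bounded_linear[OF assms(2) test_functions_smooth[OF assms(1)]])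
  show "F (\<phi> x) = 0" if "x \<notin> closure {x. \<phi> x \<noteq> 0}" for x
    using zero_not_in_support[OF that] assms(2) by (simp add: bounded_linear.linear linear_0)
qed

lemma test_functions_mult:
  fixes \<phi> :: "real^'n \<Rightarrow> real"
  assumes "\<phi> \<in> test_functions S" "\<And>k. C_k k \<psi>"
  shows "(\<lambda>x. \<phi> x * \<psi> x) \<in> test_functions S"
proof (rule test_functionsI[OF assms(1)])
  show "C_k k (\<lambda>x. \<phi> x * \<psi> x)" for k
    by (rule C_k_mult[OF test_functions_smooth[OF assms(1)] assms(2)])
  show "\<phi> x * \<psi> x = 0" if "x \<notin> closure {x. \<phi> x \<noteq> 0}" for x
    using zero_not_in_support[OF that] by simp
qed

lemma test_functions_add:
  assumes "\<phi> \<in> test_functions S" "\<psi> \<in> test_functions S"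
  shows "(\<lambda>x. \<phi> x + \<psi> x) \<in> test_functions S"
proof -
  let ?K = "closure {x. \<phi> x \<noteq> 0} \<union> closure {x. \<psi> x \<noteq> 0}"
  have K: "compact ?K" "?K \<subseteq> S" using assms by (auto simp: test_functions_def)
  have "{x. \<phi> x + \<psi> x \<noteq> 0} \<subseteq> ?K"
  proof
    fix x assume "x \<in> {x. \<phi> x + \<psi> x \<noteq> 0}"
    then have "\<phi> x \<noteq> 0 \<or> \<psi> x \<noteq> 0" by auto
    then show "x \<in> ?K" using zero_not_in_support[of x \<phi>] zero_not_in_support[of x \<psi>] by blast
  qed
  then have s: "closure {x. \<phi> x + \<psi> x \<noteq> 0} \<subseteq> ?K" using K by (simp add: closure_minimal compact_imp_closed)
  then have "compact (closure {x. \<phi> x + \<psi> x \<noteq> 0})"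
    using compact_Int_closed[OF K(1) closed_closure, of "{x. \<phi> x + \<psi> x \<noteq> 0}"] by (simp add: Int_absorb1)
  moreover have "C_k k (\<lambda>x. \<phi> x + \<psi> x)" for k
    by (rule C_k_add[OF assms[THEN test_functions_smooth]])
  ultimately show ?thesis using order_trans[OF s K(2)] by (simp add: test_functions_def)
qed

lemma test_functions_zero [simp]: "(\<lambda>x. 0) \<in> test_functions S"
  by (simp add: test_functions_def)

lemma test_functions_bounded:
  assumes "\<phi> \<in> test_functions S"
  obtains B where "\<And>x. norm (\<phi> x) \<le> B" "B \<ge> 0"
proof -
  let ?K = "closure {x. \<phi> x \<noteq> 0}"
  have "compact (\<phi> ` ?K)"
    using assms by (intro compact_continuous_image continuous_on_subset[OF test_functions_continuous])
      (auto simp: test_functions_def)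
  then obtain B where B: "\<And>y. y \<in> \<phi> ` ?K \<Longrightarrow> norm y \<le> B" "B > 0"
    using compact_imp_bounded bounded_pos by metis
  have "norm (\<phi> x) \<le> B" for x
    using B zero_not_in_support[of x \<phi>] by (cases "x \<in> ?K") auto
  then show ?thesis using that B(2) by force
qed

lemma test_functions_L2:
  assumes "\<phi> \<in> test_functions S" "T \<in> lmeasurable"
  shows "\<phi> \<in> L2 T"
proof -
  obtain B where "\<And>x. norm (\<phi> x) \<le> B" using test_functions_bounded[OF assms(1)] by blast
  moreover have "\<phi> \<in> borel_measurable (lebesgue_on T)"
    using test_functions_continuous[OF assms(1)] assms(2)
    by (metis continuous_imp_measurable_on_sets_lebesgue continuous_on_subset fmeasurableD subset_UNIV)
  ultimately show ?thesis using assms(2) by (intro L2_bounded_function) auto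
qed

text \<open>Passes from the restricted complete measure to \<open>lborel\<close>, where translation
  invariance is available.\<close>

lemma integral_eq_lborel_if_zero_outside:
  fixes f :: "'a::euclidean_space \<Rightarrow> 'b::euclidean_space"
  assumes "S \<in> sets lebesgue" "\<And>x. x \<notin> S \<Longrightarrow> f x = 0" "continuous_on UNIV f"
  shows "integral\<^sup>L (lebesgue_on S) f = integral\<^sup>L lborel f"
proof -
  have "indicator S x *\<^sub>R f x = f x" for x using assms(2) by (cases "x \<in> S") auto
  then have "integral\<^sup>L (lebesgue_on S) f = integral\<^sup>L lebesgue f"
    using assms(1) by (simp add: integral_restrict_space)
  also have "\<dots> = integral\<^sup>L lborel f"
    using assms(3) by (intro integral_completion) (simp add: borel_measurable_continuous_onI)
  finally show ?thesis .
qed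

text \<open>Difference quotients in direction \<open>i\<close> have integral zero because Lebesgue
  measure is translation invariant, and dominated convergence carries this to the derivative. This
  replaces iterated integration, and it is the source of every integration by parts below.\<close>

lemma integral_pd_eq_0:
  fixes \<phi> :: "real^'n \<Rightarrow> real"
  assumes \<phi>: "\<phi> \<in> test_functions S" and S: "S \<in> sets lebesgue"
  shows "integral\<^sup>L (lebesgue_on S) (pd i \<phi>) = 0"
proof -
  have cont: "continuous_on UNIV \<phi>" "continuous_on UNIV (pd i \<phi>)"
    using test_functions_continuous[OF \<phi>] test_functions_continuous[OF test_functions_pd[OF \<phi>]] by auto
  obtain B where B: "\<And>x. norm (pd i \<phi> x) \<le> B" "B \<ge> 0"
    using test_functions_bounded[OF test_functions_pd[OF \<phi>]] by blast
  have "compact (closure {x. \<phi> x \<noteq> 0})" using \<phi> by (simp add: test_functions_def)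
  then obtain R where R: "\<And>x. x \<in> closure {x. \<phi> x \<noteq> 0} \<Longrightarrow> norm x \<le> R"
    using compact_imp_bounded bounded_iff by metis
  define e :: "real^'n" where "e = axis i 1"
  \<comment> \<open>Steps of length at most 1 keep all difference quotients supported in the ball of
    radius \<open>R + 1\<close>, so that a single dominating function serves.\<close>
  define t where "t n = inverse (real (Suc n))" for n
  have t: "0 < t n" "t n \<le> 1" for n by (auto simp: t_def divide_simps)
  define q where "q n x = (\<phi> (x + t n *\<^sub>R e) - \<phi> x) / t n" for n x
  have zero: "\<phi> x = 0" if "norm x > R" for x
    using zero_not_in_support[of x \<phi>] R[of x] that by fastforce
  have supp: "integrable lborel \<phi>"
  proof -
    have "\<phi> = (\<lambda>x. indicator (cball 0 R) x *\<^sub>R \<phi> x)"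
      using zero by (auto simp: indicator_def fun_eq_iff)
    moreover have "integrable lborel (\<lambda>x. indicator (cball 0 R) x *\<^sub>R \<phi> x)"
      using cont by (intro borel_integrable_compact continuous_on_subset[OF cont(1)]) auto
    ultimately show ?thesis by simp
  qed
  have q0: "integral\<^sup>L lborel (q n) = 0" for n
  proof -
    have shift: "integrable lborel (\<lambda>x. \<phi> (t n *\<^sub>R e + 1 *\<^sub>R x))"
      "integral\<^sup>L lborel (\<lambda>x. \<phi> (t n *\<^sub>R e + x)) = integral\<^sup>L lborel \<phi>"
    proof -
      have d: "lborel = distr lborel borel (\<lambda>x. t n *\<^sub>R e + x)" by (rule lborel_distr_plus[symmetric])
      have m: "\<phi> \<in> borel_measurable borel" using cont by (simp add: borel_measurable_continuous_onI)
      show "integral\<^sup>L lborel (\<lambda>x. \<phi> (t n *\<^sub>R e + x)) = integral\<^sup>L lborel \<phi>"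
        using integral_distr[of "\<lambda>x. t n *\<^sub>R e + x" lborel borel \<phi>] m d by simp
      show "integrable lborel (\<lambda>x. \<phi> (t n *\<^sub>R e + 1 *\<^sub>R x))"
        using integrable_distr_eq[of "\<lambda>x. t n *\<^sub>R e + x" lborel borel \<phi>] m d supp by simp
    qed
    have "integral\<^sup>L lborel (\<lambda>x. \<phi> (t n *\<^sub>R e + x) - \<phi> x) = 0"
      using shift supp by (subst Bochner_Integration.integral_diff) auto
    then show ?thesis unfolding q_def by (simp add: add.commute)
  qed
  have "(\<lambda>n. integral\<^sup>L lborel (q n)) \<longlonglongrightarrow> integral\<^sup>L lborel (pd i \<phi>)"
  proof (rule integral_dominated_convergence[where w="\<lambda>x. indicator (cball 0 (R + 1)) x *\<^sub>R B"])
    show "pd i \<phi> \<in> borel_measurable lborel" using cont by (simp add: borel_measurable_continuous_onI)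
    have "continuous_on UNIV (q n)" for n
      unfolding q_def by (intro continuous_intros continuous_on_compose2[OF cont(1)]) (use t[of n] in auto)
    then show "q n \<in> borel_measurable lborel" for n by (simp add: borel_measurable_continuous_onI)
    show "integrable lborel (\<lambda>x. indicator (cball (0::real^'n) (R + 1)) x *\<^sub>R B)"
      by (rule borel_integrable_compact) auto
    have D: "((\<lambda>s. \<phi> (x + s *\<^sub>R e)) has_real_derivative pd i \<phi> (x + s *\<^sub>R e)) (at s)" for x s
      unfolding e_def by (rule pd_line) (rule test_functions_differentiable[OF \<phi>])
    have "(\<lambda>n. q n x) \<longlonglongrightarrow> pd i \<phi> x" for x
    proof -
      have "((\<lambda>s. (\<phi> (x + s *\<^sub>R e) - \<phi> x) / s) \<longlongrightarrow> pd i \<phi> x) (at 0)"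
        using D[of x 0] by (simp add: has_field_derivative_iff)
      moreover have "filterlim t (at 0) sequentially"
        unfolding filterlim_at t_def using LIMSEQ_inverse_real_of_nat by (auto intro: always_eventually)
      ultimately show ?thesis unfolding q_def by (rule filterlim_compose)
    qed
    then show "AE x in lborel. (\<lambda>n. q n x) \<longlonglongrightarrow> pd i \<phi> x" by simp
    have "norm (q n x) \<le> indicator (cball 0 (R + 1)) x *\<^sub>R B" for n x
    proof (cases "norm x \<le> R + 1")
      case True
      obtain z where "\<phi> (x + t n *\<^sub>R e) - \<phi> (x + 0 *\<^sub>R e) = (t n - 0) * pd i \<phi> (x + z *\<^sub>R e)"
        using MVT2[of 0 "t n" "\<lambda>s. \<phi> (x + s *\<^sub>R e)" "\<lambda>s. pd i \<phi> (x + s *\<^sub>R e)"] D t by blast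
      then have "q n x = pd i \<phi> (x + z *\<^sub>R e)" using t[of n] by (simp add: q_def)
      then show ?thesis using B True by (simp add: indicator_def)
    next
      case False
      have "norm x \<le> norm (x + t n *\<^sub>R e) + norm (t n *\<^sub>R e)"
        using norm_triangle_ineq4[of "x + t n *\<^sub>R e" "t n *\<^sub>R e"] by simp
      then have "norm (x + t n *\<^sub>R e) > R" using False t[of n] by (simp add: e_def)
      then show ?thesis using zero False by (simp add: q_def)
    qed
    then show "AE x in lborel. norm (q n x) \<le> indicator (cball 0 (R + 1)) x *\<^sub>R B" for n by simp
  qed
  then have "integral\<^sup>L lborel (pd i \<phi>) = 0" using q0 by (simp add: LIMSEQ_const_iff)
  then show ?thesis
    using integral_eq_lborel_if_zero_outside[OF S _ cont(2)] test_functions_zero_outside[OF test_functions_pd[OF \<phi>]]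
    by simp
qed

lemma test_functions_integration_by_parts:
  fixes \<phi> \<psi> :: "real^'n \<Rightarrow> real"
  assumes \<phi>: "\<phi> \<in> test_functions S" and \<psi>: "\<psi> \<in> test_functions S" and S: "S \<in> lmeasurable"
  shows "integral\<^sup>L (lebesgue_on S) (\<lambda>x. pd i \<phi> x * \<psi> x) = - integral\<^sup>L (lebesgue_on S) (\<lambda>x. \<phi> x * pd i \<psi> x)"
proof -
  have "pd i (\<lambda>x. \<phi> x * \<psi> x) = (\<lambda>x. \<phi> x * pd i \<psi> x + pd i \<phi> x * \<psi> x)"
    using test_functions_differentiable[OF \<phi>] test_functions_differentiable[OF \<psi>] by (intro ext pd_mult)
  moreover have "(\<lambda>x. \<phi> x * \<psi> x) \<in> test_functions S"
    by (rule test_functions_mult[OF \<phi> test_functions_smooth[OF \<psi>]])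
  ultimately have "integral\<^sup>L (lebesgue_on S) (\<lambda>x. \<phi> x * pd i \<psi> x + pd i \<phi> x * \<psi> x) = 0"
    using integral_pd_eq_0[of "\<lambda>x. \<phi> x * \<psi> x" S i] S by (simp add: fmeasurableD)
  moreover have "integrable (lebesgue_on S) (\<lambda>x. pd i \<phi> x * \<psi> x)" "integrable (lebesgue_on S) (\<lambda>x. \<phi> x * pd i \<psi> x)"
    using L2_integrable_inner[OF test_functions_L2[OF test_functions_pd[OF \<phi>] S, of i] test_functions_L2[OF \<psi> S]]
      L2_integrable_inner[OF test_functions_L2[OF \<phi> S] test_functions_L2[OF test_functions_pd[OF \<psi>] S, of i]]
    by simp_all
  ultimately show ?thesis by simp
qed

section \<open>Smooth bumps on boxes\<close>

text \<open>The family is closed under differentiation up to linear combinations, which makes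
  \<open>exp (- 1 / t)\<close> smooth.\<close>

definition exp_bump :: "nat \<Rightarrow> real \<Rightarrow> real" where
  "exp_bump m t = (if t > 0 then (1 / t) ^ m * exp (- (1 / t)) else 0)"

lemma tendsto_power_mult_exp_neg_inverse:
  "((\<lambda>t::real. (1 / t) ^ m * exp (- (1 / t))) \<longlongrightarrow> 0) (at_right 0)"
proof -
  have "((\<lambda>t::real. inverse t ^ m / exp (inverse t)) \<longlongrightarrow> 0) (at_right 0)"
    by (rule filterlim_compose[OF tendsto_power_div_exp_0 filterlim_inverse_at_top_right])
  then show ?thesis by (simp add: exp_minus field_simps)
qed

lemma exp_bump_has_derivative:
  "(exp_bump m has_real_derivative (exp_bump (m + 2) t - real m * exp_bump (m + 1) t)) (at t)"
proof -
  consider "t > 0" | "t < 0" | "t = 0" by linarith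
  then show ?thesis
  proof cases
    case 1
    have "((\<lambda>t. (1 / t) ^ m * exp (- (1 / t))) has_real_derivative
        (exp_bump (m + 2) t - real m * exp_bump (m + 1) t)) (at t)"
    proof -
      have "((\<lambda>y. y ^ m * exp (- y)) has_real_derivative (real m * y ^ (m - 1) * exp (- y) - y ^ m * exp (- y))) (at y)" for y
        by (auto intro!: derivative_eq_intros)
      moreover have "((\<lambda>t. 1 / t) has_real_derivative - (1 / t)\<^sup>2) (at t)"
        using 1 by (auto intro!: derivative_eq_intros simp: power2_eq_square)
      ultimately have "((\<lambda>t. (1 / t) ^ m * exp (- (1 / t))) has_real_derivative
          (real m * (1 / t) ^ (m - 1) * exp (- (1 / t)) - (1 / t) ^ m * exp (- (1 / t))) * - (1 / t)\<^sup>2) (at t)"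
        by (rule DERIV_chain2)
      moreover have "(real m * y ^ (m - 1) * e - y ^ m * e) * - y\<^sup>2 = y ^ (m + 2) * e - real m * (y ^ (m + 1) * e)"
        for y e :: real by (cases m) (simp_all add: power2_eq_square algebra_simps)
      ultimately show ?thesis using 1 by (simp only: exp_bump_def if_True)
    qed
    then show ?thesis
      by (rule DERIV_cong_ev[THEN iffD1, rotated -1, OF _ refl _ refl])
        (use 1 in \<open>auto simp: exp_bump_def eventually_nhds intro!: exI[of _ "{0<..}"]\<close>)
  next
    case 2
    have "((\<lambda>t::real. 0::real) has_real_derivative 0) (at t)" by simp
    then have "(exp_bump m has_real_derivative 0) (at t)"
      by (rule DERIV_cong_ev[THEN iffD1, rotated -1, OF _ refl _ refl])
        (use 2 in \<open>auto simp: exp_bump_def eventually_nhds intro!: exI[of _ "{..<0}"]\<close>)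
    then show ?thesis using 2 by (simp add: exp_bump_def)
  next
    \<comment> \<open>At 0 the right difference quotient of \<open>exp_bump m\<close> is again a
      power of \<open>1 / h\<close> times the exponential, with exponent \<open>Suc m\<close>; the
      left one is eventually 0.\<close>
    case 3
    have "((\<lambda>h. (exp_bump m (0 + h) - exp_bump m 0) / h) \<longlongrightarrow> 0) (at_left 0)"
      by (rule tendsto_eventually) (auto simp: eventually_at_filter exp_bump_def)
    moreover have "((\<lambda>h. (exp_bump m (0 + h) - exp_bump m 0) / h) \<longlongrightarrow> 0) (at_right 0)"
      by (rule Lim_transform_eventually[OF tendsto_power_mult_exp_neg_inverse[of "Suc m"]])
         (auto simp: eventually_at_filter exp_bump_def)
    ultimately have "(exp_bump m has_real_derivative 0) (at 0)"
      by (simp add: has_field_derivative_iff filterlim_at_split)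
    then show ?thesis using 3 by (simp add: exp_bump_def)
  qed
qed

lemma C_k_exp_bump:
  fixes i :: "'n::finite"
  shows "C_k k (\<lambda>x::real^'n. exp_bump m (c * x $ i + d))"
proof (induction k arbitrary: m)
  case 0
  have "continuous_on UNIV (exp_bump m)"
    using exp_bump_has_derivative by (intro DERIV_continuous_on) (auto intro: has_field_derivative_at_within)
  then show ?case by (auto intro!: continuous_on_compose2[of UNIV "exp_bump m"] continuous_intros)
next
  case (Suc k)
  have D: "((\<lambda>x::real^'n. exp_bump m (c * x $ i + d)) has_derivative
      (\<lambda>h. (exp_bump (m + 2) (c * x $ i + d) - real m * exp_bump (m + 1) (c * x $ i + d)) * (c * h $ i))) (at x)" for x
  proof -
    have "((\<lambda>x::real^'n. c * x $ i + d) has_derivative (\<lambda>h. c * h $ i)) (at x)"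
      by (auto intro!: derivative_eq_intros bounded_linear_imp_has_derivative bounded_linear_vec_nth)
    from has_derivative_compose[OF this, of "exp_bump m"] show ?thesis
      using exp_bump_has_derivative by (simp add: has_field_derivative_def)
  qed
  have pd: "pd j (\<lambda>x::real^'n. exp_bump m (c * x $ i + d)) =
    (\<lambda>x. (c * (if i = j then 1 else 0)) * exp_bump (m + 2) (c * x $ i + d) +
         (- real m * c * (if i = j then 1 else 0)) * exp_bump (m + 1) (c * x $ i + d))" for j
    using pd_eqI[OF D, of j] by (auto simp: fun_eq_iff axis_def algebra_simps)
  have IH: "C_k k (\<lambda>x::real^'n. r * exp_bump m' (c * x $ i + d))" for r m'
    using Suc.IH[of m'] by (rule C_k_bounded_linear[OF bounded_linear_mult_right])
  have "C_k k (pd j (\<lambda>x::real^'n. exp_bump m (c * x $ i + d)))" for j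
    unfolding pd by (rule C_k_add[OF IH IH])
  moreover have "(\<lambda>x::real^'n. exp_bump m (c * x $ i + d)) differentiable (at x)" for x
    using D unfolding differentiable_def by blast
  ultimately show ?case by simp
qed

text \<open>The factor \<open>Suc n\<close> leaves the zero set unchanged and drives every factor to
  1 inside the box. Indicators of boxes are thus bounded pointwise limits of test functions, with no
  mollification.\<close>

definition box_bump :: "nat \<Rightarrow> real^'n \<Rightarrow> real^'n \<Rightarrow> real^'n \<Rightarrow> real" where
  "box_bump n a b x = (\<Prod>i\<in>UNIV. exp_bump 0 (real (Suc n) * (x $ i - a $ i)) * exp_bump 0 (real (Suc n) * (b $ i - x $ i)))"

lemma box_bump_nonzero_iff: "box_bump n a b x \<noteq> 0 \<longleftrightarrow> x \<in> box a b"
  unfolding box_bump_def by (auto simp: exp_bump_def mem_box_cart zero_less_mult_iff)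

lemma box_bump_test_function:
  assumes "cbox a b \<subseteq> S"
  shows "box_bump n a b \<in> test_functions S"
proof -
  have "C_k k (box_bump n a b)" for k
  proof -
    have "C_k k (\<lambda>x. exp_bump 0 (real (Suc n) * (x $ i - a $ i)) * exp_bump 0 (real (Suc n) * (b $ i - x $ i)))" for i
      using C_k_mult[OF C_k_exp_bump[of k 0 "real (Suc n)" i "- (real (Suc n) * a $ i)"]
        C_k_exp_bump[of k 0 "- real (Suc n)" i "real (Suc n) * b $ i"]]
      by (simp add: algebra_simps)
    then have "C_k k (\<lambda>x. \<Prod>i\<in>UNIV. exp_bump 0 (real (Suc n) * (x $ i - a $ i)) * exp_bump 0 (real (Suc n) * (b $ i - x $ i)))"
      by (rule C_k_prod)
    then show ?thesis by (simp add: box_bump_def[abs_def])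
  qed
  moreover have "closure {x. box_bump n a b x \<noteq> 0} \<subseteq> cbox a b"
    unfolding box_bump_nonzero_iff by (rule closure_minimal) (auto simp: box_subset_cbox[THEN subsetD])
  moreover from this have "compact (closure {x. box_bump n a b x \<noteq> 0})"
    by (metis bounded_cbox bounded_subset closed_closure compact_eq_bounded_closed)
  ultimately show ?thesis using assms by (auto simp: test_functions_def)
qed

lemma exp_bump_0_bounds: "0 \<le> exp_bump 0 t" "exp_bump 0 t \<le> 1"
  by (auto simp: exp_bump_def)

lemma box_bump_bounds: "0 \<le> box_bump n a b x" "box_bump n a b x \<le> 1"
  unfolding box_bump_def using exp_bump_0_bounds
  by (auto intro!: prod_nonneg prod_le_1 mult_le_one)

lemma box_bump_tendsto: "(\<lambda>n. box_bump n a b x) \<longlonglongrightarrow> indicator (box a b) x"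
proof (cases "x \<in> box a b")
  case True
  have l: "(\<lambda>n. exp_bump 0 (real (Suc n) * s)) \<longlonglongrightarrow> 1" if "s > 0" for s
  proof -
    have "(\<lambda>n. - (inverse (real (Suc n)) * inverse s)) \<longlonglongrightarrow> - (0 * inverse s)"
      by (intro tendsto_intros LIMSEQ_inverse_real_of_nat)
    then have "(\<lambda>n. exp (- (inverse (real (Suc n)) * inverse s))) \<longlonglongrightarrow> exp (- (0 * inverse s))"
      by (rule tendsto_exp)
    then show ?thesis using that by (simp add: exp_bump_def divide_inverse zero_less_mult_iff)
  qed
  have "(\<lambda>n. box_bump n a b x) \<longlonglongrightarrow> (\<Prod>i\<in>(UNIV::'a set). 1 * 1)"
    unfolding box_bump_def by (intro tendsto_prod tendsto_mult l) (use True in \<open>auto simp: mem_box_cart\<close>)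
  then show ?thesis using True by simp
next
  case False
  then have "box_bump n a b x = 0" for n using box_bump_nonzero_iff by blast
  then show ?thesis using False by simp
qed

text \<open>Testing with \<open>box_bump\<close> and letting \<open>n\<close> grow shows that
  \<open>w\<close> has integral zero over every box inside \<open>S\<close>. Lebesgue
  differentiation along shrinking cubes then recovers the value of \<open>w\<close> at almost every
  point.\<close>

lemma fundamental_lemma:
  fixes w :: "real^'n \<Rightarrow> 'b::euclidean_space"
  assumes S: "open S" and w: "integrable (lebesgue_on S) w"
    and orth: "\<And>\<phi>::real^'n \<Rightarrow> real. \<phi> \<in> test_functions S \<Longrightarrow> integral\<^sup>L (lebesgue_on S) (\<lambda>x. \<phi> x *\<^sub>R w x) = 0"
  shows "ae_eq S w (\<lambda>x. 0)"
proof -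
  have Sm: "S \<in> sets lebesgue" using S by (simp add: borel_open)
  define W where "W x = indicator S x *\<^sub>R w x" for x
  have W: "integrable lebesgue W"
    using w Sm by (simp add: W_def[abs_def] integrable_restrict_space)
  have box0: "integral (cbox a b) W = 0" if ab: "cbox a b \<subseteq> S" for a b
  proof -
    have "(\<lambda>n. integral\<^sup>L lebesgue (\<lambda>x. box_bump n a b x *\<^sub>R W x)) \<longlonglongrightarrow> integral\<^sup>L lebesgue (\<lambda>x. indicator (box a b) x *\<^sub>R W x)"
    proof (rule integral_dominated_convergence[where w="\<lambda>x. norm (W x)"])
      have bm: "box_bump n a b \<in> borel_measurable lebesgue" for n
        using test_functions_continuous[OF box_bump_test_function[OF ab]]
        continuous_imp_measurable_on_sets_lebesgue[of UNIV "box_bump n a b"]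
        by (simp add: lebesgue_on_UNIV_eq)
      show "(\<lambda>x. box_bump n a b x *\<^sub>R W x) \<in> borel_measurable lebesgue" for n
        using W bm by (intro borel_measurable_scaleR) auto
      show "(\<lambda>x. indicator (box a b) x *\<^sub>R W x) \<in> borel_measurable lebesgue"
        using W by (intro borel_measurable_scaleR borel_measurable_indicator) auto
      show "integrable lebesgue (\<lambda>x. norm (W x))" using W by simp
      show "AE x in lebesgue. (\<lambda>n. box_bump n a b x *\<^sub>R W x) \<longlonglongrightarrow> indicator (box a b) x *\<^sub>R W x"
        by (intro AE_I2 tendsto_scaleR box_bump_tendsto tendsto_const)
      show "AE x in lebesgue. norm (box_bump n a b x *\<^sub>R W x) \<le> norm (W x)" for n
        using box_bump_bounds[of n a b] by (auto intro!: mult_left_le_one_le)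
    qed
    moreover have "integral\<^sup>L lebesgue (\<lambda>x. box_bump n a b x *\<^sub>R W x) = 0" for n
      using orth[OF box_bump_test_function[OF ab, of n]] Sm
      by (simp add: integral_restrict_space W_def mult.commute)
    ultimately have "integral\<^sup>L lebesgue (\<lambda>x. indicator (box a b) x *\<^sub>R W x) = 0"
      by (simp add: LIMSEQ_const_iff)
    moreover have "set_integrable lebesgue (box a b) W"
      using W integrable_mult_indicator[of "box a b" lebesgue W] by (simp add: set_integrable_def)
    ultimately have "integral (box a b) W = 0"
      using set_lebesgue_integral_eq_integral(2)[of "box a b" W] by (simp add: set_lebesgue_integral_def)
    then show ?thesis by (simp add: integral_open_interval)
  qed
  have "W integrable_on cbox a b" for a b
    using integrable_mult_indicator[OF _ W, of "cbox a b"]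
    by (intro set_lebesgue_integral_eq_integral(1)) (simp add: set_integrable_def)
  then obtain N where N: "negligible N" and
    lim: "\<And>x e. \<lbrakk>x \<notin> N; 0 < e\<rbrakk> \<Longrightarrow>
        \<exists>d>0. \<forall>h. 0 < h \<and> h < d \<longrightarrow> norm (integral (cbox x (x + h *\<^sub>R One)) W /\<^sub>R h ^ DIM(real^'n) - W x) < e"
    using integrable_ccontinuous_explicit[of W] by metis
  have "w x = 0" if x: "x \<in> S" "x \<notin> N" for x
  proof (rule ccontr)
    assume "w x \<noteq> 0"
    then have "norm (W x) > 0" using x by (simp add: W_def)
    then obtain d where d: "d > 0" "\<And>h. 0 < h \<Longrightarrow> h < d \<Longrightarrow>
        norm (integral (cbox x (x + h *\<^sub>R One)) W /\<^sub>R h ^ DIM(real^'n) - W x) < norm (W x)"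
      using lim[OF x(2)] by metis
    obtain r where r: "r > 0" "cball x r \<subseteq> S" using S x(1) open_contains_cball by metis
    \<comment> \<open>Small enough for the differentiation estimate and for the cube to stay in the
      ball of radius \<open>r\<close>; the summand 1 keeps the denominator positive.\<close>
    define h where "h = min (d / 2) (r / (1 + norm (One::real^'n)))"
    have pos: "1 + norm (One::real^'n) > 0" by (smt (verit) norm_ge_zero)
    have h: "0 < h" "h < d" using d(1) r(1) pos by (auto simp: h_def)
    have "h * (1 + norm (One::real^'n)) \<le> r / (1 + norm (One::real^'n)) * (1 + norm (One::real^'n))"
      using pos by (intro mult_right_mono) (auto simp: h_def)
    then have "h * (1 + norm (One::real^'n)) \<le> r" using pos by simp
    then have hr: "h * norm (One::real^'n) \<le> r" using h(1) by (simp add: algebra_simps)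
    have "cbox x (x + h *\<^sub>R One) \<subseteq> cball x r"
    proof
      fix y assume y: "y \<in> cbox x (x + h *\<^sub>R One)"
      have "norm (y - x) \<le> norm (h *\<^sub>R (One::real^'n))"
      proof (rule norm_le_componentwise)
        show "\<bar>(y - x) \<bullet> b\<bar> \<le> \<bar>h *\<^sub>R One \<bullet> b\<bar>" if "b \<in> Basis" for b
          using y that h(1) by (auto simp: mem_box inner_diff_left inner_add_left)
      qed
      then show "y \<in> cball x r" using hr h(1) by (simp add: dist_norm norm_minus_commute)
    qed
    then have "integral (cbox x (x + h *\<^sub>R One)) W = 0" using r(2) by (intro box0) auto
    then show False using d(2)[OF h] by simp
  qed
  then have "{x \<in> space (lebesgue_on S). \<not> w x = 0} \<subseteq> N \<inter> S" by auto
  moreover have "N \<inter> S \<in> null_sets (lebesgue_on S)"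
    using negligible_subset[OF N, of "N \<inter> S"] Sm by (simp add: null_sets_restrict_space negligible_iff_null_sets)
  ultimately show ?thesis unfolding ae_eq_def by (rule AE_I'[rotated])
qed

text \<open>Test functions of the form \<open>\<phi> x *\<^sub>R b\<close> isolate one coordinate,
  which reduces to scalar tests. Uniqueness of weak rotation, Curl and divergence rests on
  this.\<close>

lemma ae_eq_if_test_inner_eq:
  fixes w w' :: "real^'n \<Rightarrow> 'b::euclidean_space"
  assumes S: "open S" "S \<in> lmeasurable" and w: "w \<in> L2 S" "w' \<in> L2 S"
    and eq: "\<And>\<phi>. \<phi> \<in> test_functions S \<Longrightarrow> L2_inner S w \<phi> = L2_inner S w' \<phi>"
  shows "ae_eq S w w'"
proof -
  have d: "(\<lambda>x. w x - w' x) \<in> L2 S" using w by (rule L2_diff)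
  have "ae_eq S (\<lambda>x. w x - w' x) (\<lambda>x. 0)"
  proof (rule fundamental_lemma[OF S(1)])
    show "integrable (lebesgue_on S) (\<lambda>x. w x - w' x)" by (rule L2_integrable[OF S(2) d])
    fix \<phi> :: "real^'n \<Rightarrow> real" assume \<phi>: "\<phi> \<in> test_functions S"
    have int: "integrable (lebesgue_on S) (\<lambda>x. \<phi> x *\<^sub>R (w x - w' x))"
    proof -
      obtain B where "\<And>x. \<bar>\<phi> x\<bar> \<le> B" using test_functions_bounded[OF \<phi>] by auto
      then show ?thesis
        using L2_measurable[OF test_functions_L2[OF \<phi> S(2)]] d by (intro L2_integrable[OF S(2)] L2_bounded_mult)
    qed
    show "integral\<^sup>L (lebesgue_on S) (\<lambda>x. \<phi> x *\<^sub>R (w x - w' x)) = 0"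
    proof (rule euclidean_eqI)
      fix b :: 'b
      have \<phi>b: "(\<lambda>x. \<phi> x *\<^sub>R b) \<in> test_functions S"
        using test_functions_bounded_linear[OF \<phi> bounded_linear_scaleR_left] .
      have "integral\<^sup>L (lebesgue_on S) (\<lambda>x. \<phi> x *\<^sub>R (w x - w' x)) \<bullet> b = L2_inner S (\<lambda>x. w x - w' x) (\<lambda>x. \<phi> x *\<^sub>R b)"
        using int by (simp add: L2_inner_def integral_inner_left[symmetric])
      also have "\<dots> = 0"
        using eq[OF \<phi>b] w test_functions_L2[OF \<phi>b S(2)] by (simp add: L2_inner_diff_left)
      finally show "integral\<^sup>L (lebesgue_on S) (\<lambda>x. \<phi> x *\<^sub>R (w x - w' x)) \<bullet> b = 0 \<bullet> b" by simp
    qed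
  qed
  then show ?thesis by (simp add: ae_eq_def)
qed

section \<open>Completeness and orthogonal projections\<close>

lemma L2_norm_power2_nn_integral:
  assumes "v \<in> L2 S"
  shows "(\<integral>\<^sup>+x. ennreal ((norm (v x))\<^sup>2) \<partial>lebesgue_on S) = ennreal ((L2_norm S v)\<^sup>2)"
  unfolding L2_norm_power2 by (rule nn_integral_eq_integral[OF L2_integrable_power2[OF assms]]) simp

lemma L2_norm_integrable_norm:
  assumes S: "S \<in> lmeasurable" and v: "v \<in> L2 S"
  shows "integral\<^sup>L (lebesgue_on S) (\<lambda>x. norm (v x)) \<le> L2_norm S v * L2_norm S (\<lambda>x. 1::real)"
proof -
  have "(\<lambda>x. norm (v x)) \<in> L2 S" using v by (auto simp: L2_def intro: borel_measurable_norm)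
  from L2_Cauchy_Schwarz[OF this L2_const[OF S, of "1::real"]] show ?thesis
    by (simp add: L2_inner_def L2_norm_def)
qed

text \<open>The core of the Riesz-Fischer theorem. On a set of finite measure the L2 bound on
  increments gives an L1 bound, so the series of their pointwise norms has a finite integral, is
  finite almost everywhere, and the telescoping series converges there.\<close>

lemma L2_Cauchy_subsequence_AE_convergent:
  assumes S: "S \<in> lmeasurable" and f: "\<And>n. f n \<in> L2 S"
    and close: "\<And>k. L2_norm S (\<lambda>x. f (Suc k) x - f k x) \<le> (1/2) ^ k"
  shows "AE x in lebesgue_on S. convergent (\<lambda>k. f k x)"
proof -
  define c where "c = L2_norm S (\<lambda>x. 1::real)"
  define d where "d k x = norm (f (Suc k) x - f k x)" for k x
  have df: "(\<lambda>x. f (Suc k) x - f k x) \<in> L2 S" for k by (intro L2_diff f)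
  have dm: "d k \<in> borel_measurable (lebesgue_on S)" for k
    unfolding d_def using L2_measurable[OF df] by simp
  have di: "integrable (lebesgue_on S) (d k)" for k
    unfolding d_def by (intro integrable_norm L2_integrable[OF S df])
  have dle: "integral\<^sup>L (lebesgue_on S) (d k) \<le> (1/2) ^ k * c" for k
    using L2_norm_integrable_norm[OF S df, of k] mult_right_mono[OF close, of c k]
    unfolding d_def c_def by fastforce
  have "(\<integral>\<^sup>+x. (\<Sum>k. ennreal (d k x)) \<partial>lebesgue_on S) = (\<Sum>k. \<integral>\<^sup>+x. ennreal (d k x) \<partial>lebesgue_on S)"
    using dm by (intro nn_integral_suminf) auto
  also have "\<dots> \<le> (\<Sum>k. ennreal ((1/2) ^ k * c))"
  proof (intro suminf_le summableI)
    show "(\<integral>\<^sup>+x. ennreal (d k x) \<partial>lebesgue_on S) \<le> ennreal ((1/2) ^ k * c)" for k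
      using nn_integral_eq_integral[OF di, of k] dle[of k] by (simp add: d_def ennreal_leI)
  qed
  also have "\<dots> = ennreal (\<Sum>k. (1/2) ^ k * c)"
    by (intro suminf_ennreal2) (auto simp: c_def intro!: summable_mult2)
  finally have "(\<integral>\<^sup>+x. (\<Sum>k. ennreal (d k x)) \<partial>lebesgue_on S) \<noteq> \<infinity>"
    by (auto simp: top_unique)
  then have "AE x in lebesgue_on S. (\<Sum>k. ennreal (d k x)) \<noteq> \<infinity>"
    using dm by (intro nn_integral_noteq_infinite) auto
  then show ?thesis
  proof eventually_elim
    case (elim x)
    then have "summable (\<lambda>k. d k x)"
      by (intro summable_suminf_not_top) (auto simp: d_def)
    then have "summable (\<lambda>k. f (Suc k) x - f k x)"
      unfolding d_def by (rule summable_norm_cancel)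
    then have "convergent (\<lambda>n. \<Sum>k<n. f (Suc k) x - f k x)" by (simp add: summable_iff_convergent)
    moreover have "(\<lambda>n. \<Sum>k<n. f (Suc k) x - f k x) = (\<lambda>n. f n x - f 0 x)"
      by (intro ext sum_lessThan_telescope[of "\<lambda>k. f k x"])
    ultimately have "convergent (\<lambda>n. f n x - f 0 x)" by simp
    then have "convergent (\<lambda>n. (f n x - f 0 x) + f 0 x)" by (rule convergent_add[OF _ convergent_const])
    then show ?case by simp
  qed
qed

text \<open>Fatou's lemma for squared norms yields membership of the limit in L2 and the bound at
  once. It is applied to differences with a fixed member of a Cauchy sequence.\<close>

lemma L2_Fatou:
  assumes g: "g \<in> borel_measurable (lebesgue_on S)" and f: "\<And>n. f n \<in> L2 S"
    and lim: "AE x in lebesgue_on S. (\<lambda>n. f n x) \<longlonglongrightarrow> g x"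
    and bd: "\<forall>\<^sub>F n in sequentially. L2_norm S (f n) \<le> C"
  shows "g \<in> L2 S" "L2_norm S g \<le> C"
proof -
  have C: "0 \<le> C" using eventually_happens[OF bd] order_trans[OF L2_norm_nonneg] by auto
  have "(\<integral>\<^sup>+x. ennreal ((norm (g x))\<^sup>2) \<partial>lebesgue_on S)
      = (\<integral>\<^sup>+x. liminf (\<lambda>n. ennreal ((norm (f n x))\<^sup>2)) \<partial>lebesgue_on S)"
  proof (rule nn_integral_cong_AE)
    show "AE x in lebesgue_on S. ennreal ((norm (g x))\<^sup>2) = liminf (\<lambda>n. ennreal ((norm (f n x))\<^sup>2))"
      using lim
    proof eventually_elim
      case (elim x)
      then have "(\<lambda>n. ennreal ((norm (f n x))\<^sup>2)) \<longlonglongrightarrow> ennreal ((norm (g x))\<^sup>2)"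
        by (intro tendsto_intros)
      then show ?case by (rule lim_imp_Liminf[OF sequentially_bot, symmetric])
    qed
  qed
  also have "\<dots> \<le> liminf (\<lambda>n. \<integral>\<^sup>+x. ennreal ((norm (f n x))\<^sup>2) \<partial>lebesgue_on S)"
    using L2_measurable[OF f] by (intro nn_integral_liminf) auto
  also have "\<dots> \<le> limsup (\<lambda>n. \<integral>\<^sup>+x. ennreal ((norm (f n x))\<^sup>2) \<partial>lebesgue_on S)"
    by (simp add: Liminf_le_Limsup)
  also have "\<dots> \<le> ennreal (C\<^sup>2)"
  proof (rule Limsup_bounded)
    show "\<forall>\<^sub>F n in sequentially. (\<integral>\<^sup>+x. ennreal ((norm (f n x))\<^sup>2) \<partial>lebesgue_on S) \<le> ennreal (C\<^sup>2)"
      using bd unfolding L2_norm_power2_nn_integral[OF f]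
      by eventually_elim (intro ennreal_leI power_mono L2_norm_nonneg)
  qed
  finally have le: "(\<integral>\<^sup>+x. ennreal ((norm (g x))\<^sup>2) \<partial>lebesgue_on S) \<le> ennreal (C\<^sup>2)" .
  then have "integrable (lebesgue_on S) (\<lambda>x. (norm (g x))\<^sup>2)"
    using g by (intro integrableI_nonneg) (auto simp: less_top[symmetric] top_unique)
  then show gL: "g \<in> L2 S" using g by (simp add: L2_def)
  have "(L2_norm S g)\<^sup>2 \<le> C\<^sup>2"
    using le unfolding L2_norm_power2_nn_integral[OF gL] by (simp add: ennreal_le_iff)
  then show "L2_norm S g \<le> C" using C by (rule power2_le_imp_le)
qed

lemma L2_complete:
  fixes f :: "nat \<Rightarrow> real^'n \<Rightarrow> 'b::euclidean_space"
  assumes S: "S \<in> lmeasurable" and f: "\<And>n. f n \<in> L2 S"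
    and Cauchy: "\<And>e. e > 0 \<Longrightarrow> \<exists>N. \<forall>m\<ge>N. \<forall>n\<ge>N. L2_norm S (\<lambda>x. f m x - f n x) \<le> e"
  obtains g where "g \<in> L2 S" "(\<lambda>n. L2_norm S (\<lambda>x. f n x - g x)) \<longlonglongrightarrow> 0"
proof -
  have "\<forall>k. \<exists>N. \<forall>m\<ge>N. \<forall>n\<ge>N. L2_norm S (\<lambda>x. f m x - f n x) \<le> (1/2) ^ k"
    using Cauchy by simp
  then obtain N where N: "\<And>k m n. m \<ge> N k \<Longrightarrow> n \<ge> N k \<Longrightarrow> L2_norm S (\<lambda>x. f m x - f n x) \<le> (1/2) ^ k"
    by metis
  \<comment> \<open>The sum makes \<open>r\<close> monotone and at least \<open>N k\<close>; the
    summand \<open>k\<close> makes it exceed every fixed index eventually.\<close>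
  define r where "r k = k + (\<Sum>j\<le>k. N j)" for k
  have rN: "N k \<le> r k" "r k \<le> r (Suc k)" "k \<le> r k" for k
    unfolding r_def by (auto intro: order_trans[OF member_le_sum[of k "{..k}" N]])
  define g where "g x = lim (\<lambda>k. f (r k) x)" for x
  have gm: "g \<in> borel_measurable (lebesgue_on S)"
    unfolding g_def by (rule borel_measurable_lim_metric) (rule L2_measurable[OF f])
  have "AE x in lebesgue_on S. convergent (\<lambda>k. f (r k) x)"
  proof (rule L2_Cauchy_subsequence_AE_convergent[OF S f])
    show "L2_norm S (\<lambda>x. f (r (Suc k)) x - f (r k) x) \<le> (1/2) ^ k" for k
      using rN[of k] by (intro N) auto
  qed
  then have lim: "AE x in lebesgue_on S. (\<lambda>k. f (r k) x) \<longlonglongrightarrow> g x"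
    by eventually_elim (simp add: g_def convergent_LIMSEQ_iff)
  \<comment> \<open>With \<open>n\<close> fixed, Fatou along the subsequence turns the Cauchy bound
    into a bound for the distance to the limit.\<close>
  have bound: "(\<lambda>x. f n x - g x) \<in> L2 S \<and> L2_norm S (\<lambda>x. f n x - g x) \<le> e"
    if K: "\<forall>m\<ge>K. \<forall>n\<ge>K. L2_norm S (\<lambda>x. f m x - f n x) \<le> e" and n: "n \<ge> K" for n K e
  proof -
    have m: "(\<lambda>x. f n x - g x) \<in> borel_measurable (lebesgue_on S)"
      using gm L2_measurable[OF f] by simp
    have l: "AE x in lebesgue_on S. (\<lambda>k. f n x - f (r k) x) \<longlonglongrightarrow> f n x - g x"
      using lim by eventually_elim (intro tendsto_intros)
    have b: "\<forall>\<^sub>F k in sequentially. L2_norm S (\<lambda>x. f n x - f (r k) x) \<le> e"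
      using eventually_ge_at_top[of K] by eventually_elim (use K n rN(3) order_trans in blast)
    show ?thesis using L2_Fatou[OF m L2_diff[OF f f] l b] by blast
  qed
  obtain K where K: "\<forall>m\<ge>K. \<forall>n\<ge>K. L2_norm S (\<lambda>x. f m x - f n x) \<le> 1" using Cauchy[of 1] by auto
  have "(\<lambda>x. f K x - (f K x - g x)) \<in> L2 S"
    using L2_diff[OF f conjunct1[OF bound[OF K order_refl]]] .
  then have "g \<in> L2 S" by simp
  moreover have "(\<lambda>n. L2_norm S (\<lambda>x. f n x - g x)) \<longlonglongrightarrow> 0"
  proof (rule LIMSEQ_I)
    fix e :: real assume "0 < e"
    then obtain K where K: "\<forall>m\<ge>K. \<forall>n\<ge>K. L2_norm S (\<lambda>x. f m x - f n x) \<le> e / 2"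
      using Cauchy[of "e / 2"] by auto
    have "norm (L2_norm S (\<lambda>x. f n x - g x) - 0) < e" if "n \<ge> K" for n
      using conjunct2[OF bound[OF K that]] \<open>0 < e\<close> by simp
    then have "\<forall>n\<ge>K. norm (L2_norm S (\<lambda>x. f n x - g x) - 0) < e" by blast
    then show "\<exists>K. \<forall>n\<ge>K. norm (L2_norm S (\<lambda>x. f n x - g x) - 0) < e" by blast
  qed
  ultimately show thesis by (rule that)
qed

lemma L2_inner_tendsto:
  assumes f: "\<And>n. f n \<in> L2 S" and g: "g \<in> L2 S" and w: "w \<in> L2 S"
    and lim: "(\<lambda>n. L2_norm S (\<lambda>x. f n x - g x)) \<longlonglongrightarrow> 0"
  shows "(\<lambda>n. L2_inner S (f n) w) \<longlonglongrightarrow> L2_inner S g w"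
proof (rule LIM_zero_cancel, rule Lim_null_comparison)
  show "\<forall>\<^sub>F n in sequentially. norm (L2_inner S (f n) w - L2_inner S g w) \<le> L2_norm S (\<lambda>x. f n x - g x) * L2_norm S w"
    using L2_Cauchy_Schwarz[OF L2_diff[OF f g] w] by (simp add: L2_inner_diff_left[OF f g w])
  show "(\<lambda>n. L2_norm S (\<lambda>x. f n x - g x) * L2_norm S w) \<longlonglongrightarrow> 0"
    using tendsto_mult_right[OF lim, of "L2_norm S w"] by simp
qed

section \<open>Orthogonal projections\<close>

lemma L2_parallelogram:
  assumes "v \<in> L2 S" "a \<in> L2 S" "b \<in> L2 S"
  shows "(L2_norm S (\<lambda>x. a x - b x))\<^sup>2 = 2 * (L2_norm S (\<lambda>x. v x - a x))\<^sup>2 + 2 * (L2_norm S (\<lambda>x. v x - b x))\<^sup>2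
    - 4 * (L2_norm S (\<lambda>x. v x - ((1/2) *\<^sub>R a x + (1/2) *\<^sub>R b x)))\<^sup>2"
  using assms
  by (simp add: L2_norm_diff_power2 L2_lincomb L2_norm_add_power2 L2_scaleR L2_inner_add_right
      L2_inner_scaleR_right L2_inner_scaleR_left L2_norm_scaleR power_mult_distrib power_divide algebra_simps)

text \<open>The closure of \<open>E\<close> is never formed: the projection \<open>g\<close> is
  delivered with a sequence in \<open>E\<close> converging to it, so that any condition continuous
  in L2 passes from \<open>E\<close> to \<open>g\<close>. A minimizing sequence is Cauchy by the
  parallelogram identity.\<close>

lemma L2_projection_closure:
  fixes v :: "real^'n \<Rightarrow> 'b::euclidean_space"
  assumes S: "S \<in> lmeasurable" and E: "E \<subseteq> L2 S" "E \<noteq> {}"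
    and lin: "\<And>v w r s. v \<in> E \<Longrightarrow> w \<in> E \<Longrightarrow> (\<lambda>x. r *\<^sub>R v x + s *\<^sub>R w x) \<in> E" and v: "v \<in> L2 S"
  obtains g e where "g \<in> L2 S" "\<And>n::nat. e n \<in> E" "(\<lambda>n. L2_norm S (\<lambda>x. e n x - g x)) \<longlonglongrightarrow> 0"
    "\<And>w. w \<in> E \<Longrightarrow> L2_inner S (\<lambda>x. v x - g x) w = 0"
proof -
  define D where "D w = (L2_norm S (\<lambda>x. v x - w x))\<^sup>2" for w
  define \<delta> where "\<delta> = (INF w\<in>E. D w)"
  have bdd: "bdd_below (D ` E)" by (rule bdd_belowI[of _ 0]) (auto simp: D_def)
  have \<delta>: "\<delta> \<le> D w" if "w \<in> E" for w
    unfolding \<delta>_def by (rule cINF_lower[OF bdd that])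
  have "\<exists>w\<in>E. D w < \<delta> + inverse (real (Suc n))" for n
  proof -
    have "(INF w\<in>E. D w) < \<delta> + inverse (real (Suc n))" by (simp add: \<delta>_def)
    then show ?thesis by (simp only: cINF_less_iff[OF E(2) bdd])
  qed
  then obtain e where e: "\<And>n. e n \<in> E" "\<And>n. D (e n) < \<delta> + inverse (real (Suc n))" by metis
  have eL: "e n \<in> L2 S" for n using e E by auto
  \<comment> \<open>The midpoint of two near-minimizers lies in \<open>E\<close>, so its squared
    distance is at least \<delta>; the identity then bounds their separation by the excesses over
    \<delta>.\<close>
  have small: "(L2_norm S (\<lambda>x. e m x - e n x))\<^sup>2 \<le> 4 * inverse (real (Suc N))" if "m \<ge> N" "n \<ge> N" for m n N
  proof -
    have "inverse (real (Suc m)) \<le> inverse (real (Suc N))" "inverse (real (Suc n)) \<le> inverse (real (Suc N))"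
      using that by auto
    moreover have "\<delta> \<le> D (\<lambda>x. (1/2) *\<^sub>R e m x + (1/2) *\<^sub>R e n x)" by (intro \<delta> lin e)
    ultimately show ?thesis
      using L2_parallelogram[OF v eL eL, of m n] e(2)[of m] e(2)[of n] unfolding D_def by linarith
  qed
  obtain g where g: "g \<in> L2 S" "(\<lambda>n. L2_norm S (\<lambda>x. e n x - g x)) \<longlonglongrightarrow> 0"
  proof (rule L2_complete[OF S, of e])
    show "e n \<in> L2 S" for n by (rule eL)
    fix \<epsilon> :: real assume "\<epsilon> > 0"
    then obtain N where N: "inverse (real (Suc N)) < \<epsilon>\<^sup>2 / 4" using reals_Archimedean[of "\<epsilon>\<^sup>2 / 4"] by auto
    have "L2_norm S (\<lambda>x. e m x - e n x) \<le> \<epsilon>" if "m \<ge> N" "n \<ge> N" for m n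
    proof (rule power2_le_imp_le)
      show "(L2_norm S (\<lambda>x. e m x - e n x))\<^sup>2 \<le> \<epsilon>\<^sup>2" using small[OF that] N by linarith
      show "0 \<le> \<epsilon>" using \<open>\<epsilon> > 0\<close> by simp
    qed
    then show "\<exists>N. \<forall>m\<ge>N. \<forall>n\<ge>N. L2_norm S (\<lambda>x. e m x - e n x) \<le> \<epsilon>" by blast
  qed
  have "L2_inner S (\<lambda>x. v x - g x) w = 0" if w: "w \<in> E" for w
  proof -
    have wL: "w \<in> L2 S" using w E by auto
    \<comment> \<open>First variation at near-minimizers: moving \<open>e n\<close> by
      \<open>t\<close> times \<open>w\<close> cannot lower the squared distance below \<delta>, and
      the excess of \<open>e n\<close> vanishes in the limit.\<close>
    have key: "2 * t * L2_inner S (\<lambda>x. v x - g x) w \<le> t\<^sup>2 * (L2_norm S w)\<^sup>2" for t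
    proof (rule LIMSEQ_le)
      have "(\<lambda>n. L2_inner S v w - L2_inner S (e n) w) \<longlonglongrightarrow> L2_inner S v w - L2_inner S g w"
        by (intro tendsto_intros L2_inner_tendsto eL g wL)
      then have "(\<lambda>n. L2_inner S (\<lambda>x. v x - e n x) w) \<longlonglongrightarrow> L2_inner S (\<lambda>x. v x - g x) w"
        by (simp add: L2_inner_diff_left v eL g wL)
      then show "(\<lambda>n. 2 * t * L2_inner S (\<lambda>x. v x - e n x) w) \<longlonglongrightarrow> 2 * t * L2_inner S (\<lambda>x. v x - g x) w"
        by (intro tendsto_intros)
      show "(\<lambda>n. inverse (real (Suc n)) + t\<^sup>2 * (L2_norm S w)\<^sup>2) \<longlonglongrightarrow> t\<^sup>2 * (L2_norm S w)\<^sup>2"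
        using tendsto_add[OF LIMSEQ_inverse_real_of_nat tendsto_const, of "t\<^sup>2 * (L2_norm S w)\<^sup>2"] by simp
      have "2 * t * L2_inner S (\<lambda>x. v x - e n x) w \<le> inverse (real (Suc n)) + t\<^sup>2 * (L2_norm S w)\<^sup>2" for n
      proof -
        have "\<delta> \<le> D (\<lambda>x. 1 *\<^sub>R e n x + t *\<^sub>R w x)" by (intro \<delta> lin e w)
        also have "\<dots> = (L2_norm S (\<lambda>x. (v x - e n x) - t *\<^sub>R w x))\<^sup>2"
          by (simp add: D_def diff_diff_add)
        also have "\<dots> = D (e n) - 2 * t * L2_inner S (\<lambda>x. v x - e n x) w + t\<^sup>2 * (L2_norm S w)\<^sup>2"
          by (simp add: L2_norm_diff_power2[OF L2_diff[OF v eL] L2_scaleR[OF wL]] D_def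
              L2_inner_scaleR_right L2_norm_scaleR power_mult_distrib)
        finally show ?thesis using e(2)[of n] by linarith
      qed
      then show "\<exists>N. \<forall>n\<ge>N. 2 * t * L2_inner S (\<lambda>x. v x - e n x) w \<le> inverse (real (Suc n)) + t\<^sup>2 * (L2_norm S w)\<^sup>2"
        by blast
    qed
    show ?thesis
    proof (rule ccontr)
      let ?c = "L2_inner S (\<lambda>x. v x - g x) w"
      assume c: "?c \<noteq> 0"
      \<comment> \<open>\<open>t = ?c / q\<close> nearly minimizes the quadratic; the added 1 avoids
        division by a vanishing norm of \<open>w\<close>.\<close>
      define q where "q = (L2_norm S w)\<^sup>2 + 1"
      have q: "q > 0" "(L2_norm S w)\<^sup>2 = q - 1" by (auto simp: q_def add_nonneg_pos)
      have "2 * (?c / q) * ?c \<le> (?c / q)\<^sup>2 * (q - 1)" using key[of "?c / q"] q(2) by simp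
      then have "2 * ?c\<^sup>2 * q \<le> ?c\<^sup>2 * (q - 1)"
        using q(1) by (simp add: power2_eq_square divide_simps mult_ac)
      then have "?c\<^sup>2 * (q + 1) \<le> 0" by (simp add: algebra_simps)
      moreover have "?c\<^sup>2 * (q + 1) > 0" using c q(1) by simp
      ultimately show False by linarith
    qed
  qed
  then show thesis using that g e(1) by blast
qed

text \<open>Finitely many functionals that separate \<open>E\<close> modulo the kernel of \<open>B\<close> replace
  finite-dimensionality, since functions are not identified almost everywhere.\<close>

lemma finite_functionals_projection:
  fixes B :: "('x \<Rightarrow> 'c::real_vector) \<Rightarrow> ('x \<Rightarrow> 'c) \<Rightarrow> real" and l :: "'i \<Rightarrow> ('x \<Rightarrow> 'c) \<Rightarrow> real"
  assumes I: "finite I"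
    and H: "\<And>u v r s. u \<in> H \<Longrightarrow> v \<in> H \<Longrightarrow> (\<lambda>x. r *\<^sub>R u x + s *\<^sub>R v x) \<in> H"
    and B: "\<And>u v w r s. u \<in> H \<Longrightarrow> v \<in> H \<Longrightarrow> w \<in> H \<Longrightarrow> B (\<lambda>x. r *\<^sub>R u x + s *\<^sub>R v x) w = r * B u w + s * B v w"
    and sym: "\<And>u v. B u v = B v u" and pos: "\<And>u. u \<in> H \<Longrightarrow> 0 \<le> B u u"
    and l: "\<And>i u v r s. i \<in> I \<Longrightarrow> u \<in> E \<Longrightarrow> v \<in> E \<Longrightarrow> l i (\<lambda>x. r *\<^sub>R u x + s *\<^sub>R v x) = r * l i u + s * l i v"
    and E: "E \<subseteq> H" "(\<lambda>x. 0) \<in> E" "\<And>u v r s. u \<in> E \<Longrightarrow> v \<in> E \<Longrightarrow> (\<lambda>x. r *\<^sub>R u x + s *\<^sub>R v x) \<in> E"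
    and sep: "\<And>v. v \<in> E \<Longrightarrow> (\<And>i. i \<in> I \<Longrightarrow> l i v = 0) \<Longrightarrow> B v v = 0"
    and u: "u \<in> H"
  shows "\<exists>w\<in>E. \<forall>v\<in>E. B (\<lambda>x. u x - w x) v = 0"
proof -
  have Bdiff: "B (\<lambda>x. u x - w x) v = B u v - B w v" if "u \<in> H" "w \<in> H" "v \<in> H" for u v w
    using B[OF that(1,2,3), of 1 "-1"] by simp
  \<comment> \<open>The Cauchy-Schwarz inequality for a semidefinite form in its degenerate case:
    were \<open>B u v\<close> nonzero, an affine function of \<open>t\<close> would be nonnegative
    everywhere without being constant.\<close>
  have null: "B u v = 0" if uv: "u \<in> H" "v \<in> H" and v0: "B v v = 0" for u v
  proof (rule ccontr)
    assume ne: "B u v \<noteq> 0"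
    have "0 \<le> B u u + 2 * t * B u v" for t
    proof -
      have h: "(\<lambda>x. 1 *\<^sub>R u x + t *\<^sub>R v x) \<in> H" by (intro H uv)
      have "B (\<lambda>x. 1 *\<^sub>R u x + t *\<^sub>R v x) (\<lambda>x. 1 *\<^sub>R u x + t *\<^sub>R v x) = 
          1 * B (\<lambda>x. 1 *\<^sub>R u x + t *\<^sub>R v x) u + t * B (\<lambda>x. 1 *\<^sub>R u x + t *\<^sub>R v x) v"
        unfolding B[OF uv h] sym[of u] sym[of v] ..
      also have "\<dots> = B u u + 2 * t * B u v"
        unfolding B[OF uv uv(1)] B[OF uv uv(2)] v0 sym[of v u] by simp
      finally show ?thesis using pos[OF h] by simp
    qed
    from this[of "- (B u u + 1) / (2 * B u v)"] ne show False by (simp add: field_simps)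
  qed
  show ?thesis
    using I l E sep u
  proof (induction I arbitrary: E u rule: finite_induct)
    case empty
    have "B u v = 0" if "v \<in> E" for v
      by (rule null[OF empty.prems(6) subsetD[OF empty.prems(2) that]], rule empty.prems(5)[OF that]) simp
    then have "\<forall>v\<in>E. B (\<lambda>x. u x - 0) v = 0" by simp
    then show ?case using empty.prems(3) by (rule bexI)
  next
    case (insert i I)
    \<comment> \<open>Restricting to the kernel of \<open>l i\<close> disposes of one functional;
      what is left of \<open>E\<close> is spanned by a single direction.\<close>
    define E' where "E' = {v \<in> E. l i v = 0}"
    have li: "l i (\<lambda>x. r *\<^sub>R u x + s *\<^sub>R v x) = r * l i u + s * l i v" if "u \<in> E" "v \<in> E" for u v r s
      using insert.prems(1)[of i] that by simp
    have "l i (\<lambda>x. 0) = 0" using li[of "\<lambda>x. 0" "\<lambda>x. 0" 0 0] insert.prems(3) by simp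
    then have E': "E' \<subseteq> H" "(\<lambda>x. 0) \<in> E'" "\<And>u v r s. u \<in> E' \<Longrightarrow> v \<in> E' \<Longrightarrow> (\<lambda>x. r *\<^sub>R u x + s *\<^sub>R v x) \<in> E'"
      using insert.prems li by (auto simp: E'_def)
    have IH: "\<exists>w\<in>E'. \<forall>v\<in>E'. B (\<lambda>x. u x - w x) v = 0" if "u \<in> H" for u
    proof (rule insert.IH[OF _ E' _ that])
      show "l j (\<lambda>x. r *\<^sub>R u x + s *\<^sub>R v x) = r * l j u + s * l j v" if "j \<in> I" "u \<in> E'" "v \<in> E'" for j u v r s
        using insert.prems(1)[of j u v] that by (auto simp: E'_def)
      show "B v v = 0" if "v \<in> E'" "\<And>j. j \<in> I \<Longrightarrow> l j v = 0" for v
        using insert.prems(5)[of v] that by (auto simp: E'_def)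
    qed
    show ?case
    proof (cases "\<forall>v\<in>E. l i v = 0")
      case True
      then have "E' = E" by (auto simp: E'_def)
      then show ?thesis using IH[OF insert.prems(6)] by simp
    next
      case False
      then obtain e0 where e0: "e0 \<in> E" "l i e0 \<noteq> 0" by blast
      then have e0H: "e0 \<in> H" using insert.prems by auto
      obtain p where p: "p \<in> E'" "\<And>v. v \<in> E' \<Longrightarrow> B (\<lambda>x. e0 x - p x) v = 0" using IH[OF e0H] by blast
      obtain q where q: "q \<in> E'" "\<And>v. v \<in> E' \<Longrightarrow> B (\<lambda>x. u x - q x) v = 0" using IH[OF insert.prems(6)] by blast
      \<comment> \<open>Gram-Schmidt: the extra direction is made orthogonal to \<open>E'\<close>
        without changing its value under \<open>l i\<close>.\<close>
      define e where "e x = e0 x - p x" for x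
      have e_alt: "e = (\<lambda>x. 1 *\<^sub>R e0 x + (-1) *\<^sub>R p x)" by (simp add: e_def fun_eq_iff)
      have pE: "p \<in> E" "q \<in> E" using p q by (auto simp: E'_def)
      have eE: "e \<in> E" unfolding e_alt by (intro insert.prems(4) e0 pE)
      have le: "l i e = l i e0" unfolding e_alt li[OF e0(1) pE(1)] using p(1) by (simp add: E'_def)
      have eH: "e \<in> H" "q \<in> H" using eE pE insert.prems by auto
      have uq: "(\<lambda>x. u x - q x) \<in> H" using H[OF insert.prems(6) eH(2), of 1 "-1"] by simp
      \<comment> \<open>If \<open>B e e\<close> vanishes, every member of \<open>H\<close> is
        already orthogonal to \<open>e\<close> by \<open>null\<close>, so the default coefficient 0
        is correct.\<close>
      define t where "t = (if B e e = 0 then 0 else B (\<lambda>x. u x - q x) e / B e e)"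
      define w where "w x = 1 *\<^sub>R q x + t *\<^sub>R e x" for x
      have wE: "w \<in> E" unfolding w_def[abs_def] by (intro insert.prems(4) pE eE)
      have w_alt: "(\<lambda>x. u x - w x) = (\<lambda>x. 1 *\<^sub>R (u x - q x) + (- t) *\<^sub>R e x)"
        by (simp add: w_def fun_eq_iff)
      have Bw: "B (\<lambda>x. u x - w x) v = B (\<lambda>x. u x - q x) v - t * B e v" if "v \<in> H" for v
        unfolding w_alt B[OF uq eH(1) that] by simp
      have Be: "B (\<lambda>x. u x - w x) e = 0"
        unfolding Bw[OF eH(1)] using null[OF uq eH(1)] by (auto simp: t_def)
      have "B (\<lambda>x. u x - w x) v = 0" if v: "v \<in> E" for v
      proof -
        define s where "s = l i v / l i e"
        define v' where "v' x = 1 *\<^sub>R v x + (- s) *\<^sub>R e x" for x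
        have v'E: "v' \<in> E" unfolding v'_def[abs_def] by (intro insert.prems(4) v eE)
        have "l i v' = 0"
          unfolding v'_def[abs_def] li[OF v eE] using e0(2) le by (simp add: s_def)
        then have v': "v' \<in> E'" using v'E by (simp add: E'_def)
        have vH: "v' \<in> H" using v'E insert.prems by auto
        have wH: "(\<lambda>x. u x - w x) \<in> H"
          unfolding w_alt by (intro H uq eH)
        have Bv': "B (\<lambda>x. u x - w x) v' = 0"
          unfolding Bw[OF vH] using q(2)[OF v'] p(2)[OF v'] by (simp add: e_def[abs_def])
        have "v = (\<lambda>x. 1 *\<^sub>R v' x + s *\<^sub>R e x)" by (simp add: v'_def fun_eq_iff)
        then have "B (\<lambda>x. u x - w x) v = B (\<lambda>x. 1 *\<^sub>R v' x + s *\<^sub>R e x) (\<lambda>x. u x - w x)"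
          using sym by metis
        also have "\<dots> = 1 * B v' (\<lambda>x. u x - w x) + s * B e (\<lambda>x. u x - w x)"
          by (rule B[OF vH eH(1) wH])
        also have "\<dots> = 0" using Bv' Be sym by simp
        finally show ?thesis .
      qed
      then show ?thesis using wE by blast
    qed
  qed
qed

section \<open>Weak derivatives and the hypercircle argument\<close>

lemma test_functions_sum:
  "(\<And>i. i \<in> I \<Longrightarrow> f i \<in> test_functions S) \<Longrightarrow> (\<lambda>x. \<Sum>i\<in>I. f i x) \<in> test_functions S"
  by (induction I rule: infinite_finite_induct) (simp_all add: test_functions_add)

lemma test_functions_vec:
  fixes f :: "'m::finite \<Rightarrow> real^'n \<Rightarrow> real"
  assumes "\<And>i. f i \<in> test_functions S"
  shows "(\<lambda>x. \<chi> i. f i x) \<in> test_functions S"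
proof -
  have "(\<lambda>x. \<Sum>i\<in>UNIV. f i x *\<^sub>R axis i (1::real)) \<in> test_functions S"
    using assms by (intro test_functions_sum test_functions_bounded_linear[OF _ bounded_linear_scaleR_left])
  moreover have "(\<chi> i. f i x) = (\<Sum>i\<in>UNIV. f i x *\<^sub>R axis i (1::real))" for x
    by (simp add: vec_eq_iff axis_def if_distrib cong: if_cong)
  ultimately show ?thesis by simp
qed

abbreviation grad :: "(real^'n \<Rightarrow> real) \<Rightarrow> real^'n \<Rightarrow> real^'n" where
  "grad \<phi> \<equiv> \<lambda>x. \<chi> i. pd i \<phi> x"

lemma test_functions_grad: "\<phi> \<in> test_functions S \<Longrightarrow> grad \<phi> \<in> test_functions S"
  by (intro test_functions_vec test_functions_pd)

lemma grad_lincomb: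
  assumes "\<phi> \<in> test_functions S" "\<psi> \<in> test_functions S"
  shows "grad (\<lambda>x. r * \<phi> x + s * \<psi> x) = (\<lambda>x. r *\<^sub>R grad \<phi> x + s *\<^sub>R grad \<psi> x)"
proof (rule ext)
  fix x
  have d: "\<phi> differentiable (at x)" "\<psi> differentiable (at x)"
    using assms by (auto intro: test_functions_differentiable)
  then have "pd i (\<lambda>x. r * \<phi> x + s * \<psi> x) x = r * pd i \<phi> x + s * pd i \<psi> x" for i
    by (simp add: pd_add pd_mult)
  then show "grad (\<lambda>x. r * \<phi> x + s * \<psi> x) x = r *\<^sub>R grad \<phi> x + s *\<^sub>R grad \<psi> x"
    by (simp add: vec_eq_iff)
qed

lemma H_div0_iff: "v \<in> H_div0 S \<longleftrightarrow> v \<in> L2 S \<and> (\<forall>\<phi>\<in>test_functions S. L2_inner S v (grad \<phi>) = 0)"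
  by (auto simp: H_div0_def H_div_def is_weak_div_def intro!: bexI[of _ "\<lambda>x. 0"])

text \<open>The common properties from which both dimensions are treated at once.
  \<open>rot_grad\<close> makes weak Curls divergence-free, \<open>integral_rot\<close> gives
  constants zero weak Curl, \<open>const_S_h\<close> makes the Curl projection reproduce constants,
  and \<open>Curl_nontrivial\<close> supplies a nontrivial Maxwell solution.\<close>

locale maxwell = edge_elements rot Curl H_Curl S_h
  for rot :: "(real^'n \<Rightarrow> real^'n) \<Rightarrow> real^'n \<Rightarrow> 'b::euclidean_space"
    and Curl :: "(real^'n \<Rightarrow> 'b) \<Rightarrow> real^'n \<Rightarrow> real^'n"
    and H_Curl S_h +
  fixes \<Omega> :: "(real^'n) set"
  assumes open_domain: "open \<Omega>" and bounded_domain: "bounded \<Omega>" and domain_nonempty: "\<Omega> \<noteq> {}"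
    and rot_test: "\<psi> \<in> test_functions \<Omega> \<Longrightarrow> rot \<psi> \<in> test_functions \<Omega>"
    and Curl_test: "\<phi> \<in> test_functions \<Omega> \<Longrightarrow> Curl \<phi> \<in> test_functions \<Omega>"
    and adjoint: "\<psi> \<in> test_functions \<Omega> \<Longrightarrow> \<phi> \<in> test_functions \<Omega> \<Longrightarrow>
      L2_inner \<Omega> \<psi> (Curl \<phi>) = sgn_d * L2_inner \<Omega> (rot \<psi>) \<phi>"
    and rot_grad: "\<eta> \<in> test_functions \<Omega> \<Longrightarrow> rot (grad \<eta>) = (\<lambda>x. 0)"
    and integral_rot: "\<psi> \<in> test_functions \<Omega> \<Longrightarrow> L2_inner \<Omega> (\<lambda>x. c) (rot \<psi>) = 0"
    and Curl_nontrivial: "\<exists>\<phi>\<in>test_functions \<Omega>. \<exists>x. Curl \<phi> x \<noteq> 0"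
    and H_Curl_weak: "\<phi> \<in> H_Curl \<Omega> \<Longrightarrow> \<phi> \<in> L2 \<Omega> \<and> (\<exists>w\<in>L2 \<Omega>. is_weak_Curl \<Omega> \<phi> w)"
    and H1_H_Curl: "H1 \<Omega> \<subseteq> H_Curl \<Omega>"
    and H_Curl_lincomb: "\<phi> \<in> H_Curl \<Omega> \<Longrightarrow> \<phi>' \<in> H_Curl \<Omega> \<Longrightarrow> (\<lambda>x. r *\<^sub>R \<phi> x + s *\<^sub>R \<phi>' x) \<in> H_Curl \<Omega>"
    and S_h_H_Curl: "S_h \<Omega> \<T> \<subseteq> H_Curl \<Omega>"
    and const_S_h: "(\<lambda>x. c) \<in> S_h \<Omega> \<T>"
begin

section \<open>Weak rotations and vanishing tangential traces\<close>

lemma domain_lmeasurable: "\<Omega> \<in> lmeasurable"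
  using bounded_domain open_domain by (rule lmeasurable_open)

lemma domain_sets: "\<Omega> \<in> sets lebesgue"
  using domain_lmeasurable by (rule fmeasurableD)

lemma sgn_d_square: "sgn_d * sgn_d = 1"
  by (simp add: sgn_d_def power_mult_distrib[symmetric])

lemma sgn_d_cancel: "sgn_d * (sgn_d * x) = x"
  using sgn_d_square by (simp add: mult.assoc[symmetric])

lemma test_L2: "\<phi> \<in> test_functions \<Omega> \<Longrightarrow> \<phi> \<in> L2 \<Omega>"
  by (rule test_functions_L2[OF _ domain_lmeasurable])

lemma H_rotD: "v \<in> H_rot \<Omega> \<Longrightarrow> v \<in> L2 \<Omega> \<and> weak_rot \<Omega> v \<in> L2 \<Omega> \<and> is_weak_rot \<Omega> v (weak_rot \<Omega> v)"
  unfolding H_rot_def weak_rot_def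
  by (auto intro: someI2_bex[of _ "\<lambda>w. w \<in> L2 \<Omega> \<and> is_weak_rot \<Omega> v w" for v, simplified])
     (metis (mono_tags, lifting) someI_ex)+

lemma H_CurlD: "\<phi> \<in> H_Curl \<Omega> \<Longrightarrow> \<phi> \<in> L2 \<Omega> \<and> weak_Curl \<Omega> \<phi> \<in> L2 \<Omega> \<and> is_weak_Curl \<Omega> \<phi> (weak_Curl \<Omega> \<phi>)"
  using H_Curl_weak[of \<phi>] unfolding weak_Curl_def by (metis (mono_tags, lifting) someI_ex)

lemma is_weak_rot_unique:
  assumes "is_weak_rot \<Omega> v w" "is_weak_rot \<Omega> v w'" "w \<in> L2 \<Omega>" "w' \<in> L2 \<Omega>"
  shows "ae_eq \<Omega> w w'"
proof (rule ae_eq_if_test_inner_eq[OF open_domain domain_lmeasurable assms(3,4)])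
  fix \<phi> :: "real^'n \<Rightarrow> 'b" assume "\<phi> \<in> test_functions \<Omega>"
  then have "sgn_d * L2_inner \<Omega> w \<phi> = sgn_d * L2_inner \<Omega> w' \<phi>"
    using assms(1,2) unfolding is_weak_rot_def by metis
  then show "L2_inner \<Omega> w \<phi> = L2_inner \<Omega> w' \<phi>" by (metis sgn_d_cancel)
qed

lemma is_weak_Curl_unique:
  assumes "is_weak_Curl \<Omega> v w" "is_weak_Curl \<Omega> v w'" "w \<in> L2 \<Omega>" "w' \<in> L2 \<Omega>"
  shows "ae_eq \<Omega> w w'"
proof (rule ae_eq_if_test_inner_eq[OF open_domain domain_lmeasurable assms(3,4)])
  fix \<phi> :: "real^'n \<Rightarrow> real^'n" assume "\<phi> \<in> test_functions \<Omega>"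
  then have "sgn_d * L2_inner \<Omega> w \<phi> = sgn_d * L2_inner \<Omega> w' \<phi>"
    using assms(1,2) unfolding is_weak_Curl_def by metis
  then show "L2_inner \<Omega> w \<phi> = L2_inner \<Omega> w' \<phi>" by (metis sgn_d_cancel)
qed

lemma weak_rot_unique:
  "v \<in> H_rot \<Omega> \<Longrightarrow> is_weak_rot \<Omega> v w \<Longrightarrow> w \<in> L2 \<Omega> \<Longrightarrow> ae_eq \<Omega> (weak_rot \<Omega> v) w"
  using H_rotD is_weak_rot_unique by blast

lemma weak_Curl_unique:
  "v \<in> H_Curl \<Omega> \<Longrightarrow> is_weak_Curl \<Omega> v w \<Longrightarrow> w \<in> L2 \<Omega> \<Longrightarrow> ae_eq \<Omega> (weak_Curl \<Omega> v) w"
  using H_CurlD is_weak_Curl_unique by blast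

lemma is_weak_rot_lincomb:
  assumes "v \<in> L2 \<Omega>" "v' \<in> L2 \<Omega>" "w \<in> L2 \<Omega>" "w' \<in> L2 \<Omega>" "is_weak_rot \<Omega> v w" "is_weak_rot \<Omega> v' w'"
  shows "is_weak_rot \<Omega> (\<lambda>x. r *\<^sub>R v x + s *\<^sub>R v' x) (\<lambda>x. r *\<^sub>R w x + s *\<^sub>R w' x)"
  using assms unfolding is_weak_rot_def
  by (simp add: L2_inner_add_left L2_scaleR L2_inner_scaleR_left test_L2 Curl_test algebra_simps)

lemma is_weak_Curl_lincomb:
  assumes "v \<in> L2 \<Omega>" "v' \<in> L2 \<Omega>" "w \<in> L2 \<Omega>" "w' \<in> L2 \<Omega>" "is_weak_Curl \<Omega> v w" "is_weak_Curl \<Omega> v' w'"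
  shows "is_weak_Curl \<Omega> (\<lambda>x. r *\<^sub>R v x + s *\<^sub>R v' x) (\<lambda>x. r *\<^sub>R w x + s *\<^sub>R w' x)"
  using assms unfolding is_weak_Curl_def
  by (simp add: L2_inner_add_left L2_scaleR L2_inner_scaleR_left test_L2 rot_test algebra_simps)

lemma weak_Curl_lincomb:
  assumes "\<phi> \<in> H_Curl \<Omega>" "\<phi>' \<in> H_Curl \<Omega>"
  shows "ae_eq \<Omega> (weak_Curl \<Omega> (\<lambda>x. r *\<^sub>R \<phi> x + s *\<^sub>R \<phi>' x)) (\<lambda>x. r *\<^sub>R weak_Curl \<Omega> \<phi> x + s *\<^sub>R weak_Curl \<Omega> \<phi>' x)"
  using H_CurlD[OF assms(1)] H_CurlD[OF assms(2)]
  by (intro weak_Curl_unique H_Curl_lincomb assms is_weak_Curl_lincomb L2_lincomb) auto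

lemma const_H_Curl: "(\<lambda>x. c) \<in> H_Curl \<Omega>"
  using const_S_h S_h_H_Curl by blast

lemma weak_Curl_const: "ae_eq \<Omega> (weak_Curl \<Omega> (\<lambda>x. c)) (\<lambda>x. 0)"
  by (rule weak_Curl_unique[OF const_H_Curl]) (auto simp: is_weak_Curl_def integral_rot)

text \<open>\<open>weak_rot\<close> is an arbitrary choice of representative, so its linearity is an
  instance of uniqueness and holds only almost everywhere.\<close>

lemma H_rot_lincomb:
  assumes "v \<in> H_rot \<Omega>" "v' \<in> H_rot \<Omega>"
  shows "(\<lambda>x. r *\<^sub>R v x + s *\<^sub>R v' x) \<in> H_rot \<Omega>"
    and "ae_eq \<Omega> (weak_rot \<Omega> (\<lambda>x. r *\<^sub>R v x + s *\<^sub>R v' x)) (\<lambda>x. r *\<^sub>R weak_rot \<Omega> v x + s *\<^sub>R weak_rot \<Omega> v' x)"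
proof -
  note H = H_rotD[OF assms(1)] H_rotD[OF assms(2)]
  have w: "is_weak_rot \<Omega> (\<lambda>x. r *\<^sub>R v x + s *\<^sub>R v' x) (\<lambda>x. r *\<^sub>R weak_rot \<Omega> v x + s *\<^sub>R weak_rot \<Omega> v' x)"
    using H by (intro is_weak_rot_lincomb) auto
  have l: "(\<lambda>x. r *\<^sub>R v x + s *\<^sub>R v' x) \<in> L2 \<Omega>" "(\<lambda>x. r *\<^sub>R weak_rot \<Omega> v x + s *\<^sub>R weak_rot \<Omega> v' x) \<in> L2 \<Omega>"
    using H by (auto intro: L2_lincomb)
  show h: "(\<lambda>x. r *\<^sub>R v x + s *\<^sub>R v' x) \<in> H_rot \<Omega>" using w l unfolding H_rot_def by blast
  show "ae_eq \<Omega> (weak_rot \<Omega> (\<lambda>x. r *\<^sub>R v x + s *\<^sub>R v' x)) (\<lambda>x. r *\<^sub>R weak_rot \<Omega> v x + s *\<^sub>R weak_rot \<Omega> v' x)"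
    by (rule weak_rot_unique[OF h w l(2)])
qed

lemma a_commute: "a \<Omega> v w = a \<Omega> w v"
  by (simp add: a_def L2_inner_commute)

lemma a_nonneg: "0 \<le> a \<Omega> v v"
  by (simp add: a_def L2_norm_power2_inner[symmetric])

lemma a_norm_eq: "a_norm \<Omega> v = L2_norm \<Omega> (weak_rot \<Omega> v)"
  by (simp add: a_norm_def a_def L2_norm_power2_inner[symmetric])

lemma a_lincomb:
  assumes "v \<in> H_rot \<Omega>" "v' \<in> H_rot \<Omega>" "w \<in> H_rot \<Omega>"
  shows "a \<Omega> (\<lambda>x. r *\<^sub>R v x + s *\<^sub>R v' x) w = r * a \<Omega> v w + s * a \<Omega> v' w"
proof -
  note H = H_rotD[OF assms(1)] H_rotD[OF assms(2)] H_rotD[OF assms(3)]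
  have "a \<Omega> (\<lambda>x. r *\<^sub>R v x + s *\<^sub>R v' x) w = L2_inner \<Omega> (\<lambda>x. r *\<^sub>R weak_rot \<Omega> v x + s *\<^sub>R weak_rot \<Omega> v' x) (weak_rot \<Omega> w)"
    unfolding a_def using H H_rotD[OF H_rot_lincomb(1)[OF assms(1,2)]]
    by (intro L2_inner_cong H_rot_lincomb(2) assms L2_lincomb) auto
  then show ?thesis
    using H by (simp add: a_def L2_inner_add_left L2_scaleR L2_inner_scaleR_left)
qed

lemma a_diff:
  assumes "v \<in> H_rot \<Omega>" "v' \<in> H_rot \<Omega>" "w \<in> H_rot \<Omega>"
  shows "a \<Omega> (\<lambda>x. v x - v' x) w = a \<Omega> v w - a \<Omega> v' w"
  using a_lincomb[OF assms, of 1 "-1"] by simp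

lemma H0_rot_iff:
  "v \<in> H0_rot \<Omega> \<longleftrightarrow> v \<in> H_rot \<Omega> \<and>
    (\<forall>\<phi>\<in>H_Curl \<Omega>. L2_inner \<Omega> (weak_rot \<Omega> v) \<phi> = sgn_d * L2_inner \<Omega> v (weak_Curl \<Omega> \<phi>))"
  by (auto simp: H0_rot_def tangential_trace_def)

text \<open>Allows the trace condition to be checked with any representative \<open>w\<close> of the
  weak rotation in place of the chosen one.\<close>

lemma H0_rotI:
  assumes "v \<in> L2 \<Omega>" "w \<in> L2 \<Omega>" "is_weak_rot \<Omega> v w"
    and "\<And>\<phi>. \<phi> \<in> H_Curl \<Omega> \<Longrightarrow> L2_inner \<Omega> w \<phi> = sgn_d * L2_inner \<Omega> v (weak_Curl \<Omega> \<phi>)"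
  shows "v \<in> H0_rot \<Omega>" "ae_eq \<Omega> (weak_rot \<Omega> v) w"
proof -
  have h: "v \<in> H_rot \<Omega>" using assms unfolding H_rot_def by blast
  show e: "ae_eq \<Omega> (weak_rot \<Omega> v) w" by (rule weak_rot_unique[OF h assms(3,2)])
  show "v \<in> H0_rot \<Omega>"
    unfolding H0_rot_iff using h assms(4) L2_inner_cong[OF e _ assms(2)] H_rotD[OF h] H_CurlD by auto
qed

lemma H0_rot_lincomb:
  assumes "v \<in> H0_rot \<Omega>" "v' \<in> H0_rot \<Omega>"
  shows "(\<lambda>x. r *\<^sub>R v x + s *\<^sub>R v' x) \<in> H0_rot \<Omega>"
proof -
  have h: "v \<in> H_rot \<Omega>" "v' \<in> H_rot \<Omega>" using assms by (auto simp: H0_rot_iff)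
  note H = H_rotD[OF h(1)] H_rotD[OF h(2)]
  show ?thesis
  proof (rule H0_rotI(1)[where w="\<lambda>x. r *\<^sub>R weak_rot \<Omega> v x + s *\<^sub>R weak_rot \<Omega> v' x"])
    show "is_weak_rot \<Omega> (\<lambda>x. r *\<^sub>R v x + s *\<^sub>R v' x) (\<lambda>x. r *\<^sub>R weak_rot \<Omega> v x + s *\<^sub>R weak_rot \<Omega> v' x)"
      using H by (intro is_weak_rot_lincomb) auto
    fix \<phi> assume \<phi>: "\<phi> \<in> H_Curl \<Omega>"
    show "L2_inner \<Omega> (\<lambda>x. r *\<^sub>R weak_rot \<Omega> v x + s *\<^sub>R weak_rot \<Omega> v' x) \<phi> =
        sgn_d * L2_inner \<Omega> (\<lambda>x. r *\<^sub>R v x + s *\<^sub>R v' x) (weak_Curl \<Omega> \<phi>)"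
      using H H_CurlD[OF \<phi>] assms \<phi>
      by (simp add: L2_inner_add_left L2_scaleR L2_inner_scaleR_left H0_rot_iff algebra_simps)
  qed (use H in \<open>auto intro: L2_lincomb\<close>)
qed

lemma test_H0_rot:
  assumes "\<psi> \<in> test_functions \<Omega>"
  shows "\<psi> \<in> H0_rot \<Omega>" "ae_eq \<Omega> (weak_rot \<Omega> \<psi>) (rot \<psi>)"
proof -
  have "is_weak_rot \<Omega> \<psi> (rot \<psi>)" using adjoint[OF assms] by (auto simp: is_weak_rot_def)
  moreover have "L2_inner \<Omega> (rot \<psi>) \<phi> = sgn_d * L2_inner \<Omega> \<psi> (weak_Curl \<Omega> \<phi>)" if "\<phi> \<in> H_Curl \<Omega>" for \<phi>
    using H_CurlD[OF that] assms by (simp add: is_weak_Curl_def L2_inner_commute)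
  ultimately show "\<psi> \<in> H0_rot \<Omega>" "ae_eq \<Omega> (weak_rot \<Omega> \<psi>) (rot \<psi>)"
    using H0_rotI[OF test_L2[OF assms] test_L2[OF rot_test[OF assms]]] by auto
qed

section \<open>Divergence-free fields, Helmholtz decomposition and the error bound\<close>

lemma weak_Curl_H_div0:
  assumes "\<phi> \<in> H_Curl \<Omega>"
  shows "weak_Curl \<Omega> \<phi> \<in> H_div0 \<Omega>"
proof -
  have "L2_inner \<Omega> (weak_Curl \<Omega> \<phi>) (grad \<eta>) = 0" if "\<eta> \<in> test_functions \<Omega>" for \<eta>
  proof -
    have "L2_inner \<Omega> \<phi> (rot (grad \<eta>)) = sgn_d * L2_inner \<Omega> (weak_Curl \<Omega> \<phi>) (grad \<eta>)"
      using H_CurlD[OF assms] test_functions_grad[OF that] by (auto simp: is_weak_Curl_def)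
    then show ?thesis using rot_grad[OF that] sgn_d_square by (auto simp: L2_inner_def)
  qed
  then show ?thesis using H_CurlD[OF assms] by (simp add: H_div0_iff)
qed

lemma Curl_test_H_div0:
  assumes "\<phi> \<in> test_functions \<Omega>"
  shows "Curl \<phi> \<in> H_div0 \<Omega>"
proof -
  have "L2_inner \<Omega> (Curl \<phi>) (grad \<eta>) = 0" if "\<eta> \<in> test_functions \<Omega>" for \<eta>
    using adjoint[OF test_functions_grad[OF that] assms] rot_grad[OF that]
    by (simp add: L2_inner_commute[of \<Omega> "Curl \<phi>"])
  then show ?thesis using test_L2[OF Curl_test[OF assms]] by (simp add: H_div0_iff)
qed

text \<open>The limit \<open>g\<close> of gradients enters only through its orthogonality to
  divergence-free fields. Weak Curls are such fields, so subtracting \<open>g\<close> changes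
  neither the weak rotation nor the tangential trace, while the projection makes the remainder
  divergence-free.\<close>

lemma Helmholtz:
  assumes v: "v \<in> H0_rot \<Omega>"
  obtains g where "g \<in> L2 \<Omega>" "(\<lambda>x. v x - g x) \<in> V \<Omega>"
    "ae_eq \<Omega> (weak_rot \<Omega> (\<lambda>x. v x - g x)) (weak_rot \<Omega> v)"
    "\<And>f. f \<in> H_div0 \<Omega> \<Longrightarrow> L2_inner \<Omega> g f = 0"
proof -
  have vL: "v \<in> L2 \<Omega>" "weak_rot \<Omega> v \<in> L2 \<Omega>" "is_weak_rot \<Omega> v (weak_rot \<Omega> v)"
    using v H_rotD by (auto simp: H0_rot_iff)
  define E where "E = grad ` (test_functions \<Omega> :: (real^'n \<Rightarrow> real) set)"
  have lin: "(\<lambda>x. r *\<^sub>R p x + s *\<^sub>R q x) \<in> E" if pq: "p \<in> E" "q \<in> E" for p q r s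
  proof -
    obtain \<phi> \<psi> where "p = grad \<phi>" "\<phi> \<in> test_functions \<Omega>" "q = grad \<psi>" "\<psi> \<in> test_functions \<Omega>"
      using pq by (auto simp: E_def)
    moreover from this have "(\<lambda>x. r * \<phi> x + s * \<psi> x) \<in> test_functions \<Omega>"
      by (intro test_functions_add test_functions_bounded_linear[OF _ bounded_linear_mult_right])
    ultimately show ?thesis unfolding E_def
      by (intro image_eqI[where x="\<lambda>x. r * \<phi> x + s * \<psi> x"]) (simp_all add: grad_lincomb)
  qed
  have "E \<noteq> {}"
    unfolding E_def using test_functions_zero by blast
  have "E \<subseteq> L2 \<Omega>"
    unfolding E_def using test_L2[OF test_functions_grad] by blast
  have "\<exists>g e. g \<in> L2 \<Omega> \<and> (\<forall>n::nat. e n \<in> E) \<and> (\<lambda>n. L2_norm \<Omega> (\<lambda>x. e n x - g x)) \<longlonglongrightarrow> 0 \<and>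
      (\<forall>w\<in>E. L2_inner \<Omega> (\<lambda>x. v x - g x) w = 0)"
    by (rule L2_projection_closure[OF domain_lmeasurable \<open>E \<subseteq> L2 \<Omega>\<close> \<open>E \<noteq> {}\<close> lin vL(1)]) auto
  then obtain g e where g: "g \<in> L2 \<Omega>" and e: "\<And>n::nat. e n \<in> E"
    and lim: "(\<lambda>n. L2_norm \<Omega> (\<lambda>x. e n x - g x)) \<longlonglongrightarrow> 0"
    and orth: "\<And>w. w \<in> E \<Longrightarrow> L2_inner \<Omega> (\<lambda>x. v x - g x) w = 0"
    by auto
  have eL: "e n \<in> L2 \<Omega>" for n using e \<open>E \<subseteq> L2 \<Omega>\<close> by auto
  \<comment> \<open>Orthogonality to all gradients of test functions survives the L2 limit.\<close>
  have g0: "L2_inner \<Omega> g w = 0" if "w \<in> L2 \<Omega>" "\<And>\<eta>. \<eta> \<in> test_functions \<Omega> \<Longrightarrow> L2_inner \<Omega> (grad \<eta>) w = 0" for w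
  proof -
    have "L2_inner \<Omega> (e n) w = 0" for n using e[of n] that(2) by (auto simp: E_def)
    then show ?thesis
      using L2_inner_tendsto[OF eL g that(1) lim] by (simp add: LIMSEQ_const_iff)
  qed
  have gCurl: "L2_inner \<Omega> g (weak_Curl \<Omega> \<phi>) = 0" if "\<phi> \<in> H_Curl \<Omega>" for \<phi>
    using weak_Curl_H_div0[OF that] H_CurlD[OF that]
    by (intro g0) (auto simp: H_div0_iff L2_inner_commute)
  have gCurl': "L2_inner \<Omega> g (Curl \<phi>) = 0" if "\<phi> \<in> test_functions \<Omega>" for \<phi>
    using Curl_test_H_div0[OF that] by (intro g0) (auto simp: H_div0_iff L2_inner_commute)
  have d: "(\<lambda>x. v x - g x) \<in> L2 \<Omega>" by (rule L2_diff[OF vL(1) g])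
  have "is_weak_rot \<Omega> (\<lambda>x. v x - g x) (weak_rot \<Omega> v)"
    using vL(3) test_L2[OF Curl_test] by (simp add: is_weak_rot_def L2_inner_diff_left vL g gCurl')
  moreover have "L2_inner \<Omega> (weak_rot \<Omega> v) \<phi> = sgn_d * L2_inner \<Omega> (\<lambda>x. v x - g x) (weak_Curl \<Omega> \<phi>)"
    if "\<phi> \<in> H_Curl \<Omega>" for \<phi>
    using v that H_CurlD[OF that] by (simp add: H0_rot_iff L2_inner_diff_left vL g gCurl)
  ultimately have r: "(\<lambda>x. v x - g x) \<in> H0_rot \<Omega>" "ae_eq \<Omega> (weak_rot \<Omega> (\<lambda>x. v x - g x)) (weak_rot \<Omega> v)"
    using H0_rotI[OF d vL(2)] by auto
  have "(\<lambda>x. v x - g x) \<in> H_div0 \<Omega>"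
    unfolding H_div0_iff using d orth by (auto simp: E_def)
  then have "(\<lambda>x. v x - g x) \<in> V \<Omega>" using r by (simp add: V_def)
  moreover have "L2_inner \<Omega> g f = 0" if "f \<in> H_div0 \<Omega>" for f
    using that by (intro g0) (auto simp: H_div0_iff L2_inner_commute)
  ultimately show thesis using that g r(2) by blast
qed

text \<open>The component \<open>g\<close> of \<open>v\<close> is invisible to both sides: it does
  not affect the rotation, and it is orthogonal to the divergence-free \<open>f\<close>. Discrete
  functions need not lie in \<open>V\<close>, so the Galerkin argument depends on this
  extension.\<close>

lemma solves_V_H0_rot:
  assumes f: "f \<in> H_div0 \<Omega>" and u: "solves \<Omega> (V \<Omega>) f u" and v: "v \<in> H0_rot \<Omega>"
  shows "a \<Omega> u v = L2_inner \<Omega> f v"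
proof -
  obtain g where g: "g \<in> L2 \<Omega>" "(\<lambda>x. v x - g x) \<in> V \<Omega>"
    "ae_eq \<Omega> (weak_rot \<Omega> (\<lambda>x. v x - g x)) (weak_rot \<Omega> v)" "L2_inner \<Omega> g f = 0"
    by (rule Helmholtz[OF v]) (use f in blast)
  have H: "u \<in> H_rot \<Omega>" "v \<in> H_rot \<Omega>" "(\<lambda>x. v x - g x) \<in> H_rot \<Omega>"
    using u v g(2) by (auto simp: solves_def V_def H0_rot_iff)
  have rL: "weak_rot \<Omega> u \<in> L2 \<Omega>" "weak_rot \<Omega> v \<in> L2 \<Omega>" "weak_rot \<Omega> (\<lambda>x. v x - g x) \<in> L2 \<Omega>" "v \<in> L2 \<Omega>"
    by (simp_all only: H_rotD[OF H(1)] H_rotD[OF H(2)] H_rotD[OF H(3)])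
  have "a \<Omega> u v = a \<Omega> u (\<lambda>x. v x - g x)"
    using L2_inner_cong[OF ae_eq_sym[OF g(3)], of "weak_rot \<Omega> u"] rL
    by (simp only: a_def L2_inner_commute[of \<Omega> "weak_rot \<Omega> u"])
  also have "\<dots> = L2_inner \<Omega> f (\<lambda>x. v x - g x)" using u g(2) by (simp add: solves_def)
  also have "\<dots> = L2_inner \<Omega> f v"
    using g(1,4) f rL(4) by (simp add: L2_inner_diff_right H_div0_iff L2_inner_commute[of \<Omega> f g])
  finally show ?thesis .
qed

text \<open>The vanishing trace of \<open>v\<close> removes the boundary term in Green's formula,
  and the sign in the equation for \<tau> cancels the sign of that formula because
  \<open>sgn_d\<close> squares to 1.\<close>

lemma weak_Curl_weak_rot_adjoint:
  assumes \<tau>: "\<tau> \<in> H_Curl \<Omega>" "is_weak_Curl \<Omega> \<tau> (\<lambda>x. sgn_d *\<^sub>R f x)" and f: "f \<in> L2 \<Omega>" and v: "v \<in> H0_rot \<Omega>"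
  shows "L2_inner \<Omega> \<tau> (weak_rot \<Omega> v) = L2_inner \<Omega> f v"
proof -
  have vL: "v \<in> L2 \<Omega>" using v H_rotD by (auto simp: H0_rot_iff)
  have "L2_inner \<Omega> \<tau> (weak_rot \<Omega> v) = sgn_d * L2_inner \<Omega> (weak_Curl \<Omega> \<tau>) v"
    using v \<tau>(1) by (simp add: H0_rot_iff L2_inner_commute)
  also have "L2_inner \<Omega> (weak_Curl \<Omega> \<tau>) v = L2_inner \<Omega> (\<lambda>x. sgn_d *\<^sub>R f x) v"
    using H_CurlD[OF \<tau>(1)] f vL
    by (intro L2_inner_cong weak_Curl_unique \<tau> L2_scaleR) auto
  finally show ?thesis by (simp add: L2_inner_scaleR_left sgn_d_cancel)
qed

text \<open>Galerkin orthogonality is used twice: it drops the part of the error paired with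
  \<open>u_h\<close>, and it inserts the arbitrary \<open>v_h\<close>. In between, the extended
  equation and the adjoint relation replace \<open>u\<close> by \<tau>; Cauchy-Schwarz
  finishes.\<close>

lemma hypercircle_bound:
  assumes f: "f \<in> H_div0 \<Omega>" and u: "solves \<Omega> (V \<Omega>) f u"
    and \<tau>: "\<tau> \<in> H_Curl \<Omega>" "is_weak_Curl \<Omega> \<tau> (\<lambda>x. sgn_d *\<^sub>R f x)"
    and W: "W \<subseteq> H0_rot \<Omega>" and uh: "u_h \<in> W" "\<And>v. v \<in> W \<Longrightarrow> a \<Omega> (\<lambda>x. u x - u_h x) v = 0" and vh: "v_h \<in> W"
  shows "a_norm \<Omega> (\<lambda>x. u x - u_h x) \<le> L2_norm \<Omega> (\<lambda>x. \<tau> x - weak_rot \<Omega> v_h x)"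
proof -
  have uV: "u \<in> H0_rot \<Omega>" using u by (simp add: solves_def V_def)
  have H0: "u_h \<in> H0_rot \<Omega>" "v_h \<in> H0_rot \<Omega>" using W uh vh by auto
  have e0: "(\<lambda>x. u x - u_h x) \<in> H0_rot \<Omega>" using H0_rot_lincomb[OF uV H0(1), of 1 "-1"] by simp
  have H: "u \<in> H_rot \<Omega>" "u_h \<in> H_rot \<Omega>" "v_h \<in> H_rot \<Omega>" "(\<lambda>x. u x - u_h x) \<in> H_rot \<Omega>"
    using uV H0 e0 by (auto simp: H0_rot_iff)
  have L: "weak_rot \<Omega> u \<in> L2 \<Omega>" "weak_rot \<Omega> u_h \<in> L2 \<Omega>" "weak_rot \<Omega> v_h \<in> L2 \<Omega>"
    "weak_rot \<Omega> (\<lambda>x. u x - u_h x) \<in> L2 \<Omega>" "\<tau> \<in> L2 \<Omega>"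
    using H[THEN H_rotD] H_CurlD[OF \<tau>(1)] by auto
  define e where "e = weak_rot \<Omega> (\<lambda>x. u x - u_h x)"
  have eL: "e \<in> L2 \<Omega>" using L by (simp add: e_def)
  have "(L2_norm \<Omega> e)\<^sup>2 = a \<Omega> (\<lambda>x. u x - u_h x) (\<lambda>x. u x - u_h x)"
    by (simp add: L2_norm_power2_inner a_def e_def)
  also have "\<dots> = a \<Omega> u (\<lambda>x. u x - u_h x) - a \<Omega> (\<lambda>x. u x - u_h x) u_h"
    using a_diff[OF H(1,2,4)] by (simp add: a_commute)
  also have "\<dots> = L2_inner \<Omega> f (\<lambda>x. u x - u_h x)"
    using uh solves_V_H0_rot[OF f u e0] by simp
  also have "\<dots> = L2_inner \<Omega> \<tau> e"
    using weak_Curl_weak_rot_adjoint[OF \<tau> _ e0] f by (simp add: H_div0_iff e_def)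
  also have "\<dots> = L2_inner \<Omega> e (\<lambda>x. \<tau> x - weak_rot \<Omega> v_h x)"
    using uh(2)[OF vh] by (simp add: L2_inner_diff_right L eL a_def e_def[symmetric] L2_inner_commute)
  also have "\<dots> \<le> L2_norm \<Omega> e * L2_norm \<Omega> (\<lambda>x. \<tau> x - weak_rot \<Omega> v_h x)"
    using L2_Cauchy_Schwarz[OF eL L2_diff[OF L(5,3)]] by simp
  finally have "L2_norm \<Omega> e * L2_norm \<Omega> e \<le> L2_norm \<Omega> e * L2_norm \<Omega> (\<lambda>x. \<tau> x - weak_rot \<Omega> v_h x)"
    by (simp add: power2_eq_square)
  then have "L2_norm \<Omega> e \<le> L2_norm \<Omega> (\<lambda>x. \<tau> x - weak_rot \<Omega> v_h x)"
    by (smt (verit) L2_norm_nonneg mult_left_le_imp_le)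
  then show ?thesis by (simp add: a_norm_eq e_def)
qed

end

section \<open>Triangulations and patches\<close>

text \<open>A local graph leaves no room for slits: directly above a boundary point lie points
  outside the closure. Patches are interiors of unions of closed elements, and this places them
  inside \<Omega>.\<close>

lemma interior_closure_lipschitz:
  fixes \<Omega> :: "(real^'n) set"
  assumes op: "open \<Omega>" and lip: "lipschitz_boundary \<Omega>"
  shows "interior (closure \<Omega>) = \<Omega>"
proof
  show "\<Omega> \<subseteq> interior (closure \<Omega>)" using op by (simp add: interior_maximal closure_subset)
  show "interior (closure \<Omega>) \<subseteq> \<Omega>"
  proof
    fix p assume p: "p \<in> interior (closure \<Omega>)"
    show "p \<in> \<Omega>"
    proof (rule ccontr)
      assume np: "p \<notin> \<Omega>"
      then have "p \<in> frontier \<Omega>" using p op interior_subset by (auto simp: frontier_def interior_open)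
      then obtain \<nu> r L and \<gamma> :: "real^'n \<Rightarrow> real" where n: "norm \<nu> = 1" "0 < r" "L-lipschitz_on UNIV \<gamma>"
        and eq: "\<Omega> \<inter> ball p r = {y \<in> ball p r. y \<bullet> \<nu> < \<gamma> (y - (y \<bullet> \<nu>) *\<^sub>R \<nu>)}"
        using lip unfolding lipschitz_boundary_def by blast
      have c\<gamma>: "continuous_on UNIV \<gamma>" using n(3) lipschitz_on_continuous_on by blast
      define U where "U = {y. \<gamma> (y - (y \<bullet> \<nu>) *\<^sub>R \<nu>) < y \<bullet> \<nu>} \<inter> ball p r"
      have "open U" unfolding U_def
        by (intro open_Int open_Collect_less open_ball continuous_intros continuous_on_compose2[OF c\<gamma>]) auto
      moreover have "U \<inter> \<Omega> = {}" using eq by (force simp: U_def)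
      ultimately have U: "U \<inter> closure \<Omega> = {}" by (simp add: open_Int_closure_eq_empty)
      have pge: "\<gamma> (p - (p \<bullet> \<nu>) *\<^sub>R \<nu>) \<le> p \<bullet> \<nu>"
      proof (rule ccontr)
        assume "\<not> \<gamma> (p - (p \<bullet> \<nu>) *\<^sub>R \<nu>) \<le> p \<bullet> \<nu>"
        then have "p \<in> \<Omega> \<inter> ball p r" unfolding eq using n(2) by simp
        then show False using np by simp
      qed
      obtain e where e: "e > 0" "ball p e \<subseteq> closure \<Omega>" using p mem_interior by blast
      \<comment> \<open>The shifted point \<open>q\<close> stays in both balls while lying strictly
        above the graph.\<close>
      define t where "t = min e r / 2"
      have t: "t > 0" "t < e" "t < r" using e n by (auto simp: t_def)
      define q where "q = p + t *\<^sub>R \<nu>"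
      have nn: "\<nu> \<bullet> \<nu> = 1" using n(1) by (simp add: norm_eq_1)
      have "q - (q \<bullet> \<nu>) *\<^sub>R \<nu> = p - (p \<bullet> \<nu>) *\<^sub>R \<nu>" using nn by (simp add: q_def inner_add_left algebra_simps)
      moreover have "q \<bullet> \<nu> = p \<bullet> \<nu> + t" using nn by (simp add: q_def inner_add_left)
      moreover have d: "dist p q = t" using n(1) t by (simp add: q_def dist_norm)
      ultimately have "q \<in> U" using pge t by (simp add: U_def)
      moreover have "q \<in> closure \<Omega>" using e(2) d t by auto
      ultimately show False using U by auto
    qed
  qed
qed

locale mesh =
  fixes \<Omega> :: "(real^'n) set" and \<T> :: "(real^'n) set set"
  assumes bounded_mesh: "bounded \<Omega>" and open_mesh: "open \<Omega>" and mesh_nonempty: "\<Omega> \<noteq> {}"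
    and connected_mesh: "connected \<Omega>" and lipschitz_mesh: "lipschitz_boundary \<Omega>"
    and triangulation_mesh: "regular_triangulation \<Omega> \<T>"
begin

section \<open>Geometry of the elements\<close>

lemma mesh_lmeasurable: "\<Omega> \<in> lmeasurable"
  using bounded_mesh open_mesh by (rule lmeasurable_open)

lemma mesh_sets: "\<Omega> \<in> sets lebesgue"
  using mesh_lmeasurable by (rule fmeasurableD)

lemma finite_mesh: "finite \<T>"
  using triangulation_mesh by (simp add: regular_triangulation_def triangulation_def)

lemma Union_mesh: "\<Union>\<T> = closure \<Omega>"
  using triangulation_mesh by (simp add: regular_triangulation_def)

lemma mesh_not_empty: "\<T> \<noteq> {}"
  using Union_mesh mesh_nonempty by (metis Union_empty closure_eq_empty)

lemma simplex_mesh: "T \<in> \<T> \<Longrightarrow> int CARD('n) simplex T"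
  using triangulation_mesh by (simp add: regular_triangulation_def)

lemma convex_element: "T \<in> \<T> \<Longrightarrow> convex T"
  using simplex_mesh convex_simplex by blast

lemma compact_element: "T \<in> \<T> \<Longrightarrow> compact T"
  using simplex_mesh compact_simplex by blast

lemma aff_dim_element: "T \<in> \<T> \<Longrightarrow> aff_dim T = int CARD('n)"
  using simplex_mesh aff_dim_simplex by blast

lemma element_nonempty: "T \<in> \<T> \<Longrightarrow> T \<noteq> {}"
  using aff_dim_element by fastforce

lemma rel_interior_element: "T \<in> \<T> \<Longrightarrow> rel_interior T = interior T"
  using aff_dim_element[of T] by (intro rel_interior_interior) (simp add: aff_dim_eq_full[symmetric])

lemma interior_element_nonempty: "T \<in> \<T> \<Longrightarrow> interior T \<noteq> {}"
  using rel_interior_element rel_interior_eq_empty convex_element element_nonempty by metis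

lemma closure_interior_element: "T \<in> \<T> \<Longrightarrow> closure (interior T) = T"
  using convex_closure_interior[OF convex_element interior_element_nonempty] compact_element
  by (simp add: compact_imp_closed)

lemma interior_element_subset: "T \<in> \<T> \<Longrightarrow> interior T \<subseteq> \<Omega>"
  using interior_mono[of T "closure \<Omega>"] Union_mesh interior_closure_lipschitz[OF open_mesh lipschitz_mesh] by auto

lemma negligible_element_boundary: "T \<in> \<T> \<Longrightarrow> negligible (T - interior T)"
  using negligible_convex_frontier[OF convex_element]
  by (rule negligible_subset) (auto simp: frontier_def dest: closure_subset[THEN subsetD])

text \<open>The common face meets the relative interior of \<open>T\<close>, hence is all of
  \<open>T\<close>. A proper face of \<open>K\<close> would have smaller dimension, but all elements
  have full dimension.\<close>

lemma interior_element_disjoint: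
  assumes T: "T \<in> \<T>" and K: "K \<in> \<T>" and x: "x \<in> interior T" "x \<in> K"
  shows "T = K"
proof (rule ccontr)
  assume ne: "T \<noteq> K"
  have face: "(T \<inter> K) face_of T" "(K \<inter> T) face_of K"
    using triangulation_mesh T K by (auto simp: regular_triangulation_def triangulation_def)
  have "x \<in> T" using x interior_subset by blast
  then have "T \<subseteq> T \<inter> K"
    using x rel_interior_element[OF T] by (intro subset_of_face_of[OF face(1)]) auto
  then have "K \<inter> T = T" by auto
  then have "T face_of K" using face(2) by simp
  then have "aff_dim T < aff_dim K" by (rule face_of_aff_dim_lt[OF convex_element[OF K]]) (rule ne)
  then show False using aff_dim_element T K by simp
qed

section \<open>Element patches, splitting of norms and overlap\<close>

lemma patch_open: "open (patch \<T> T)"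
  by (simp add: patch_def)

lemma patch_subset: "patch \<T> T \<subseteq> \<Omega>"
proof -
  have "patch \<T> T \<subseteq> interior (closure \<Omega>)"
    unfolding patch_def using Union_mesh by (intro interior_mono) auto
  then show ?thesis by (simp add: interior_closure_lipschitz[OF open_mesh lipschitz_mesh])
qed

lemma patch_lmeasurable: "patch \<T> T \<in> lmeasurable"
  by (rule lmeasurable_open[OF bounded_subset[OF bounded_mesh patch_subset] patch_open])

lemma interior_element_patch:
  assumes "T \<in> \<T>" "K \<in> \<T>" "K \<inter> T \<noteq> {}"
  shows "interior K \<subseteq> patch \<T> T"
  unfolding patch_def using assms by (intro interior_mono) auto

lemma interior_element_own_patch: "T \<in> \<T> \<Longrightarrow> interior T \<subseteq> patch \<T> T"
  using element_nonempty by (intro interior_element_patch) auto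

lemma measure_interior_element_pos: "T \<in> \<T> \<Longrightarrow> measure lebesgue (interior T) > 0"
proof -
  assume T: "T \<in> \<T>"
  have "\<not> negligible (interior T)" using interior_element_nonempty[OF T] open_not_negligible by blast
  moreover have "interior T \<in> lmeasurable"
    by (rule lmeasurable_interior) (use compact_element[OF T] compact_imp_bounded in blast)
  ultimately show ?thesis by (simp add: negligible_iff_measure less_le)
qed

lemma interior_element_lmeasurable: "T \<in> \<T> \<Longrightarrow> interior T \<in> lmeasurable"
  by (rule lmeasurable_interior) (use compact_element compact_imp_bounded in blast)

lemma AE_interior_element: "AE x in lebesgue. x \<in> \<Omega> \<longrightarrow> (\<exists>T\<in>\<T>. x \<in> interior T)"
proof -
  have "negligible (\<Union>T\<in>\<T>. T - interior T)"
    using finite_mesh negligible_element_boundary by (intro negligible_Union) auto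
  then have "(\<Union>T\<in>\<T>. T - interior T) \<in> null_sets lebesgue" by (simp add: negligible_iff_null_sets)
  then have "AE x in lebesgue. x \<notin> (\<Union>T\<in>\<T>. T - interior T)" by (rule AE_not_in)
  then show ?thesis
  proof eventually_elim
    case (elim x)
    show ?case
    proof
      assume "x \<in> \<Omega>"
      then have "x \<in> \<Union>\<T>" using Union_mesh closure_subset by auto
      then show "\<exists>T\<in>\<T>. x \<in> interior T" using elim by auto
    qed
  qed
qed

text \<open>Closed elements may touch the boundary of \<Omega>, where nothing is known about
  \<open>v\<close>. Passing to the interior costs a null set and moves every norm inside the
  domain.\<close>

lemma L2_norm_element:
  assumes T: "T \<in> \<T>" and v: "v \<in> L2 \<Omega>"
  shows "L2_norm T v = L2_norm (interior T) v"
proof -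
  have i: "v \<in> L2 (interior T)"
    using L2_subset[OF v interior_element_subset[OF T]] mesh_sets by (simp add: borel_open)
  have meas: "(\<lambda>x. indicator (interior T) x *\<^sub>R (norm (v x))\<^sup>2) \<in> borel_measurable lebesgue"
    using L2_integrable_power2[OF i] by (auto simp: integrable_restrict_space borel_open dest: borel_measurable_integrable)
  have ae: "AE x in lebesgue. indicator (interior T) x *\<^sub>R (norm (v x))\<^sup>2 = indicator T x *\<^sub>R (norm (v x))\<^sup>2"
  proof -
    have "AE x in lebesgue. x \<notin> T - interior T"
      using negligible_element_boundary[OF T] by (intro AE_not_in) (simp add: negligible_iff_null_sets)
    then show ?thesis
      by eventually_elim (use interior_subset[of T] in \<open>auto simp: indicator_def\<close>)
  qed
  have "integral\<^sup>L lebesgue (\<lambda>x. indicator T x *\<^sub>R (norm (v x))\<^sup>2) = integral\<^sup>L lebesgue (\<lambda>x. indicator (interior T) x *\<^sub>R (norm (v x))\<^sup>2)"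
    by (rule integral_cong_AE[OF borel_measurable_AE[OF meas ae] meas]) (use ae in eventually_elim, auto)
  moreover have "T \<in> sets lebesgue" using compact_element[OF T] by (simp add: borel_compact)
  ultimately show ?thesis
    by (simp add: L2_norm_def integral_restrict_space borel_open)
qed

text \<open>Writes the norms over all subsets as integrals of one density against indicators, so
  that sums over elements or patches reduce to pointwise counting.\<close>

lemma L2_norm_power2_weighted:
  assumes v: "v \<in> L2 \<Omega>" and S: "S \<subseteq> \<Omega>" "S \<in> sets lebesgue"
  defines "f \<equiv> \<lambda>x. indicator \<Omega> x *\<^sub>R (norm (v x))\<^sup>2"
  shows "(L2_norm S v)\<^sup>2 = integral\<^sup>L lebesgue (\<lambda>x. indicator S x * f x)"
    and "integrable lebesgue (\<lambda>x. indicator S x * f x)"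
proof -
  have eq: "indicator S x * f x = indicator S x *\<^sub>R (norm (v x))\<^sup>2" for x
    using S by (auto simp: f_def indicator_def)
  show "(L2_norm S v)\<^sup>2 = integral\<^sup>L lebesgue (\<lambda>x. indicator S x * f x)"
    unfolding L2_norm_power2 eq using S by (simp add: integral_restrict_space)
  show "integrable lebesgue (\<lambda>x. indicator S x * f x)"
    unfolding eq using L2_integrable_power2[OF L2_subset[OF v S mesh_sets]] S by (simp add: integrable_restrict_space)
qed

lemma sum_L2_norm_elements:
  assumes v: "v \<in> L2 \<Omega>"
  shows "(\<Sum>T\<in>\<T>. (L2_norm T v)\<^sup>2) = (L2_norm \<Omega> v)\<^sup>2"
proof -
  define f where "f x = indicator \<Omega> x *\<^sub>R (norm (v x))\<^sup>2" for x
  have i: "(L2_norm (interior T) v)\<^sup>2 = integral\<^sup>L lebesgue (\<lambda>x. indicator (interior T) x * f x)"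
    "integrable lebesgue (\<lambda>x. indicator (interior T) x * f x)" if "T \<in> \<T>" for T
    using L2_norm_power2_weighted[OF v interior_element_subset[OF that]] by (auto simp: f_def[abs_def] borel_open)
  have o: "(L2_norm \<Omega> v)\<^sup>2 = integral\<^sup>L lebesgue (\<lambda>x. indicator \<Omega> x * f x)" "integrable lebesgue (\<lambda>x. indicator \<Omega> x * f x)"
    using L2_norm_power2_weighted[OF v order_refl mesh_sets] by (auto simp: f_def[abs_def])
  have "(\<Sum>T\<in>\<T>. (L2_norm T v)\<^sup>2) = (\<Sum>T\<in>\<T>. integral\<^sup>L lebesgue (\<lambda>x. indicator (interior T) x * f x))"
    using L2_norm_element[OF _ v] i by simp
  also have "\<dots> = integral\<^sup>L lebesgue (\<lambda>x. \<Sum>T\<in>\<T>. indicator (interior T) x * f x)"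
    using i by (intro Bochner_Integration.integral_sum[symmetric]) auto
  also have "\<dots> = integral\<^sup>L lebesgue (\<lambda>x. indicator \<Omega> x * f x)"
  proof (rule integral_cong_AE)
    show "(\<lambda>x. \<Sum>T\<in>\<T>. indicator (interior T) x * f x) \<in> borel_measurable lebesgue"
      using i by (intro borel_measurable_integrable Bochner_Integration.integrable_sum) auto
    show "(\<lambda>x. indicator \<Omega> x * f x) \<in> borel_measurable lebesgue" using o by auto
    show "AE x in lebesgue. (\<Sum>T\<in>\<T>. indicator (interior T) x * f x) = indicator \<Omega> x * f x"
      using AE_interior_element
    proof eventually_elim
      case (elim x)
      show ?case
      proof (cases "x \<in> \<Omega>")
        case True
        then obtain T where T: "T \<in> \<T>" "x \<in> interior T" using elim by auto
        have "(\<Sum>K\<in>\<T>. indicator (interior K) x * f x) = (\<Sum>K\<in>\<T>. if K = T then f x else 0)"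
        proof (rule sum.cong)
          fix K assume K: "K \<in> \<T>"
          have "x \<in> interior K \<Longrightarrow> K = T"
            using interior_element_disjoint[OF T(1) K T(2)] interior_subset by blast
          then show "indicator (interior K) x * f x = (if K = T then f x else 0)"
            using T(2) by (cases "K = T") (auto simp: indicator_def)
        qed simp
        also have "\<dots> = f x" using T(1) finite_mesh by (simp add: sum.delta)
        finally show ?thesis using True by simp
      next
        case False
        then show ?thesis by (simp add: f_def)
      qed
    qed
  qed
  finally show ?thesis using o by simp
qed

text \<open>\<open>C_OL\<close> counts patches whose closure contains an element. A patch that
  contains an interior point of \<open>K\<close> has \<open>K\<close> among its elements, hence
  contains \<open>K\<close> in its closure.\<close>

lemma card_patches_le_C_OL:
  assumes K: "K \<in> \<T>" "x \<in> interior K"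
  shows "card {T \<in> \<T>. x \<in> patch \<T> T} \<le> C_OL \<T>"
proof -
  have "{T \<in> \<T>. x \<in> patch \<T> T} \<subseteq> {T \<in> \<T>. K \<subseteq> closure (patch \<T> T)}"
  proof safe
    fix T y assume T: "T \<in> \<T>" "x \<in> patch \<T> T" and y: "y \<in> K"
    from T(2) obtain K' where K': "K' \<in> \<T>" "K' \<inter> T \<noteq> {}" "x \<in> K'"
      unfolding patch_def using interior_subset by blast
    then have "K = K'" using interior_element_disjoint[OF K(1) K'(1) K(2) K'(3)] by simp
    then have "interior K \<subseteq> patch \<T> T" using K' T by (intro interior_element_patch) auto
    then have "closure (interior K) \<subseteq> closure (patch \<T> T)" by (rule closure_mono)
    then show "y \<in> closure (patch \<T> T)" using y closure_interior_element[OF K(1)] by auto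
  qed
  then have "card {T \<in> \<T>. x \<in> patch \<T> T} \<le> card {T \<in> \<T>. K \<subseteq> closure (patch \<T> T)}"
    using finite_mesh by (intro card_mono) auto
  also have "\<dots> \<le> C_OL \<T>"
    unfolding C_OL_def using finite_mesh K by (intro Max_ge) auto
  finally show ?thesis .
qed

text \<open>Almost every point lies in at most \<open>C_OL\<close> patches; this is where the root
  of \<open>C_OL\<close> in the final bound comes from.\<close>

lemma sum_L2_norm_patch:
  assumes v: "v \<in> L2 \<Omega>"
  shows "(\<Sum>T\<in>\<T>. (L2_norm (patch \<T> T) v)\<^sup>2) \<le> real (C_OL \<T>) * (L2_norm \<Omega> v)\<^sup>2"
proof -
  define f where "f x = indicator \<Omega> x *\<^sub>R (norm (v x))\<^sup>2" for x
  have i: "(L2_norm (patch \<T> T) v)\<^sup>2 = integral\<^sup>L lebesgue (\<lambda>x. indicator (patch \<T> T) x * f x)"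
    "integrable lebesgue (\<lambda>x. indicator (patch \<T> T) x * f x)" for T
    using L2_norm_power2_weighted[OF v patch_subset] by (auto simp: f_def[abs_def] borel_open patch_open)
  have o: "(L2_norm \<Omega> v)\<^sup>2 = integral\<^sup>L lebesgue (\<lambda>x. indicator \<Omega> x * f x)" "integrable lebesgue (\<lambda>x. indicator \<Omega> x * f x)"
    using L2_norm_power2_weighted[OF v order_refl mesh_sets] by (auto simp: f_def[abs_def])
  have "(\<Sum>T\<in>\<T>. (L2_norm (patch \<T> T) v)\<^sup>2) = integral\<^sup>L lebesgue (\<lambda>x. \<Sum>T\<in>\<T>. indicator (patch \<T> T) x * f x)"
    unfolding i using i by (intro Bochner_Integration.integral_sum[symmetric]) auto
  also have "\<dots> \<le> integral\<^sup>L lebesgue (\<lambda>x. real (C_OL \<T>) * (indicator \<Omega> x * f x))"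
  proof (rule integral_mono_AE)
    show "integrable lebesgue (\<lambda>x. \<Sum>T\<in>\<T>. indicator (patch \<T> T) x * f x)"
      using i by (intro Bochner_Integration.integrable_sum) auto
    show "integrable lebesgue (\<lambda>x. real (C_OL \<T>) * (indicator \<Omega> x * f x))" using o by simp
    show "AE x in lebesgue. (\<Sum>T\<in>\<T>. indicator (patch \<T> T) x * f x) \<le> real (C_OL \<T>) * (indicator \<Omega> x * f x)"
      using AE_interior_element
    proof eventually_elim
      case (elim x)
      show ?case
      proof (cases "x \<in> \<Omega>")
        case True
        then obtain K where K: "K \<in> \<T>" "x \<in> interior K" using elim by auto
        have "(\<Sum>T\<in>\<T>. indicator (patch \<T> T) x * f x) = real (card {T \<in> \<T>. x \<in> patch \<T> T}) * f x"
          using finite_mesh by (simp add: sum_distrib_right[symmetric] indicator_def sum.If_cases Int_def conj_commute)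
        also have "\<dots> \<le> real (C_OL \<T>) * f x"
          using card_patches_le_C_OL[OF K] by (intro mult_right_mono) (auto simp: f_def)
        finally show ?thesis using True by simp
      qed (simp add: f_def)
    qed
  qed
  finally show ?thesis using o by simp
qed

lemma diameter_le_h_max: "T \<in> \<T> \<Longrightarrow> diameter T \<le> h_max \<T>"
  unfolding h_max_def using finite_mesh by (intro Max_ge) auto

lemma diameter_nonneg: "T \<in> \<T> \<Longrightarrow> 0 \<le> diameter T"
  using compact_element compact_imp_bounded diameter_ge_0 by blast

lemma h_max_nonneg: "0 \<le> h_max \<T>"
  using mesh_not_empty diameter_le_h_max diameter_nonneg by (meson all_not_in_conv order_trans)

end

section \<open>Poincare inequalities\<close>

lemma test_scaleR_L2:
  fixes \<phi> :: "real^'n \<Rightarrow> real"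
  assumes \<phi>: "\<phi> \<in> test_functions S'" and S: "S \<in> lmeasurable" and w: "w \<in> L2 S"
  shows "(\<lambda>x. \<phi> x *\<^sub>R w x) \<in> L2 S" "integrable (lebesgue_on S) (\<lambda>x. \<phi> x *\<^sub>R w x)"
proof -
  obtain B where "\<And>x. \<bar>\<phi> x\<bar> \<le> B" using test_functions_bounded[OF \<phi>] by auto
  then show "(\<lambda>x. \<phi> x *\<^sub>R w x) \<in> L2 S"
    by (rule L2_bounded_mult[OF w L2_measurable[OF test_functions_L2[OF \<phi> S]]])
  then show "integrable (lebesgue_on S) (\<lambda>x. \<phi> x *\<^sub>R w x)" by (rule L2_integrable[OF S])
qed

lemma is_weak_pd_unique:
  assumes S: "open S" "S \<in> lmeasurable" and w: "w \<in> L2 S" "w' \<in> L2 S"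
    and pd: "is_weak_pd S i v w" "is_weak_pd S i v w'"
  shows "ae_eq S w w'"
proof -
  have d: "(\<lambda>x. w x - w' x) \<in> L2 S" using w by (rule L2_diff)
  have "ae_eq S (\<lambda>x. w x - w' x) (\<lambda>x. 0)"
  proof (rule fundamental_lemma[OF S(1) L2_integrable[OF S(2) d]])
    fix \<phi> :: "real^'a \<Rightarrow> real" assume \<phi>: "\<phi> \<in> test_functions S"
    show "integral\<^sup>L (lebesgue_on S) (\<lambda>x. \<phi> x *\<^sub>R (w x - w' x)) = 0"
      using pd \<phi> test_scaleR_L2(2)[OF \<phi> S(2) w(1)] test_scaleR_L2(2)[OF \<phi> S(2) w(2)]
      by (simp add: is_weak_pd_def scaleR_diff_right)
  qed
  then show ?thesis by (simp add: ae_eq_def)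
qed

lemma weak_pdD:
  assumes "v \<in> H1 S"
  shows "weak_pd S i v \<in> L2 S" "is_weak_pd S i v (weak_pd S i v)"
  using assms someI_ex[of "\<lambda>w. w \<in> L2 S \<and> is_weak_pd S i v w"]
  unfolding H1_def weak_pd_def by blast+

lemma H1_L2: "v \<in> H1 S \<Longrightarrow> v \<in> L2 S"
  by (simp add: H1_def)

lemma weak_pd_unique:
  assumes "open S" "S \<in> lmeasurable" "v \<in> H1 S" "w \<in> L2 S" "is_weak_pd S i v w"
  shows "ae_eq S (weak_pd S i v) w"
  by (rule is_weak_pd_unique[OF assms(1,2) weak_pdD(1)[OF assms(3)] assms(4) weak_pdD(2)[OF assms(3)] assms(5)])

lemma integral_test_mono:
  fixes \<phi> :: "real^'n \<Rightarrow> real" and w :: "real^'n \<Rightarrow> 'b::euclidean_space"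
  assumes "\<phi> \<in> test_functions S'" "S' \<subseteq> S" "S' \<in> sets lebesgue" "S \<in> sets lebesgue"
  shows "integral\<^sup>L (lebesgue_on S') (\<lambda>x. \<phi> x *\<^sub>R w x) = integral\<^sup>L (lebesgue_on S) (\<lambda>x. \<phi> x *\<^sub>R w x)"
proof -
  have eq: "indicator S' x *\<^sub>R \<phi> x *\<^sub>R w x = indicator S x *\<^sub>R \<phi> x *\<^sub>R w x" for x
    using test_functions_zero_outside[OF assms(1), of x] assms(2) by (cases "x \<in> S'") auto
  have "integral\<^sup>L (lebesgue_on S') (\<lambda>x. \<phi> x *\<^sub>R w x) = integral\<^sup>L lebesgue (\<lambda>x. indicator S' x *\<^sub>R \<phi> x *\<^sub>R w x)"
    using assms(3) by (simp add: integral_restrict_space del: scaleR_scaleR)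
  also have "\<dots> = integral\<^sup>L (lebesgue_on S) (\<lambda>x. \<phi> x *\<^sub>R w x)"
    unfolding eq using assms(4) by (simp add: integral_restrict_space del: scaleR_scaleR)
  finally show ?thesis .
qed

lemma is_weak_pd_mono:
  assumes "is_weak_pd S i v w" "S' \<subseteq> S" "S' \<in> sets lebesgue" "S \<in> sets lebesgue"
  shows "is_weak_pd S' i v w"
  unfolding is_weak_pd_def
proof (intro allI impI)
  fix \<phi> :: "real^'a \<Rightarrow> real" assume \<phi>: "\<phi> \<in> test_functions S'"
  show "integral\<^sup>L (lebesgue_on S') (\<lambda>x. pd i \<phi> x *\<^sub>R v x) = - integral\<^sup>L (lebesgue_on S') (\<lambda>x. \<phi> x *\<^sub>R w x)"
    using assms(1) test_functions_mono[OF assms(2) \<phi>]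
    unfolding integral_test_mono[OF \<phi> assms(2-4)] integral_test_mono[OF test_functions_pd[OF \<phi>] assms(2-4)]
    by (simp add: is_weak_pd_def)
qed

text \<open>The constant \<open>m\<close> drops out because derivatives of test functions have
  integral zero.\<close>

lemma is_weak_pd_component_shift:
  assumes S: "S \<in> lmeasurable" and v: "v \<in> L2 S" and w: "w \<in> L2 S" and pd: "is_weak_pd S i v w"
  shows "is_weak_pd S i (\<lambda>x. (v x - m) \<bullet> b) (\<lambda>x. w x \<bullet> b)"
  unfolding is_weak_pd_def
proof (intro allI impI)
  fix \<phi> :: "real^'a \<Rightarrow> real" assume \<phi>: "\<phi> \<in> test_functions S"
  note p = test_functions_pd[OF \<phi>, of i]
  have iv: "integrable (lebesgue_on S) (\<lambda>x. pd i \<phi> x *\<^sub>R v x)" and iw: "integrable (lebesgue_on S) (\<lambda>x. \<phi> x *\<^sub>R w x)"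
    and im: "integrable (lebesgue_on S) (\<lambda>x. pd i \<phi> x *\<^sub>R m)"
    by (rule test_scaleR_L2(2)[OF p S v] test_scaleR_L2(2)[OF \<phi> S w] test_scaleR_L2(2)[OF p S L2_const[OF S]])+
  have "integral\<^sup>L (lebesgue_on S) (\<lambda>x. pd i \<phi> x *\<^sub>R m) = 0"
    using integral_pd_eq_0[OF \<phi>, of i] S L2_integrable[OF S test_functions_L2[OF p S]]
    by (simp add: fmeasurableD)
  then have "integral\<^sup>L (lebesgue_on S) (\<lambda>x. pd i \<phi> x *\<^sub>R (v x - m)) = - integral\<^sup>L (lebesgue_on S) (\<lambda>x. \<phi> x *\<^sub>R w x)"
    using pd \<phi> iv im by (simp add: scaleR_diff_right is_weak_pd_def)
  moreover have "integrable (lebesgue_on S) (\<lambda>x. pd i \<phi> x *\<^sub>R (v x - m))"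
    using iv im by (simp add: scaleR_diff_right)
  ultimately have "integral\<^sup>L (lebesgue_on S) (\<lambda>x. (pd i \<phi> x *\<^sub>R (v x - m)) \<bullet> b) = - integral\<^sup>L (lebesgue_on S) (\<lambda>x. (\<phi> x *\<^sub>R w x) \<bullet> b)"
    using iw by (simp add: integral_inner_left[simplified] del: inner_scaleR_left)
  then show "integral\<^sup>L (lebesgue_on S) (\<lambda>x. pd i \<phi> x *\<^sub>R ((v x - m) \<bullet> b)) = - integral\<^sup>L (lebesgue_on S) (\<lambda>x. \<phi> x *\<^sub>R (w x \<bullet> b))"
    by simp
qed

text \<open>The patch constant is defined by scalar functions with mean zero on the patch. This
  makes the shifted components of a vector field on \<Omega> admissible there, with derivatives
  inherited from \<Omega>.\<close>

lemma H1_component_shift: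
  assumes Om: "\<Omega> \<in> sets lebesgue" and S: "open S" "S \<in> lmeasurable" "S \<subseteq> \<Omega>" and v: "v \<in> H1 \<Omega>"
  shows "(\<lambda>x. (v x - m) \<bullet> b) \<in> H1 S"
    and "ae_eq S (weak_pd S i (\<lambda>x. (v x - m) \<bullet> b)) (\<lambda>x. weak_pd \<Omega> i v x \<bullet> b)"
proof -
  have Ss: "S \<in> sets lebesgue" using S by auto
  have vL: "v \<in> L2 S" and wL: "weak_pd \<Omega> j v \<in> L2 S" for j
    using L2_subset[OF _ S(3) Ss Om] H1_L2[OF v] weak_pdD(1)[OF v] by auto
  have pd: "is_weak_pd S j (\<lambda>x. (v x - m) \<bullet> b) (\<lambda>x. weak_pd \<Omega> j v x \<bullet> b)" for j
    by (rule is_weak_pd_component_shift[OF S(2) vL wL is_weak_pd_mono[OF weak_pdD(2)[OF v] S(3) Ss Om]])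
  have "(\<lambda>x. (v x - m) \<bullet> b) \<in> L2 S" by (intro L2_component L2_diff vL L2_const S)
  then show h: "(\<lambda>x. (v x - m) \<bullet> b) \<in> H1 S"
    unfolding H1_def using pd L2_component[OF wL] by blast
  show "ae_eq S (weak_pd S i (\<lambda>x. (v x - m) \<bullet> b)) (\<lambda>x. weak_pd \<Omega> i v x \<bullet> b)"
    by (rule weak_pd_unique[OF S(1,2) h L2_component[OF wL] pd])
qed

lemma L2_norm_power2_Basis:
  assumes v: "v \<in> L2 S"
  shows "(L2_norm S v)\<^sup>2 = (\<Sum>b\<in>Basis. (L2_norm S (\<lambda>x. v x \<bullet> b))\<^sup>2)"
proof -
  have "(norm (v x))\<^sup>2 = (\<Sum>b\<in>Basis. (norm (v x \<bullet> b))\<^sup>2)" for x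
    unfolding power2_norm_eq_inner euclidean_inner[of "v x" "v x"] by (simp add: power2_eq_square)
  then show ?thesis
    unfolding L2_norm_power2 using L2_integrable_power2[OF L2_component[OF v]]
    by (simp add: Bochner_Integration.integral_sum)
qed

lemma L2_norm_constant:
  assumes "S \<in> lmeasurable"
  shows "L2_norm S (\<lambda>x. c) = norm c * sqrt (measure lebesgue S)"
proof -
  have "S \<in> sets lebesgue" using assms by auto
  then have "integral\<^sup>L (lebesgue_on S) (\<lambda>x. (norm c)\<^sup>2) = (norm c)\<^sup>2 * measure lebesgue S"
    by (simp add: measure_restrict_space)
  then show ?thesis by (simp add: L2_norm_def real_sqrt_mult)
qed

text \<open>The weak derivatives are those on \<open>\<Omega>\<close>; only the norm is restricted to \<open>S\<close>.\<close>

definition J_norm :: "(real^'n) set \<Rightarrow> (real^'n) set \<Rightarrow> (real^'n \<Rightarrow> 'b::euclidean_space) \<Rightarrow> real" where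
  "J_norm \<Omega> S v = sqrt (\<Sum>i\<in>UNIV. (L2_norm S (weak_pd \<Omega> i v))\<^sup>2)"

lemma J_norm_power2: "(J_norm \<Omega> S v)\<^sup>2 = (\<Sum>i\<in>UNIV. (L2_norm S (weak_pd \<Omega> i v))\<^sup>2)"
  by (simp add: J_norm_def sum_nonneg)

lemma J_norm_nonneg [simp]: "0 \<le> J_norm \<Omega> S v"
  by (simp add: J_norm_def sum_nonneg)

lemma D_norm_J_norm: "D_norm \<Omega> v = J_norm \<Omega> \<Omega> v"
  by (simp add: J_norm_def D_norm_def)

context mesh
begin

section \<open>Poincare inequalities on patches and on the whole domain\<close>

lemma J_norm_le:
  assumes "S \<subseteq> \<Omega>" "S \<in> sets lebesgue" "v \<in> H1 \<Omega>"
  shows "J_norm \<Omega> S v \<le> D_norm \<Omega> v"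
  unfolding D_norm_J_norm unfolding J_norm_def
  by (intro real_sqrt_le_mono sum_mono power_mono L2_norm_mono_set weak_pdD assms mesh_sets L2_norm_nonneg)

definition patch_mean :: "(real^'n) set \<Rightarrow> (real^'n \<Rightarrow> 'b::euclidean_space) \<Rightarrow> 'b" where
  "patch_mean T v = (1 / measure lebesgue (patch \<T> T)) *\<^sub>R integral\<^sup>L (lebesgue_on (patch \<T> T)) v"

lemma measure_patch_pos: "T \<in> \<T> \<Longrightarrow> measure lebesgue (patch \<T> T) > 0"
  using measure_interior_element_pos[of T] interior_element_lmeasurable[of T] patch_lmeasurable
    measure_mono_fmeasurable[OF interior_element_own_patch, of T lebesgue]
  by (metis fmeasurableD less_le_trans)

text \<open>The scalar inequality is squared and summed over components; the squares add up on both
  sides, so the vector-valued version keeps the same constant.\<close>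

lemma patch_Poincare:
  assumes ct: "patch_poincare_bound \<T> ct" and T: "T \<in> \<T>" and v: "v \<in> H1 \<Omega>"
  shows "L2_norm (patch \<T> T) (\<lambda>x. v x - patch_mean T v) \<le> diameter T * ct * J_norm \<Omega> (patch \<T> T) v"
proof -
  let ?S = "patch \<T> T" and ?m = "patch_mean T v"
  let ?v = "\<lambda>b x. (v x - ?m) \<bullet> b"
  have S: "open ?S" "?S \<in> lmeasurable" "?S \<subseteq> \<Omega>" by (rule patch_open patch_lmeasurable patch_subset)+
  then have Ss: "?S \<in> sets lebesgue" by auto
  have vL: "v \<in> L2 ?S" and wL: "weak_pd \<Omega> i v \<in> L2 ?S" for i
    using L2_subset[OF _ S(3) Ss mesh_sets] H1_L2[OF v] weak_pdD(1)[OF v] by auto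
  have iv: "integrable (lebesgue_on ?S) v" "integrable (lebesgue_on ?S) (\<lambda>x. ?m)"
    by (rule L2_integrable[OF S(2) vL] L2_integrable[OF S(2) L2_const[OF S(2)]])+
  have "integral\<^sup>L (lebesgue_on ?S) (\<lambda>x. v x - ?m) = integral\<^sup>L (lebesgue_on ?S) v - integral\<^sup>L (lebesgue_on ?S) (\<lambda>x. ?m)"
    by (rule Bochner_Integration.integral_diff[OF iv])
  also have "integral\<^sup>L (lebesgue_on ?S) (\<lambda>x. ?m) = measure lebesgue ?S *\<^sub>R ?m"
    using Ss by (simp add: measure_restrict_space)
  finally have mean0: "integral\<^sup>L (lebesgue_on ?S) (\<lambda>x. v x - ?m) = 0"
    using measure_patch_pos[OF T] by (simp add: patch_mean_def)
  have "integral\<^sup>L (lebesgue_on ?S) (?v b) = 0" for b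
    using integral_inner_left[of b "lebesgue_on ?S" "\<lambda>x. v x - ?m"] iv mean0 by simp
  then have le: "L2_norm ?S (?v b) \<le> diameter T * ct * D_norm ?S (?v b)" for b
    using ct T H1_component_shift(1)[OF mesh_sets S v] unfolding patch_poincare_bound_def by blast
  have D: "(D_norm ?S (?v b))\<^sup>2 = (\<Sum>i\<in>UNIV. (L2_norm ?S (\<lambda>x. weak_pd \<Omega> i v x \<bullet> b))\<^sup>2)" for b
  proof -
    have "L2_norm ?S (weak_pd ?S i (?v b)) = L2_norm ?S (\<lambda>x. weak_pd \<Omega> i v x \<bullet> b)" for i
      by (rule L2_norm_cong[OF H1_component_shift(2)[OF mesh_sets S v]
          weak_pdD(1)[OF H1_component_shift(1)[OF mesh_sets S v]] L2_component[OF wL]])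
    then show ?thesis by (simp add: D_norm_def sum_nonneg)
  qed
  have J: "(J_norm \<Omega> ?S v)\<^sup>2 = (\<Sum>b\<in>Basis. (D_norm ?S (?v b))\<^sup>2)"
    unfolding J_norm_power2 D L2_norm_power2_Basis[OF wL] by (rule sum.swap)
  have "(L2_norm ?S (\<lambda>x. v x - ?m))\<^sup>2 = (\<Sum>b\<in>Basis. (L2_norm ?S (?v b))\<^sup>2)"
    by (intro L2_norm_power2_Basis L2_diff vL L2_const S)
  also have "\<dots> \<le> (\<Sum>b\<in>Basis. (diameter T * ct * D_norm ?S (?v b))\<^sup>2)"
    by (intro sum_mono power_mono le L2_norm_nonneg)
  also have "\<dots> = (diameter T * ct * J_norm \<Omega> ?S v)\<^sup>2"
    unfolding power_mult_distrib J by (simp add: sum_distrib_left)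
  finally have sq: "(L2_norm ?S (\<lambda>x. v x - ?m))\<^sup>2 \<le> (diameter T * ct * J_norm \<Omega> ?S v)\<^sup>2" .
  \<comment> \<open>\<open>ct\<close> carries no sign assumption. If some component has a nonzero
    gradient, its own inequality forces \<open>diameter T * ct\<close> to be nonnegative.\<close>
  have "0 \<le> diameter T * ct * J_norm \<Omega> ?S v"
  proof (cases "J_norm \<Omega> ?S v = 0")
    case False
    then have "(\<Sum>b\<in>Basis. (D_norm ?S (?v b))\<^sup>2) \<noteq> 0" by (simp add: J[symmetric])
    then obtain b where "D_norm ?S (?v b) \<noteq> 0" by (metis (no_types, lifting) power_zero_numeral sum.neutral)
    then have "D_norm ?S (?v b) > 0" by (simp add: D_norm_def sum_nonneg less_le)
    then have "0 \<le> diameter T * ct"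
      using order_trans[OF L2_norm_nonneg le, of b] by (simp add: zero_le_mult_iff)
    then show ?thesis by simp
  qed simp
  then show ?thesis using sq by (rule power2_le_imp_le[rotated])
qed

text \<open>The elements reachable from \<open>T0\<close> and the remaining ones have disjoint
  closed unions that cover the connected closure of \<Omega>, so no element can remain.\<close>

lemma mesh_adjacency_connected:
  assumes "T0 \<in> \<T>" "T \<in> \<T>"
  shows "(T0, T) \<in> {(T, T'). T \<in> \<T> \<and> T' \<in> \<T> \<and> T \<inter> T' \<noteq> {}}\<^sup>*"
proof (rule ccontr)
  let ?R = "{(T, T'). T \<in> \<T> \<and> T' \<in> \<T> \<and> T \<inter> T' \<noteq> {}}"
  assume n: "(T0, T) \<notin> ?R\<^sup>*"
  define A where "A = {K \<in> \<T>. (T0, K) \<in> ?R\<^sup>*}"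
  have A: "A \<subseteq> \<T>" "T0 \<in> A" "T \<in> \<T> - A" using assms n by (auto simp: A_def)
  have cl: "closed (\<Union>B)" if "B \<subseteq> \<T>" for B
    using that finite_subset[OF that finite_mesh] compact_element
    by (intro closed_Union) (auto intro: compact_imp_closed)
  have dis: "\<Union>A \<inter> \<Union>(\<T> - A) = {}"
  proof (rule ccontr)
    assume "\<Union>A \<inter> \<Union>(\<T> - A) \<noteq> {}"
    then obtain K K' where K: "K \<in> A" "K' \<in> \<T> - A" "K \<inter> K' \<noteq> {}" by blast
    then have "(K, K') \<in> ?R" using A by auto
    then have "(T0, K') \<in> ?R\<^sup>*" using K(1) unfolding A_def by (blast intro: rtrancl_into_rtrancl)
    then show False using K(2) by (auto simp: A_def)
  qed
  have cov: "closure \<Omega> = \<Union>A \<union> \<Union>(\<T> - A)" using A(1) Union_mesh by blast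
  have "connected (closure \<Omega>)" using connected_mesh by (rule connected_imp_connected_closure)
  then have "\<Union>A \<inter> closure \<Omega> = {} \<or> \<Union>(\<T> - A) \<inter> closure \<Omega> = {}"
    using cl[OF A(1)] cl[of "\<T> - A"] dis cov by (intro connected_closedD) auto
  moreover have "\<Union>A \<inter> closure \<Omega> \<noteq> {}" "\<Union>(\<T> - A) \<inter> closure \<Omega> \<noteq> {}"
    using element_nonempty A cov by blast+
  ultimately show False by blast
qed

text \<open>Means over patches of touching elements differ by a multiple of
  \<open>D_norm \<Omega> v\<close>, and chains of touching elements join every element to a fixed
  \<open>T0\<close>; one constant, the mean around \<open>T0\<close>, therefore works everywhere.
  Only the existence of \<open>C\<close> matters, since it serves to make \<open>kappa_h\<close>
  finite.\<close>

lemma global_Poincare: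
  assumes ct: "patch_poincare_bound \<T> ct"
  shows "\<exists>C. \<forall>v::real^'n \<Rightarrow> 'b::euclidean_space. v \<in> H1 \<Omega> \<longrightarrow> (\<exists>c. L2_norm \<Omega> (\<lambda>x. v x - c) \<le> C * D_norm \<Omega> v)"
proof -
  define K where "K = h_max \<T> * \<bar>ct\<bar>"
  have patch: "L2_norm (interior T) (\<lambda>x. v x - patch_mean T' v) \<le> K * D_norm \<Omega> v"
    if T: "T \<in> \<T>" "T' \<in> \<T>" "T \<inter> T' \<noteq> {}" and v: "v \<in> H1 \<Omega>" for T T' and v :: "real^'n \<Rightarrow> 'b"
  proof -
    have ps: "patch \<T> T' \<in> sets lebesgue" "patch \<T> T' \<in> lmeasurable" using patch_lmeasurable by auto
    have vL: "v \<in> L2 (patch \<T> T')" using L2_subset[OF H1_L2[OF v] patch_subset ps(1) mesh_sets] .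
    have "L2_norm (interior T) (\<lambda>x. v x - patch_mean T' v) \<le> L2_norm (patch \<T> T') (\<lambda>x. v x - patch_mean T' v)"
      using T ps by (intro L2_norm_mono_set L2_diff vL L2_const interior_element_patch) (auto simp: borel_open)
    also have "\<dots> \<le> diameter T' * ct * J_norm \<Omega> (patch \<T> T') v" by (rule patch_Poincare[OF ct T(2) v])
    also have "\<dots> \<le> K * D_norm \<Omega> v"
    proof (intro mult_mono J_norm_le patch_subset ps v J_norm_nonneg)
      have "diameter T' * ct \<le> diameter T' * \<bar>ct\<bar>" using diameter_nonneg[OF T(2)] by (intro mult_left_mono) auto
      also have "\<dots> \<le> K" unfolding K_def by (intro mult_right_mono diameter_le_h_max T) simp
      finally show "diameter T' * ct \<le> K" .
      show "0 \<le> K" using h_max_nonneg by (simp add: K_def)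
    qed
    finally show ?thesis .
  qed
  have Dnn: "0 \<le> D_norm \<Omega> v" for v :: "real^'n \<Rightarrow> 'b" by (simp add: D_norm_J_norm)
  define \<mu> where "\<mu> T = sqrt (measure lebesgue (interior T))" for T :: "(real^'n) set"
  have \<mu>: "\<mu> T > 0" if "T \<in> \<T>" for T using measure_interior_element_pos[OF that] by (simp add: \<mu>_def)
  have vLi: "v \<in> L2 (interior T)" if "T \<in> \<T>" "v \<in> H1 \<Omega>" for T and v :: "real^'n \<Rightarrow> 'b"
    using L2_subset[OF H1_L2[OF that(2)] interior_element_subset[OF that(1)] _ mesh_sets] by (simp add: borel_open)
  have cL: "(\<lambda>x. c) \<in> L2 (interior T)" if "T \<in> \<T>" for T and c :: 'b
    by (rule L2_const[OF interior_element_lmeasurable[OF that]])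
  \<comment> \<open>The interior of \<open>T\<close> lies in both patches. There the difference of
    the two means is a constant function, whose norm is the Euclidean norm times
    \<open>\<mu> T\<close>.\<close>
  have adj: "norm (patch_mean T' v - patch_mean T v) \<le> 2 * K / \<mu> T * D_norm \<Omega> v"
    if T: "T \<in> \<T>" "T' \<in> \<T>" "T \<inter> T' \<noteq> {}" and v: "v \<in> H1 \<Omega>" for T T' and v :: "real^'n \<Rightarrow> 'b"
  proof -
    have TT: "T \<inter> T \<noteq> {}" using element_nonempty[OF T(1)] by simp
    have "norm (patch_mean T' v - patch_mean T v) * \<mu> T = L2_norm (interior T) (\<lambda>x. (v x - patch_mean T v) - (v x - patch_mean T' v))"
      by (simp add: \<mu>_def L2_norm_constant[OF interior_element_lmeasurable[OF T(1)]])
    also have "\<dots> \<le> K * D_norm \<Omega> v + K * D_norm \<Omega> v"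
      by (rule order_trans[OF L2_norm_triangle_diff add_mono[OF patch[OF T(1) T(1) TT v] patch[OF T v]]])
        (intro L2_diff vLi cL T v)+
    finally show ?thesis using \<mu>[OF T(1)] by (simp add: field_simps)
  qed
  obtain T0 where T0: "T0 \<in> \<T>" using mesh_not_empty by blast
  have "\<exists>C. \<forall>v::real^'n \<Rightarrow> 'b. v \<in> H1 \<Omega> \<longrightarrow> norm (patch_mean T v - patch_mean T0 v) \<le> C * D_norm \<Omega> v" if "T \<in> \<T>" for T
    using mesh_adjacency_connected[OF T0 that]
  proof (induction rule: rtrancl_induct)
    case base
    show ?case by (rule exI[of _ 0]) simp
  next
    case (step T T')
    then obtain C where C: "\<And>v::real^'n \<Rightarrow> 'b. v \<in> H1 \<Omega> \<Longrightarrow> norm (patch_mean T v - patch_mean T0 v) \<le> C * D_norm \<Omega> v" by blast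
    have "norm (patch_mean T' v - patch_mean T0 v) \<le> (2 * K / \<mu> T + C) * D_norm \<Omega> v" if "v \<in> H1 \<Omega>" for v :: "real^'n \<Rightarrow> 'b"
      using norm_triangle_ineq[of "patch_mean T' v - patch_mean T v" "patch_mean T v - patch_mean T0 v"]
        adj[of T T' v] C[of v] step(2) that by (simp add: algebra_simps)
    then show ?case by blast
  qed
  then obtain C where C: "\<And>T v. T \<in> \<T> \<Longrightarrow> (v::real^'n \<Rightarrow> 'b) \<in> H1 \<Omega> \<Longrightarrow> norm (patch_mean T v - patch_mean T0 v) \<le> C T * D_norm \<Omega> v"
    by metis
  define B where "B T = K + C T * \<mu> T" for T
  have "L2_norm \<Omega> (\<lambda>x. v x - patch_mean T0 v) \<le> sqrt (\<Sum>T\<in>\<T>. (B T)\<^sup>2) * D_norm \<Omega> v" if v: "v \<in> H1 \<Omega>" for v :: "real^'n \<Rightarrow> 'b"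
  proof (rule power2_le_imp_le)
    have vc: "(\<lambda>x. v x - patch_mean T0 v) \<in> L2 \<Omega>" by (intro L2_diff H1_L2[OF v] L2_const mesh_lmeasurable)
    have T: "L2_norm T (\<lambda>x. v x - patch_mean T0 v) \<le> B T * D_norm \<Omega> v" if T: "T \<in> \<T>" for T
    proof -
      have TT: "T \<inter> T \<noteq> {}" using element_nonempty[OF T] by simp
      have "L2_norm T (\<lambda>x. v x - patch_mean T0 v) = L2_norm (interior T) (\<lambda>x. (v x - patch_mean T v) + (patch_mean T v - patch_mean T0 v))"
        using L2_norm_element[OF T vc] by simp
      also have "\<dots> \<le> L2_norm (interior T) (\<lambda>x. v x - patch_mean T v) + L2_norm (interior T) (\<lambda>x. patch_mean T v - patch_mean T0 v)"
        by (intro L2_norm_triangle L2_diff vLi cL T v)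
      also have "\<dots> \<le> K * D_norm \<Omega> v + C T * D_norm \<Omega> v * \<mu> T"
        unfolding L2_norm_constant[OF interior_element_lmeasurable[OF T]] \<mu>_def[symmetric]
        using \<mu>[OF T] by (intro add_mono patch T TT v mult_right_mono C) auto
      finally show ?thesis by (simp add: B_def algebra_simps)
    qed
    have "(L2_norm \<Omega> (\<lambda>x. v x - patch_mean T0 v))\<^sup>2 = (\<Sum>T\<in>\<T>. (L2_norm T (\<lambda>x. v x - patch_mean T0 v))\<^sup>2)"
      by (rule sum_L2_norm_elements[OF vc, symmetric])
    also have "\<dots> \<le> (\<Sum>T\<in>\<T>. (B T * D_norm \<Omega> v)\<^sup>2)"
      by (intro sum_mono power_mono T L2_norm_nonneg)
    also have "\<dots> = (sqrt (\<Sum>T\<in>\<T>. (B T)\<^sup>2) * D_norm \<Omega> v)\<^sup>2"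
      by (simp add: power_mult_distrib sum_distrib_right[symmetric] sum_nonneg)
    finally show "(L2_norm \<Omega> (\<lambda>x. v x - patch_mean T0 v))\<^sup>2 \<le> (sqrt (\<Sum>T\<in>\<T>. (B T)\<^sup>2) * D_norm \<Omega> v)\<^sup>2" .
    show "0 \<le> sqrt (\<Sum>T\<in>\<T>. (B T)\<^sup>2) * D_norm \<Omega> v" using Dnn by (simp add: sum_nonneg)
  qed
  then show ?thesis by blast
qed

end

section \<open>Error estimate\<close>

lemma ae_eq_subset:
  assumes "ae_eq \<Omega> v w" "S \<subseteq> \<Omega>" "S \<in> sets lebesgue" "\<Omega> \<in> sets lebesgue"
  shows "ae_eq S v w"
proof -
  have "AE x in lebesgue. x \<in> \<Omega> \<longrightarrow> v x = w x"
    using assms(1,4) by (simp add: ae_eq_def AE_restrict_space_iff)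
  then have "AE x in lebesgue. x \<in> S \<longrightarrow> v x = w x"
    by eventually_elim (use assms(2) in auto)
  then show ?thesis using assms(3) by (simp add: ae_eq_def AE_restrict_space_iff)
qed

lemma ae_eq_lincomb:
  assumes "ae_eq S v v'" "ae_eq S w w'"
  shows "ae_eq S (\<lambda>x. r *\<^sub>R v x + s *\<^sub>R w x) (\<lambda>x. r *\<^sub>R v' x + s *\<^sub>R w' x)"
  using assms unfolding ae_eq_def by auto

locale maxwell_mesh = maxwell rot Curl H_Curl S_h \<Omega> + mesh \<Omega> \<T>
  for rot :: "(real^'n \<Rightarrow> real^'n) \<Rightarrow> real^'n \<Rightarrow> 'b::euclidean_space"
    and Curl :: "(real^'n \<Rightarrow> 'b) \<Rightarrow> real^'n \<Rightarrow> real^'n"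
    and H_Curl S_h \<Omega> \<T> +
  fixes \<pi>div \<pi>Curl C1div C2div C1Curl C2Curl C_RD ct
  assumes projections: "commuting_projections \<Omega> \<T> \<pi>div \<pi>Curl C1div C2div C1Curl C2Curl"
    and potential: "is_potential_constant \<Omega> C_RD"
    and patch_constant: "patch_poincare_bound \<T> ct"
begin

section \<open>Local bounds of the projections and signs of the constants\<close>

lemma div_projection: "linear_projection \<Omega> (H_div \<Omega>) (RT0 \<Omega> \<T>) \<pi>div"
  and Curl_projection: "linear_projection \<Omega> (H_Curl \<Omega>) (S_h \<Omega> \<T>) \<pi>Curl"
  and commuting: "v \<in> H_Curl \<Omega> \<Longrightarrow> ae_eq \<Omega> (\<pi>div (weak_Curl \<Omega> v)) (weak_Curl \<Omega> (\<pi>Curl v))"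
  and div_local_bound: "T \<in> \<T> \<Longrightarrow> w \<in> H_div \<Omega> \<Longrightarrow> L2_norm T (\<pi>div w) \<le>
      C1div * L2_norm (patch \<T> T) w + diameter T * C2div * L2_norm (patch \<T> T) (weak_div \<Omega> w)"
  and Curl_local_bound: "T \<in> \<T> \<Longrightarrow> v \<in> H_Curl \<Omega> \<Longrightarrow> L2_norm T (\<pi>Curl v) \<le>
      C1Curl * L2_norm (patch \<T> T) v + diameter T * C2Curl * L2_norm (patch \<T> T) (weak_Curl \<Omega> v)"
  using projections unfolding commuting_projections_def by blast+

lemma patch_sets: "patch \<T> T \<in> sets lebesgue"
  using patch_lmeasurable by auto

lemma L2_patch: "v \<in> L2 \<Omega> \<Longrightarrow> v \<in> L2 (patch \<T> T)"
  by (rule L2_subset[OF _ patch_subset patch_sets domain_sets])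

lemma L2_norm_patch_cong:
  assumes "ae_eq \<Omega> v w" "v \<in> L2 \<Omega>" "w \<in> L2 \<Omega>"
  shows "L2_norm (patch \<T> T) v = L2_norm (patch \<T> T) w"
  by (rule L2_norm_cong[OF ae_eq_subset[OF assms(1) patch_subset patch_sets domain_sets] L2_patch[OF assms(2)] L2_patch[OF assms(3)]])

lemma interior_element_sets: "interior T \<in> sets lebesgue"
  by (simp add: borel_open)

lemma L2_element: "T \<in> \<T> \<Longrightarrow> v \<in> L2 \<Omega> \<Longrightarrow> v \<in> L2 (interior T)"
  by (rule L2_subset[OF _ interior_element_subset interior_element_sets domain_sets])

lemma L2_norm_element_cong:
  assumes "T \<in> \<T>" "ae_eq \<Omega> v w" "v \<in> L2 \<Omega>" "w \<in> L2 \<Omega>"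
  shows "L2_norm T v = L2_norm T w"
  unfolding L2_norm_element[OF assms(1,3)] L2_norm_element[OF assms(1,4)]
  by (rule L2_norm_cong[OF ae_eq_subset[OF assms(2) interior_element_subset[OF assms(1)] interior_element_sets domain_sets]
        L2_element[OF assms(1,3)] L2_element[OF assms(1,4)]])

lemma L2_norm_element_le_patch:
  assumes "T \<in> \<T>" "v \<in> L2 \<Omega>"
  shows "L2_norm T v \<le> L2_norm (patch \<T> T) v"
  unfolding L2_norm_element[OF assms]
  by (rule L2_norm_mono_set[OF L2_patch[OF assms(2)] interior_element_own_patch[OF assms(1)] interior_element_sets patch_sets])

lemma L2_norm_patch_le: "v \<in> L2 \<Omega> \<Longrightarrow> L2_norm (patch \<T> T) v \<le> L2_norm \<Omega> v"
  by (rule L2_norm_mono_set[OF _ patch_subset patch_sets domain_sets])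

lemma L2_norm_element_triangle_diff:
  assumes "T \<in> \<T>" "v \<in> L2 \<Omega>" "w \<in> L2 \<Omega>"
  shows "L2_norm T (\<lambda>x. v x - w x) \<le> L2_norm T v + L2_norm T w"
  unfolding L2_norm_element[OF assms(1,2)] L2_norm_element[OF assms(1,3)] L2_norm_element[OF assms(1) L2_diff[OF assms(2,3)]]
  by (rule L2_norm_triangle_diff[OF L2_element[OF assms(1,2)] L2_element[OF assms(1,3)]])

lemma diameter_pos: "T \<in> \<T> \<Longrightarrow> 0 < diameter T"
proof -
  assume T: "T \<in> \<T>"
  obtain x where "x \<in> interior T" using interior_element_nonempty[OF T] by blast
  then obtain e where e: "e > 0" "cball x e \<subseteq> T" using mem_interior_cball by blast
  define y where "y = x + e *\<^sub>R axis undefined 1"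
  have d: "dist x y = e" using e by (simp add: y_def dist_norm)
  have "dist x y \<le> diameter T"
    using e d compact_imp_bounded[OF compact_element[OF T]] by (intro diameter_bounded_bound) auto
  then show ?thesis using d e by simp
qed

text \<open>Nonzero constants are the sample fields of the development: they force
  \<open>C1div\<close> to be nonnegative and make the index set of the supremum in
  \<open>kappa_h\<close> nonempty.\<close>

lemma const_H_div0: "(\<lambda>x. c) \<in> H_div0 \<Omega>"
proof -
  have "L2_inner \<Omega> (\<lambda>x. c) (grad \<phi>) = 0" if \<phi>: "\<phi> \<in> test_functions \<Omega>" for \<phi>
  proof -
    have i: "integrable (lebesgue_on \<Omega>) (pd i \<phi>)" for i
      by (rule L2_integrable[OF domain_lmeasurable test_L2[OF test_functions_pd[OF \<phi>]]])
    have "L2_inner \<Omega> (\<lambda>x. c) (grad \<phi>) = (\<Sum>i\<in>UNIV. c $ i * integral\<^sup>L (lebesgue_on \<Omega>) (pd i \<phi>))"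
      unfolding L2_inner_def inner_vec_def using i by (simp add: Bochner_Integration.integral_sum)
    then show ?thesis using integral_pd_eq_0[OF \<phi> domain_sets] by simp
  qed
  then show ?thesis using L2_const[OF domain_lmeasurable] by (simp add: H_div0_iff)
qed

lemma const_norm_pos:
  assumes "c \<noteq> 0" "T \<in> \<T>"
  shows "0 < L2_norm (patch \<T> T) (\<lambda>x. c)" "0 < L2_norm T (\<lambda>x. c)"
proof -
  show "0 < L2_norm T (\<lambda>x. c)"
    unfolding L2_norm_element[OF assms(2) L2_const[OF domain_lmeasurable]]
      L2_norm_constant[OF interior_element_lmeasurable[OF assms(2)]]
    using assms measure_interior_element_pos by simp
  then show "0 < L2_norm (patch \<T> T) (\<lambda>x. c)"
    using L2_norm_element_le_patch[OF assms(2) L2_const[OF domain_lmeasurable], of c] by linarith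
qed

text \<open>Removes the \<open>C2div\<close> term from the local bound on divergence-free
  fields.\<close>

lemma weak_div_H_div0:
  assumes "f \<in> H_div0 \<Omega>"
  shows "L2_norm (patch \<T> T) (weak_div \<Omega> f) = 0"
proof -
  have "\<exists>w. w \<in> L2 \<Omega> \<and> is_weak_div \<Omega> f w" using assms by (auto simp: H_div0_def H_div_def)
  then have w: "weak_div \<Omega> f \<in> L2 \<Omega>" "is_weak_div \<Omega> f (weak_div \<Omega> f)"
    using someI_ex[of "\<lambda>w. w \<in> L2 \<Omega> \<and> is_weak_div \<Omega> f w"] unfolding weak_div_def by auto
  have "ae_eq \<Omega> (weak_div \<Omega> f) (\<lambda>x. 0)"
    using w assms by (intro ae_eq_if_test_inner_eq open_domain domain_lmeasurable L2_zero)
      (auto simp: is_weak_div_def H_div0_iff)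
  then show ?thesis using L2_norm_patch_cong[OF _ w(1) L2_zero, of T] by (simp add: L2_norm_def)
qed

lemma H_div0_H_div: "f \<in> H_div0 \<Omega> \<Longrightarrow> f \<in> H_div \<Omega>"
  by (simp add: H_div0_def)

lemma H_div_L2: "f \<in> H_div \<Omega> \<Longrightarrow> f \<in> L2 \<Omega>"
  by (simp add: H_div_def)

lemma RT0_H_div: "f \<in> RT0 \<Omega> \<T> \<Longrightarrow> f \<in> H_div \<Omega>"
  by (simp add: RT0_def)

lemma div_projection_RT0: "f \<in> H_div \<Omega> \<Longrightarrow> \<pi>div f \<in> RT0 \<Omega> \<T>"
  using div_projection by (simp add: linear_projection_def)

lemma div_projection_L2: "f \<in> H_div \<Omega> \<Longrightarrow> \<pi>div f \<in> L2 \<Omega>"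
  using div_projection_RT0 RT0_H_div H_div_L2 by blast

lemma Curl_projection_S_h: "v \<in> H_Curl \<Omega> \<Longrightarrow> \<pi>Curl v \<in> S_h \<Omega> \<T>"
  using Curl_projection by (simp add: linear_projection_def)

lemma Curl_projection_H_Curl: "v \<in> H_Curl \<Omega> \<Longrightarrow> \<pi>Curl v \<in> H_Curl \<Omega>"
  using Curl_projection_S_h S_h_H_Curl by blast

lemma div_projection_element:
  assumes "T \<in> \<T>" "f \<in> H_div0 \<Omega>"
  shows "L2_norm T (\<pi>div f) \<le> C1div * L2_norm (patch \<T> T) f"
  using div_local_bound[OF assms(1) H_div0_H_div[OF assms(2)]] weak_div_H_div0[OF assms(2), of T] by simp

lemma C1div_nonneg: "0 \<le> C1div"
proof -
  obtain T where T: "T \<in> \<T>" using mesh_not_empty by blast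
  have "0 \<le> C1div * L2_norm (patch \<T> T) (\<lambda>x. axis undefined 1 :: real^'n)"
    by (rule order_trans[OF L2_norm_nonneg div_projection_element[OF T const_H_div0]])
  then show ?thesis using const_norm_pos(1)[OF _ T, of "axis undefined 1 :: real^'n"]
    by (simp add: zero_le_mult_iff axis_eq_0_iff)
qed

lemma div_projection_bound:
  assumes f: "f \<in> H_div0 \<Omega>"
  shows "L2_norm \<Omega> (\<pi>div f) \<le> C1div * sqrt (real (C_OL \<T>)) * L2_norm \<Omega> f"
proof (rule power2_le_imp_le)
  have fL: "f \<in> L2 \<Omega>" using f by (simp add: H_div0_iff)
  have "(L2_norm \<Omega> (\<pi>div f))\<^sup>2 = (\<Sum>T\<in>\<T>. (L2_norm T (\<pi>div f))\<^sup>2)"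
    by (rule sum_L2_norm_elements[OF div_projection_L2[OF H_div0_H_div[OF f]], symmetric])
  also have "\<dots> \<le> (\<Sum>T\<in>\<T>. (C1div * L2_norm (patch \<T> T) f)\<^sup>2)"
    by (intro sum_mono power_mono div_projection_element f L2_norm_nonneg)
  also have "\<dots> = C1div\<^sup>2 * (\<Sum>T\<in>\<T>. (L2_norm (patch \<T> T) f)\<^sup>2)"
    by (simp add: power_mult_distrib sum_distrib_left)
  also have "\<dots> \<le> C1div\<^sup>2 * (real (C_OL \<T>) * (L2_norm \<Omega> f)\<^sup>2)"
    by (intro mult_left_mono sum_L2_norm_patch fL) simp
  finally show "(L2_norm \<Omega> (\<pi>div f))\<^sup>2 \<le> (C1div * sqrt (real (C_OL \<T>)) * L2_norm \<Omega> f)\<^sup>2"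
    by (simp add: power_mult_distrib)
  show "0 \<le> C1div * sqrt (real (C_OL \<T>)) * L2_norm \<Omega> f" using C1div_nonneg by simp
qed

lemma is_weak_Curl_cong:
  assumes "is_weak_Curl \<Omega> \<phi> w" "ae_eq \<Omega> w w'" "w \<in> L2 \<Omega>" "w' \<in> L2 \<Omega>"
  shows "is_weak_Curl \<Omega> \<phi> w'"
  using assms L2_inner_cong[OF assms(2-4) test_L2] by (simp add: is_weak_Curl_def)

text \<open>The commuting property concerns the chosen representative of the weak Curl; the
  compatibility of \<open>\<pi>div\<close> with almost everywhere equality transfers it to the given
  \<open>f\<close>.\<close>

lemma Curl_projection_weak_Curl:
  assumes v: "v \<in> H_Curl \<Omega>" and f: "is_weak_Curl \<Omega> v f" "f \<in> H_div \<Omega>"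
  shows "is_weak_Curl \<Omega> (\<pi>Curl v) (\<pi>div f)"
proof -
  have e: "ae_eq \<Omega> (weak_Curl \<Omega> v) f" by (rule weak_Curl_unique[OF v f(1) H_div_L2[OF f(2)]])
  have w: "weak_Curl \<Omega> v \<in> H_div \<Omega>" using H_div0_H_div[OF weak_Curl_H_div0[OF v]] .
  have "ae_eq \<Omega> (\<pi>div (weak_Curl \<Omega> v)) (\<pi>div f)"
    using div_projection w f(2) e by (simp add: linear_projection_def)
  then have "ae_eq \<Omega> (weak_Curl \<Omega> (\<pi>Curl v)) (\<pi>div f)"
    by (rule ae_eq_trans[OF ae_eq_sym[OF commuting[OF v]]])
  then show ?thesis
    by (rule is_weak_Curl_cong[OF conjunct2[OF conjunct2[OF H_CurlD[OF Curl_projection_H_Curl[OF v]]]] _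
        conjunct1[OF conjunct2[OF H_CurlD[OF Curl_projection_H_Curl[OF v]]]] div_projection_L2[OF f(2)]])
qed

text \<open>A nonzero constant has vanishing weak Curl, so its local bound leaves only the
  \<open>C1Curl\<close> term.\<close>

lemma C1Curl_nonneg: "0 \<le> C1Curl"
proof -
  obtain T where T: "T \<in> \<T>" using mesh_not_empty by blast
  obtain c :: 'b where c: "c \<noteq> 0" using nonzero_Basis[of "SOME i. i \<in> (Basis::'b set)"] nonempty_Basis some_in_eq by metis
  have "L2_norm (patch \<T> T) (weak_Curl \<Omega> (\<lambda>x. c)) = 0"
    using L2_norm_patch_cong[OF weak_Curl_const _ L2_zero, of c T] H_CurlD[OF const_H_Curl, of c]
    by (simp add: L2_norm_def)
  then have "0 \<le> C1Curl * L2_norm (patch \<T> T) (\<lambda>x. c)"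
    using order_trans[OF L2_norm_nonneg Curl_local_bound[OF T const_H_Curl, of c]] by simp
  then show ?thesis using const_norm_pos(1)[OF c T] by (simp add: zero_le_mult_iff)
qed

text \<open>Constants lie in the discrete space, so subtracting the patch mean changes neither the
  projection error nor the Curl. Stability then applies to a field with mean zero, where the
  Poincare inequality gains the factor \<open>diameter T\<close>; the 1 in \<open>1 + C1Curl\<close>
  is the field itself.\<close>

lemma Curl_projection_element_error:
  assumes T: "T \<in> \<T>" and \<beta>: "\<beta> \<in> H1 \<Omega>" and f: "is_weak_Curl \<Omega> \<beta> f" "f \<in> L2 \<Omega>"
  shows "L2_norm T (\<lambda>x. \<beta> x - \<pi>Curl \<beta> x) \<le>
    diameter T * ((1 + C1Curl) * ct * J_norm \<Omega> (patch \<T> T) \<beta> + C2Curl * L2_norm (patch \<T> T) f)"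
proof -
  let ?c = "patch_mean T \<beta>"
  define \<beta>' where "\<beta>' x = 1 *\<^sub>R \<beta> x + (-1) *\<^sub>R ?c" for x
  have \<beta>'_alt: "\<beta>' = (\<lambda>x. \<beta> x - ?c)" by (simp add: \<beta>'_def fun_eq_iff)
  have h: "\<beta> \<in> H_Curl \<Omega>" "(\<lambda>x. ?c) \<in> H_Curl \<Omega>" using \<beta> H1_H_Curl const_H_Curl by auto
  have h': "\<beta>' \<in> H_Curl \<Omega>" unfolding \<beta>'_def[abs_def] by (rule H_Curl_lincomb[OF h])
  have L: "\<beta> \<in> L2 \<Omega>" "\<beta>' \<in> L2 \<Omega>" "\<pi>Curl \<beta> \<in> L2 \<Omega>" "\<pi>Curl \<beta>' \<in> L2 \<Omega>"
    using H_CurlD h(1) h' Curl_projection_H_Curl by auto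
  have "\<forall>r s. ae_eq \<Omega> (\<pi>Curl (\<lambda>x. r *\<^sub>R \<beta> x + s *\<^sub>R ?c)) (\<lambda>x. r *\<^sub>R \<pi>Curl \<beta> x + s *\<^sub>R \<pi>Curl (\<lambda>x. ?c) x)"
    using Curl_projection h unfolding linear_projection_def by simp
  then have "ae_eq \<Omega> (\<pi>Curl \<beta>') (\<lambda>x. 1 *\<^sub>R \<pi>Curl \<beta> x + (-1) *\<^sub>R \<pi>Curl (\<lambda>x. ?c) x)"
    unfolding \<beta>'_def[abs_def] by blast
  moreover have "ae_eq \<Omega> (\<lambda>x. 1 *\<^sub>R \<pi>Curl \<beta> x + (-1) *\<^sub>R \<pi>Curl (\<lambda>x. ?c) x) (\<lambda>x. 1 *\<^sub>R \<pi>Curl \<beta> x + (-1) *\<^sub>R ?c)"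
    using Curl_projection const_S_h by (intro ae_eq_lincomb) (auto simp: linear_projection_def)
  ultimately have "ae_eq \<Omega> (\<pi>Curl \<beta>') (\<lambda>x. \<pi>Curl \<beta> x - ?c)"
    using ae_eq_trans by fastforce
  then have e: "ae_eq \<Omega> (\<lambda>x. \<beta> x - \<pi>Curl \<beta> x) (\<lambda>x. \<beta>' x - \<pi>Curl \<beta>' x)"
    unfolding ae_eq_def \<beta>'_alt by auto
  have "ae_eq \<Omega> (weak_Curl \<Omega> \<beta>') f"
  proof -
    have "ae_eq \<Omega> (weak_Curl \<Omega> \<beta>') (\<lambda>x. 1 *\<^sub>R weak_Curl \<Omega> \<beta> x + (-1) *\<^sub>R weak_Curl \<Omega> (\<lambda>x. ?c) x)"
      unfolding \<beta>'_def[abs_def] by (rule weak_Curl_lincomb[OF h])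
    then have "ae_eq \<Omega> (weak_Curl \<Omega> \<beta>') (\<lambda>x. 1 *\<^sub>R f x + (-1) *\<^sub>R 0)"
      by (rule ae_eq_trans[OF _ ae_eq_lincomb[OF weak_Curl_unique[OF h(1) f] weak_Curl_const]])
    then show ?thesis by simp
  qed
  then have n: "L2_norm (patch \<T> T) (weak_Curl \<Omega> \<beta>') = L2_norm (patch \<T> T) f"
    using H_CurlD[OF h'] f(2) by (intro L2_norm_patch_cong) auto
  have "L2_norm T (\<lambda>x. \<beta> x - \<pi>Curl \<beta> x) = L2_norm T (\<lambda>x. \<beta>' x - \<pi>Curl \<beta>' x)"
    by (intro L2_norm_element_cong[OF T e] L2_diff L)
  also have "\<dots> \<le> L2_norm T \<beta>' + L2_norm T (\<pi>Curl \<beta>')"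
    by (rule L2_norm_element_triangle_diff[OF T L(2,4)])
  also have "\<dots> \<le> L2_norm (patch \<T> T) \<beta>' + (C1Curl * L2_norm (patch \<T> T) \<beta>' + diameter T * C2Curl * L2_norm (patch \<T> T) f)"
    using Curl_local_bound[OF T h'] L2_norm_element_le_patch[OF T L(2)] n by simp
  also have "\<dots> = (1 + C1Curl) * L2_norm (patch \<T> T) \<beta>' + diameter T * C2Curl * L2_norm (patch \<T> T) f"
    by (simp add: algebra_simps)
  also have "\<dots> \<le> (1 + C1Curl) * (diameter T * ct * J_norm \<Omega> (patch \<T> T) \<beta>) + diameter T * C2Curl * L2_norm (patch \<T> T) f"
    unfolding \<beta>'_alt using C1Curl_nonneg
    by (intro add_right_mono mult_left_mono patch_Poincare[OF patch_constant T \<beta>]) simp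
  finally show ?thesis by (simp add: algebra_simps)
qed

lemma sum_J_norm_patch:
  assumes "\<beta> \<in> H1 \<Omega>"
  shows "(\<Sum>T\<in>\<T>. (J_norm \<Omega> (patch \<T> T) \<beta>)\<^sup>2) \<le> real (C_OL \<T>) * (D_norm \<Omega> \<beta>)\<^sup>2"
proof -
  have "(\<Sum>T\<in>\<T>. (J_norm \<Omega> (patch \<T> T) \<beta>)\<^sup>2) = (\<Sum>i\<in>UNIV. \<Sum>T\<in>\<T>. (L2_norm (patch \<T> T) (weak_pd \<Omega> i \<beta>))\<^sup>2)"
    unfolding J_norm_power2 by (rule sum.swap)
  also have "\<dots> \<le> (\<Sum>i\<in>UNIV. real (C_OL \<T>) * (L2_norm \<Omega> (weak_pd \<Omega> i \<beta>))\<^sup>2)"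
    by (intro sum_mono sum_L2_norm_patch weak_pdD assms)
  also have "\<dots> = real (C_OL \<T>) * (D_norm \<Omega> \<beta>)\<^sup>2"
    by (simp add: D_norm_J_norm J_norm_power2 sum_distrib_left)
  finally show ?thesis .
qed

text \<open>The Jacobian of the potential is bounded by \<open>C_RD\<close> only on all of \<Omega>,
  so the two local terms must be summed over the mesh separately. Splitting the square of their sum
  costs the factor 2.\<close>

lemma Curl_projection_error_general:
  assumes \<beta>: "\<beta> \<in> H1 \<Omega>" and f: "is_weak_Curl \<Omega> \<beta> f" "f \<in> L2 \<Omega>" and D: "D_norm \<Omega> \<beta> \<le> C_RD * L2_norm \<Omega> f"
  shows "L2_norm \<Omega> (\<lambda>x. \<beta> x - \<pi>Curl \<beta> x) \<le>
    h_max \<T> * sqrt (2 * (((1 + C1Curl) * ct * C_RD)\<^sup>2 + C2Curl\<^sup>2)) * sqrt (real (C_OL \<T>)) * L2_norm \<Omega> f"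
proof (rule power2_le_imp_le)
  define A where "A = (1 + C1Curl) * ct"
  have h: "\<beta> \<in> H_Curl \<Omega>" using \<beta> H1_H_Curl by blast
  have eL: "(\<lambda>x. \<beta> x - \<pi>Curl \<beta> x) \<in> L2 \<Omega>"
    using H_CurlD[OF h] H_CurlD[OF Curl_projection_H_Curl[OF h]] by (intro L2_diff) auto
  have T: "(L2_norm T (\<lambda>x. \<beta> x - \<pi>Curl \<beta> x))\<^sup>2 \<le>
      (h_max \<T>)\<^sup>2 * 2 * (A\<^sup>2 * (J_norm \<Omega> (patch \<T> T) \<beta>)\<^sup>2 + C2Curl\<^sup>2 * (L2_norm (patch \<T> T) f)\<^sup>2)"
    if T: "T \<in> \<T>" for T
  proof -
    let ?s = "A * J_norm \<Omega> (patch \<T> T) \<beta>" and ?t = "C2Curl * L2_norm (patch \<T> T) f"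
    have "(L2_norm T (\<lambda>x. \<beta> x - \<pi>Curl \<beta> x))\<^sup>2 \<le> (diameter T * (?s + ?t))\<^sup>2"
      unfolding A_def by (intro power_mono Curl_projection_element_error T \<beta> f L2_norm_nonneg)
    also have "\<dots> = (diameter T)\<^sup>2 * (?s + ?t)\<^sup>2" by (simp add: power_mult_distrib)
    also have "\<dots> \<le> (h_max \<T>)\<^sup>2 * (2 * (?s\<^sup>2 + ?t\<^sup>2))"
    proof (intro mult_mono power_mono diameter_le_h_max diameter_nonneg T)
      show "(?s + ?t)\<^sup>2 \<le> 2 * (?s\<^sup>2 + ?t\<^sup>2)"
        using zero_le_power2[of "?s - ?t"] by (simp add: power2_sum power2_diff)
    qed auto
    finally show ?thesis by (simp add: power_mult_distrib algebra_simps)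
  qed
  have D2: "(D_norm \<Omega> \<beta>)\<^sup>2 \<le> C_RD\<^sup>2 * (L2_norm \<Omega> f)\<^sup>2"
    using power_mono[OF D, of 2] by (simp add: D_norm_J_norm power_mult_distrib)
  have "(L2_norm \<Omega> (\<lambda>x. \<beta> x - \<pi>Curl \<beta> x))\<^sup>2 = (\<Sum>T\<in>\<T>. (L2_norm T (\<lambda>x. \<beta> x - \<pi>Curl \<beta> x))\<^sup>2)"
    by (rule sum_L2_norm_elements[OF eL, symmetric])
  also have "\<dots> \<le> (\<Sum>T\<in>\<T>. (h_max \<T>)\<^sup>2 * 2 * (A\<^sup>2 * (J_norm \<Omega> (patch \<T> T) \<beta>)\<^sup>2 + C2Curl\<^sup>2 * (L2_norm (patch \<T> T) f)\<^sup>2))"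
    by (intro sum_mono T)
  also have "\<dots> = (h_max \<T>)\<^sup>2 * 2 * (A\<^sup>2 * (\<Sum>T\<in>\<T>. (J_norm \<Omega> (patch \<T> T) \<beta>)\<^sup>2) + C2Curl\<^sup>2 * (\<Sum>T\<in>\<T>. (L2_norm (patch \<T> T) f)\<^sup>2))"
    by (simp only: sum_distrib_left[symmetric] sum.distrib)
  also have "\<dots> \<le> (h_max \<T>)\<^sup>2 * 2 * (A\<^sup>2 * (real (C_OL \<T>) * (C_RD\<^sup>2 * (L2_norm \<Omega> f)\<^sup>2)) + C2Curl\<^sup>2 * (real (C_OL \<T>) * (L2_norm \<Omega> f)\<^sup>2))"
    by (intro mult_left_mono add_mono sum_L2_norm_patch f order_trans[OF sum_J_norm_patch[OF \<beta>]] D2) auto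
  also have "\<dots> = (h_max \<T> * sqrt (2 * (((1 + C1Curl) * ct * C_RD)\<^sup>2 + C2Curl\<^sup>2)) * sqrt (real (C_OL \<T>)) * L2_norm \<Omega> f)\<^sup>2"
    unfolding A_def by (simp add: power_mult_distrib) (simp add: algebra_simps)
  finally show "(L2_norm \<Omega> (\<lambda>x. \<beta> x - \<pi>Curl \<beta> x))\<^sup>2 \<le>
    (h_max \<T> * sqrt (2 * (((1 + C1Curl) * ct * C_RD)\<^sup>2 + C2Curl\<^sup>2)) * sqrt (real (C_OL \<T>)) * L2_norm \<Omega> f)\<^sup>2" .
  show "0 \<le> h_max \<T> * sqrt (2 * (((1 + C1Curl) * ct * C_RD)\<^sup>2 + C2Curl\<^sup>2)) * sqrt (real (C_OL \<T>)) * L2_norm \<Omega> f"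
    using h_max_nonneg by simp
qed

text \<open>Here both local terms are multiples of the same patch norm of \<open>f\<close>, so they
  combine before squaring and the factor 2 of the general estimate disappears.\<close>

lemma Curl_projection_error_isometric:
  assumes \<beta>: "\<beta> \<in> H1 \<Omega>" and f: "is_weak_Curl \<Omega> \<beta> f" "f \<in> L2 \<Omega>"
    and J: "\<And>T. T \<in> \<T> \<Longrightarrow> J_norm \<Omega> (patch \<T> T) \<beta> = L2_norm (patch \<T> T) f"
  shows "L2_norm \<Omega> (\<lambda>x. \<beta> x - \<pi>Curl \<beta> x) \<le>
    h_max \<T> * ((1 + C1Curl) * ct + C2Curl) * sqrt (real (C_OL \<T>)) * L2_norm \<Omega> f"
proof -
  define C where "C = (1 + C1Curl) * ct + C2Curl"
  have h: "\<beta> \<in> H_Curl \<Omega>" using \<beta> H1_H_Curl by blast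
  have eL: "(\<lambda>x. \<beta> x - \<pi>Curl \<beta> x) \<in> L2 \<Omega>"
    using H_CurlD[OF h] H_CurlD[OF Curl_projection_H_Curl[OF h]] by (intro L2_diff) auto
  have T: "L2_norm T (\<lambda>x. \<beta> x - \<pi>Curl \<beta> x) \<le> diameter T * C * L2_norm (patch \<T> T) f" if "T \<in> \<T>" for T
    using Curl_projection_element_error[OF that \<beta> f] J[OF that] by (simp add: C_def algebra_simps)
  have "(L2_norm \<Omega> (\<lambda>x. \<beta> x - \<pi>Curl \<beta> x))\<^sup>2 = (\<Sum>T\<in>\<T>. (L2_norm T (\<lambda>x. \<beta> x - \<pi>Curl \<beta> x))\<^sup>2)"
    by (rule sum_L2_norm_elements[OF eL, symmetric])
  also have "\<dots> \<le> (\<Sum>T\<in>\<T>. (h_max \<T>)\<^sup>2 * C\<^sup>2 * (L2_norm (patch \<T> T) f)\<^sup>2)"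
  proof (rule sum_mono)
    fix T assume TT: "T \<in> \<T>"
    have "(L2_norm T (\<lambda>x. \<beta> x - \<pi>Curl \<beta> x))\<^sup>2 \<le> (diameter T * C * L2_norm (patch \<T> T) f)\<^sup>2"
      by (intro power_mono T TT L2_norm_nonneg)
    also have "\<dots> = (diameter T)\<^sup>2 * C\<^sup>2 * (L2_norm (patch \<T> T) f)\<^sup>2" by (simp add: power_mult_distrib)
    also have "\<dots> \<le> (h_max \<T>)\<^sup>2 * C\<^sup>2 * (L2_norm (patch \<T> T) f)\<^sup>2"
      by (intro mult_right_mono power_mono diameter_le_h_max diameter_nonneg TT) auto
    finally show "(L2_norm T (\<lambda>x. \<beta> x - \<pi>Curl \<beta> x))\<^sup>2 \<le> (h_max \<T>)\<^sup>2 * C\<^sup>2 * (L2_norm (patch \<T> T) f)\<^sup>2" .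
  qed
  also have "\<dots> \<le> (h_max \<T>)\<^sup>2 * C\<^sup>2 * (real (C_OL \<T>) * (L2_norm \<Omega> f)\<^sup>2)"
    unfolding sum_distrib_left[symmetric] by (intro mult_left_mono sum_L2_norm_patch f) auto
  also have "\<dots> = (h_max \<T> * \<bar>C\<bar> * sqrt (real (C_OL \<T>)) * L2_norm \<Omega> f)\<^sup>2"
    by (simp add: power_mult_distrib)
  finally have sq: "(L2_norm \<Omega> (\<lambda>x. \<beta> x - \<pi>Curl \<beta> x))\<^sup>2 \<le> (h_max \<T> * \<bar>C\<bar> * sqrt (real (C_OL \<T>)) * L2_norm \<Omega> f)\<^sup>2" .
  have le: "L2_norm \<Omega> (\<lambda>x. \<beta> x - \<pi>Curl \<beta> x) \<le> h_max \<T> * \<bar>C\<bar> * sqrt (real (C_OL \<T>)) * L2_norm \<Omega> f"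
    using h_max_nonneg by (intro power2_le_imp_le[OF sq]) simp
  show ?thesis
  proof (cases "C \<ge> 0")
    case True
    then show ?thesis using le by (simp add: C_def)
  next
    \<comment> \<open>A negative combined constant contradicts the local bound unless
      \<open>f\<close> vanishes on every patch, and then both sides are 0.\<close>
    case False
    have "L2_norm T f = 0" if TT: "T \<in> \<T>" for T
    proof -
      have "0 \<le> (diameter T * C) * L2_norm (patch \<T> T) f" using order_trans[OF L2_norm_nonneg T[OF TT]] .
      moreover have "diameter T * C < 0" using diameter_pos[OF TT] False by (simp add: mult_pos_neg)
      ultimately have "L2_norm (patch \<T> T) f \<le> 0" by (smt (verit) mult_neg_pos)
      then show ?thesis using L2_norm_element_le_patch[OF TT f(2)] L2_norm_nonneg[of T f] by linarith
    qed
    then have "L2_norm \<Omega> f = 0" using sum_L2_norm_elements[OF f(2)] by simp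
    then show ?thesis using le by simp
  qed
qed

section \<open>Finiteness of \<open>kappa_h\<close> and nearly optimal discrete functions\<close>

lemma zero_N0: "(\<lambda>x. 0) \<in> N0 \<Omega> \<T>"
  unfolding N0_def H_rot_def
proof (intro CollectI conjI ballI bexI[of _ "\<lambda>x. 0"] L2_zero)
  show "is_weak_rot \<Omega> (\<lambda>x. 0) (\<lambda>x. 0)" by (simp add: is_weak_rot_def)
  fix T
  show "\<exists>\<alpha> \<beta>. (\<exists>A b. \<forall>x. \<beta> x = A *v x + b) \<and> (\<forall>x\<in>T. \<beta> x \<bullet> x = 0) \<and> (AE x in lebesgue_on T. 0 = \<alpha> + \<beta> x)"
    by (intro exI[of _ 0] exI[of _ "\<lambda>x. 0"] conjI) auto
qed

lemma zero_V_h: "(\<lambda>x. 0) \<in> V_h \<Omega> \<T>"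
  using zero_N0 test_H0_rot(1)[OF test_functions_zero] by (simp add: V_h_def N0_D_def)

lemma weak_rot_zero: "ae_eq \<Omega> (weak_rot \<Omega> (\<lambda>x. 0)) (\<lambda>x. 0)"
  using test_H0_rot(1)[OF test_functions_zero]
  by (intro weak_rot_unique) (auto simp: H0_rot_iff is_weak_rot_def)

lemma L2_norm_diff_weak_rot_zero:
  assumes "\<tau> \<in> L2 \<Omega>"
  shows "L2_norm \<Omega> (\<lambda>x. \<tau> x - weak_rot \<Omega> (\<lambda>x. 0) x) = L2_norm \<Omega> \<tau>"
proof -
  have z: "(\<lambda>x. 0) \<in> H_rot \<Omega>" using test_H0_rot(1)[OF test_functions_zero] by (simp add: H0_rot_iff)
  have "ae_eq \<Omega> (\<lambda>x. \<tau> x - weak_rot \<Omega> (\<lambda>x. 0) x) \<tau>" using weak_rot_zero unfolding ae_eq_def by auto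
  then show ?thesis using assms H_rotD[OF z] by (intro L2_norm_cong L2_diff) auto
qed

lemma scaleR_H_div0: "f \<in> H_div0 \<Omega> \<Longrightarrow> (\<lambda>x. r *\<^sub>R f x) \<in> H_div0 \<Omega>"
  by (simp add: H_div0_iff L2_scaleR L2_inner_scaleR_left)

lemma scaleR_RT0:
  assumes "f \<in> RT0 \<Omega> \<T>"
  shows "(\<lambda>x. r *\<^sub>R f x) \<in> RT0 \<Omega> \<T>"
  unfolding RT0_def
proof (intro CollectI conjI ballI)
  show "(\<lambda>x. r *\<^sub>R f x) \<in> H_div \<Omega>"
  proof -
    obtain w where "f \<in> L2 \<Omega>" "w \<in> L2 \<Omega>" "is_weak_div \<Omega> f w"
      using RT0_H_div[OF assms] by (auto simp: H_div_def)
    then have "(\<lambda>x. r *\<^sub>R f x) \<in> L2 \<Omega>" "(\<lambda>x. r *\<^sub>R w x) \<in> L2 \<Omega>" "is_weak_div \<Omega> (\<lambda>x. r *\<^sub>R f x) (\<lambda>x. r *\<^sub>R w x)"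
      by (simp_all add: L2_scaleR L2_scaleR[of w, simplified] is_weak_div_def L2_inner_scaleR_left L2_inner_scaleR_left[where 'b=real, simplified])
    then show ?thesis unfolding H_div_def by blast
  qed
  fix T assume "T \<in> \<T>"
  then obtain \<alpha> \<beta> where "AE x in lebesgue_on T. f x = \<alpha> + \<beta> *\<^sub>R x" using assms by (auto simp: RT0_def)
  then have "AE x in lebesgue_on T. r *\<^sub>R f x = r *\<^sub>R \<alpha> + (r * \<beta>) *\<^sub>R x"
    by eventually_elim (simp add: scaleR_add_right)
  then show "\<exists>\<alpha> \<beta>. AE x in lebesgue_on T. r *\<^sub>R f x = \<alpha> + \<beta> *\<^sub>R x" by blast
qed

lemma abs_sgn_d: "\<bar>sgn_d\<bar> = 1"
  by (simp add: sgn_d_def power_abs)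

text \<open>Makes the supremum in the definition of \<open>\<kappa>\<^sub>h\<close> meaningful.\<close>

lemma discrete_potential_bound:
  "\<exists>C. \<forall>f\<in>X_h \<Omega> \<T>. \<exists>\<tau>\<in>S_f \<Omega> \<T> f. L2_norm \<Omega> \<tau> \<le> C * L2_norm \<Omega> f"
proof -
  obtain C where C: "\<And>v::real^'n \<Rightarrow> 'b. v \<in> H1 \<Omega> \<Longrightarrow> \<exists>c. L2_norm \<Omega> (\<lambda>x. v x - c) \<le> C * D_norm \<Omega> v"
    using global_Poincare[OF patch_constant] by metis
  \<comment> \<open>The two terms of the local bound for \<open>\<pi>Curl\<close>: the global
    Poincare and potential constants enter the first, the mesh size the second. Absolute values
    stand in for unknown signs.\<close>
  define B where "B = C1Curl * \<bar>C\<bar> * C_RD + h_max \<T> * \<bar>C2Curl\<bar>"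
  have "\<exists>\<tau>\<in>S_f \<Omega> \<T> f. L2_norm \<Omega> \<tau> \<le> sqrt (real (card \<T>)) * \<bar>B\<bar> * L2_norm \<Omega> f" if f: "f \<in> X_h \<Omega> \<T>" for f
  proof -
    \<comment> \<open>Members of \<open>S_f\<close> have Curl equal to \<open>sgn_d\<close> times
      \<open>f\<close>, so the potential is taken for the signed field.\<close>
    let ?f = "\<lambda>x. sgn_d *\<^sub>R f x"
    have f0: "f \<in> H_div0 \<Omega>" "f \<in> RT0 \<Omega> \<T>" using f by (auto simp: X_h_def)
    then have sf: "?f \<in> H_div0 \<Omega>" "?f \<in> RT0 \<Omega> \<T>" by (auto intro: scaleR_H_div0 scaleR_RT0)
    have fL: "f \<in> L2 \<Omega>" "?f \<in> L2 \<Omega>" using f0 sf by (auto simp: H_div0_iff)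
    have nf: "L2_norm S ?f = L2_norm S f" for S by (simp add: L2_norm_scaleR abs_sgn_d)
    obtain \<beta> where \<beta>: "\<beta> \<in> H1 \<Omega>" "is_weak_Curl \<Omega> \<beta> ?f" "D_norm \<Omega> \<beta> \<le> C_RD * L2_norm \<Omega> f"
      using bspec[OF potential[unfolded is_potential_constant_def] sf(1)] unfolding nf by blast
    obtain c where c: "L2_norm \<Omega> (\<lambda>x. \<beta> x - c) \<le> C * D_norm \<Omega> \<beta>" using C[OF \<beta>(1)] by blast
    \<comment> \<open>The local bound involves the potential itself and not only its derivatives;
      subtracting \<open>c\<close> brings it under the control of the global Poincare
      inequality.\<close>
    define \<beta>' where "\<beta>' x = 1 *\<^sub>R \<beta> x + (-1) *\<^sub>R c" for x
    have h: "\<beta> \<in> H_Curl \<Omega>" using \<beta>(1) H1_H_Curl by blast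
    have h': "\<beta>' \<in> H_Curl \<Omega>" unfolding \<beta>'_def[abs_def] by (rule H_Curl_lincomb[OF h const_H_Curl])
    have "is_weak_Curl \<Omega> (\<lambda>x. c) (\<lambda>x. 0)" by (simp add: is_weak_Curl_def integral_rot)
    then have "is_weak_Curl \<Omega> \<beta>' (\<lambda>x. 1 *\<^sub>R ?f x + (-1) *\<^sub>R 0)"
      unfolding \<beta>'_def[abs_def] using H_CurlD[OF h] fL L2_const[OF domain_lmeasurable]
      by (intro is_weak_Curl_lincomb \<beta>(2)) auto
    then have w': "is_weak_Curl \<Omega> \<beta>' ?f" by simp
    define \<tau> where "\<tau> = \<pi>Curl \<beta>'"
    have \<tau>h: "\<tau> \<in> S_h \<Omega> \<T>" "\<tau> \<in> H_Curl \<Omega>"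
      unfolding \<tau>_def by (rule Curl_projection_S_h[OF h'] Curl_projection_H_Curl[OF h'])+
    have "is_weak_Curl \<Omega> \<tau> (\<pi>div ?f)"
      unfolding \<tau>_def by (rule Curl_projection_weak_Curl[OF h' w' RT0_H_div[OF sf(2)]])
    \<comment> \<open>Commutation gives the Curl of \<tau> as the projection of the signed field,
      which is discrete already and hence reproduced.\<close>
    moreover have "ae_eq \<Omega> (\<pi>div ?f) ?f" using div_projection sf(2) by (simp add: linear_projection_def)
    ultimately have "is_weak_Curl \<Omega> \<tau> ?f"
      by (rule is_weak_Curl_cong[OF _ _ div_projection_L2[OF RT0_H_div[OF sf(2)]] fL(2)])
    then have \<tau>S: "\<tau> \<in> S_f \<Omega> \<T> f" using \<tau>h by (simp add: S_f_def)
    have n: "L2_norm (patch \<T> T) (weak_Curl \<Omega> \<beta>') = L2_norm (patch \<T> T) f" for T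
      using H_CurlD[OF h'] by (intro trans[OF L2_norm_patch_cong[OF weak_Curl_unique[OF h' w' fL(2)] _ fL(2)] nf]) blast
    have b: "L2_norm \<Omega> \<beta>' \<le> \<bar>C\<bar> * C_RD * L2_norm \<Omega> f"
    proof -
      have "L2_norm \<Omega> \<beta>' \<le> C * D_norm \<Omega> \<beta>" using c by (simp add: \<beta>'_def[abs_def])
      also have "\<dots> \<le> \<bar>C\<bar> * D_norm \<Omega> \<beta>" by (intro mult_right_mono) (auto simp: D_norm_J_norm)
      also have "\<dots> \<le> \<bar>C\<bar> * (C_RD * L2_norm \<Omega> f)" by (intro mult_left_mono \<beta>) simp
      finally show ?thesis by (simp add: mult.assoc)
    qed
    have T: "L2_norm T \<tau> \<le> \<bar>B\<bar> * L2_norm \<Omega> f" if T: "T \<in> \<T>" for T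
    proof -
      have "L2_norm T \<tau> \<le> C1Curl * L2_norm (patch \<T> T) \<beta>' + diameter T * C2Curl * L2_norm (patch \<T> T) f"
        using Curl_local_bound[OF T h'] n by (simp add: \<tau>_def)
      also have "\<dots> \<le> C1Curl * (\<bar>C\<bar> * C_RD * L2_norm \<Omega> f) + h_max \<T> * \<bar>C2Curl\<bar> * L2_norm \<Omega> f"
      proof (rule add_mono)
        show "C1Curl * L2_norm (patch \<T> T) \<beta>' \<le> C1Curl * (\<bar>C\<bar> * C_RD * L2_norm \<Omega> f)"
          using H_CurlD[OF h'] by (intro mult_left_mono C1Curl_nonneg order_trans[OF L2_norm_patch_le b]) auto
        have "diameter T * C2Curl \<le> diameter T * \<bar>C2Curl\<bar>" using diameter_nonneg[OF T] by (intro mult_left_mono) auto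
        also have "\<dots> \<le> h_max \<T> * \<bar>C2Curl\<bar>" by (intro mult_right_mono diameter_le_h_max T) simp
        finally have "diameter T * C2Curl \<le> h_max \<T> * \<bar>C2Curl\<bar>" .
        then show "diameter T * C2Curl * L2_norm (patch \<T> T) f \<le> h_max \<T> * \<bar>C2Curl\<bar> * L2_norm \<Omega> f"
          by (rule mult_mono[OF _ L2_norm_patch_le[OF fL(1)]]) (use h_max_nonneg in auto)
      qed
      also have "\<dots> = B * L2_norm \<Omega> f" by (simp add: B_def algebra_simps)
      also have "\<dots> \<le> \<bar>B\<bar> * L2_norm \<Omega> f" by (intro mult_right_mono) auto
      finally show ?thesis .
    qed
    \<comment> \<open>Each element is bounded by the global norm of \<open>f\<close>; summing
      squares produces the number of elements. The crude constant suffices for finiteness.\<close>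
    have "L2_norm \<Omega> \<tau> \<le> sqrt (real (card \<T>)) * \<bar>B\<bar> * L2_norm \<Omega> f"
    proof (rule power2_le_imp_le)
      have "(L2_norm \<Omega> \<tau>)\<^sup>2 = (\<Sum>T\<in>\<T>. (L2_norm T \<tau>)\<^sup>2)"
        using H_CurlD[OF \<tau>h(2)] by (intro sum_L2_norm_elements[symmetric]) auto
      also have "\<dots> \<le> (\<Sum>T\<in>\<T>. (\<bar>B\<bar> * L2_norm \<Omega> f)\<^sup>2)"
        by (intro sum_mono power_mono T L2_norm_nonneg)
      also have "\<dots> = (sqrt (real (card \<T>)) * \<bar>B\<bar> * L2_norm \<Omega> f)\<^sup>2" by (simp add: power_mult_distrib)
      finally show "(L2_norm \<Omega> \<tau>)\<^sup>2 \<le> (sqrt (real (card \<T>)) * \<bar>B\<bar> * L2_norm \<Omega> f)\<^sup>2" .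
    qed simp
    then show ?thesis using \<tau>S by blast
  qed
  then show ?thesis by blast
qed

lemma S_f_L2: "\<tau> \<in> S_f \<Omega> \<T> f \<Longrightarrow> \<tau> \<in> L2 \<Omega>"
  using S_h_H_Curl H_CurlD by (auto simp: S_f_def)

text \<open>Extrema over real sets need nonempty index sets and bounds: the ratios are nonnegative,
  and the discrete potential with \<open>v = 0\<close> bounds the inner infima uniformly from above.
  Minimizers are replaced by choices that are optimal up to \<open>e\<close>.\<close>

lemma kappa_h_properties:
  shows kappa_h_nonneg: "0 \<le> kappa_h \<Omega> \<T>"
    and kappa_h_approx: "f \<in> X_h \<Omega> \<T> \<Longrightarrow> 0 < e \<Longrightarrow>
      \<exists>v\<in>V_h \<Omega> \<T>. \<exists>\<tau>\<in>S_f \<Omega> \<T> f. L2_norm \<Omega> (\<lambda>x. \<tau> x - weak_rot \<Omega> v x) \<le> kappa_h \<Omega> \<T> * L2_norm \<Omega> f + e"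
proof -
  obtain C where C: "\<And>f. f \<in> X_h \<Omega> \<T> \<Longrightarrow> \<exists>\<tau>\<in>S_f \<Omega> \<T> f. L2_norm \<Omega> \<tau> \<le> C * L2_norm \<Omega> f"
    using discrete_potential_bound by blast
  define F where "F = {f \<in> X_h \<Omega> \<T>. \<not> ae_eq \<Omega> f (\<lambda>x. 0)}"
  define q where "q f v \<tau> = L2_norm \<Omega> (\<lambda>x. \<tau> x - weak_rot \<Omega> v x) / L2_norm \<Omega> f"
    for f :: "real^'n \<Rightarrow> real^'n" and v \<tau>
  define Q where "Q f v = (INF \<tau>\<in>S_f \<Omega> \<T> f. q f v \<tau>)" for f v
  define k where "k f = (INF v\<in>V_h \<Omega> \<T>. Q f v)" for f
  have \<kappa>: "kappa_h \<Omega> \<T> = (SUP f\<in>F. k f)" by (simp add: kappa_h_def F_def k_def Q_def q_def)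
  have q0: "0 \<le> q f v \<tau>" for f v \<tau> by (simp add: q_def)
  have ne: "S_f \<Omega> \<T> f \<noteq> {}" if "f \<in> X_h \<Omega> \<T>" for f using C[OF that] by blast
  have neV: "V_h \<Omega> \<T> \<noteq> {}" using zero_V_h by blast
  have bq: "bdd_below (q f v ` S_f \<Omega> \<T> f)" for f v by (rule bdd_belowI[of _ 0]) (auto simp: q0)
  have Q0: "0 \<le> Q f v" if "f \<in> X_h \<Omega> \<T>" for f v
    unfolding Q_def by (rule cINF_greatest[OF ne[OF that] q0])
  have bQ: "bdd_below (Q f ` V_h \<Omega> \<T>)" if "f \<in> X_h \<Omega> \<T>" for f
    by (rule bdd_belowI[of _ 0]) (auto simp: Q0[OF that])
  have k0: "0 \<le> k f" if "f \<in> X_h \<Omega> \<T>" for f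
    unfolding k_def by (rule cINF_greatest[OF neV Q0[OF that]])
  have pos: "L2_norm \<Omega> f > 0" if "f \<in> F" for f
    using that L2_norm_eq_0_iff[of f \<Omega>] L2_norm_nonneg[of \<Omega> f]
    by (auto simp: F_def X_h_def H_div0_iff less_le)
  have kC: "k f \<le> C" if f: "f \<in> F" for f
  proof -
    have fX: "f \<in> X_h \<Omega> \<T>" using f by (simp add: F_def)
    obtain \<tau> where \<tau>: "\<tau> \<in> S_f \<Omega> \<T> f" "L2_norm \<Omega> \<tau> \<le> C * L2_norm \<Omega> f" using C[OF fX] by blast
    have "k f \<le> Q f (\<lambda>x. 0)" unfolding k_def by (rule cINF_lower[OF bQ[OF fX] zero_V_h])
    also have "\<dots> \<le> q f (\<lambda>x. 0) \<tau>" unfolding Q_def by (rule cINF_lower[OF bq \<tau>(1)])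
    also have "\<dots> = L2_norm \<Omega> \<tau> / L2_norm \<Omega> f"
      unfolding q_def by (simp add: L2_norm_diff_weak_rot_zero[OF S_f_L2[OF \<tau>(1)]])
    also have "\<dots> \<le> C" using \<tau>(2) pos[OF f] by (simp add: divide_le_eq)
    finally show ?thesis .
  qed
  have bk: "bdd_above (k ` F)" by (rule bdd_aboveI[of _ C]) (auto simp: kC)
  have k\<kappa>: "k f \<le> kappa_h \<Omega> \<T>" if "f \<in> F" for f
    unfolding \<kappa> by (rule cSUP_upper[OF that bk])
  show k_nonneg: "0 \<le> kappa_h \<Omega> \<T>"
  proof -
    obtain T where T: "T \<in> \<T>" using mesh_not_empty by blast
    let ?c = "\<lambda>x::real^'n. axis undefined 1 :: real^'n"
    have "?c \<in> RT0 \<Omega> \<T>"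
      unfolding RT0_def using H_div0_H_div[OF const_H_div0]
      by (intro CollectI conjI ballI exI[of _ "axis undefined 1"] exI[of _ 0]) auto
    then have X: "?c \<in> X_h \<Omega> \<T>" using const_H_div0 by (simp add: X_h_def)
    have "0 < L2_norm \<Omega> ?c"
      using const_norm_pos(1)[OF _ T, of "axis undefined 1 :: real^'n"]
        L2_norm_patch_le[OF L2_const[OF domain_lmeasurable], of T "axis undefined 1 :: real^'n"]
      by (simp add: axis_eq_0_iff)
    then have "?c \<in> F"
      using X L2_norm_eq_0_iff[OF L2_const[OF domain_lmeasurable], of "axis undefined 1 :: real^'n"] by (simp add: F_def)
    then show ?thesis using k\<kappa> k0[OF X] order_trans by blast
  qed
  show "\<exists>v\<in>V_h \<Omega> \<T>. \<exists>\<tau>\<in>S_f \<Omega> \<T> f. L2_norm \<Omega> (\<lambda>x. \<tau> x - weak_rot \<Omega> v x) \<le> kappa_h \<Omega> \<T> * L2_norm \<Omega> f + e"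
    if f: "f \<in> X_h \<Omega> \<T>" and e: "0 < e"
  proof (cases "f \<in> F")
    case True
    let ?n = "L2_norm \<Omega> f"
    \<comment> \<open>The slack is divided by the norm of \<open>f\<close> because the extrema are
      over ratios; the strict inequality lets both nested infima be unfolded into witnesses.\<close>
    have "k f < kappa_h \<Omega> \<T> + e / ?n" using k\<kappa>[OF True] pos[OF True] e by (simp add: add_pos_pos less_add_same_cancel1 le_less_trans)
    then obtain v where v: "v \<in> V_h \<Omega> \<T>" "Q f v < kappa_h \<Omega> \<T> + e / ?n"
      unfolding k_def cINF_less_iff[OF neV bQ[OF f]] by blast
    then obtain \<tau> where \<tau>: "\<tau> \<in> S_f \<Omega> \<T> f" "q f v \<tau> < kappa_h \<Omega> \<T> + e / ?n"
      unfolding Q_def cINF_less_iff[OF ne[OF f] bq] by blast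
    then have "L2_norm \<Omega> (\<lambda>x. \<tau> x - weak_rot \<Omega> v x) \<le> kappa_h \<Omega> \<T> * ?n + e"
      using pos[OF True] by (simp add: q_def field_simps)
    then show ?thesis using v \<tau> by blast
  next
    \<comment> \<open>Fields that vanish almost everywhere are excluded from the supremum; for them
      \<open>v = 0\<close> and \<tau> = 0 are admissible.\<close>
    case False
    then have z: "ae_eq \<Omega> f (\<lambda>x. 0)" using f by (simp add: F_def)
    have fL: "f \<in> L2 \<Omega>" using f by (simp add: X_h_def H_div0_iff)
    have "is_weak_Curl \<Omega> (\<lambda>x. 0) (\<lambda>x. sgn_d *\<^sub>R f x)"
      using L2_inner_cong[OF z fL L2_zero test_L2] by (simp add: is_weak_Curl_def L2_inner_scaleR_left)
    then have S: "(\<lambda>x. 0) \<in> S_f \<Omega> \<T> f" using const_S_h by (simp add: S_f_def)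
    have "L2_norm \<Omega> (\<lambda>x. (\<lambda>x. 0) x - weak_rot \<Omega> (\<lambda>x. 0) x) = 0"
      using L2_norm_diff_weak_rot_zero[OF L2_zero] by (simp add: L2_norm_def)
    also have "\<dots> \<le> kappa_h \<Omega> \<T> * L2_norm \<Omega> f + e" using k_nonneg e by simp
    finally have "L2_norm \<Omega> (\<lambda>x. (\<lambda>x. 0) x - weak_rot \<Omega> (\<lambda>x. 0) x) \<le> kappa_h \<Omega> \<T> * L2_norm \<Omega> f + e" .
    then show ?thesis by (intro bexI[OF bexI[OF _ S] zero_V_h])
  qed
qed

lemma V_h_H0_rot: "V_h \<Omega> \<T> \<subseteq> H0_rot \<Omega>"
  by (auto simp: V_h_def N0_D_def)

text \<open>\<open>R\<close> abstracts the bound on the projection error of the potential, the only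
  ingredient that differs between the dimensions. The slack \<open>e\<close> absorbs the
  near-optimality in \<open>kappa_h_approx\<close>.\<close>

lemma discretization_error:
  assumes R: "\<And>\<beta> f. \<beta> \<in> H1 \<Omega> \<Longrightarrow> f \<in> H_div0 \<Omega> \<Longrightarrow> is_weak_Curl \<Omega> \<beta> f \<Longrightarrow> D_norm \<Omega> \<beta> \<le> C_RD * L2_norm \<Omega> f \<Longrightarrow>
      L2_norm \<Omega> (\<lambda>x. \<beta> x - \<pi>Curl \<beta> x) \<le> R * L2_norm \<Omega> f"
    and f: "f \<in> H_div0 \<Omega>" and u: "solves \<Omega> (V \<Omega>) f u"
    and uh: "u_h \<in> V_h \<Omega> \<T>" "\<And>v. v \<in> V_h \<Omega> \<T> \<Longrightarrow> a \<Omega> (\<lambda>x. u x - u_h x) v = 0"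
  shows "a_norm \<Omega> (\<lambda>x. u x - u_h x) \<le> (R + kappa_h \<Omega> \<T> * C1div * sqrt (real (C_OL \<T>))) * L2_norm \<Omega> f"
proof (rule field_le_epsilon)
  fix e :: real assume e: "0 < e"
  have fL: "f \<in> L2 \<Omega>" using f by (simp add: H_div0_iff)
  obtain \<beta> where \<beta>: "\<beta> \<in> H1 \<Omega>" "is_weak_Curl \<Omega> \<beta> f" "D_norm \<Omega> \<beta> \<le> C_RD * L2_norm \<Omega> f"
    using potential f unfolding is_potential_constant_def by blast
  have h: "\<beta> \<in> H_Curl \<Omega>" using \<beta>(1) H1_H_Curl by blast
  have h': "\<pi>Curl \<beta> \<in> H_Curl \<Omega>" by (rule Curl_projection_H_Curl[OF h])
  define f_h where "f_h = \<pi>div f"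
  have w: "is_weak_Curl \<Omega> (\<pi>Curl \<beta>) f_h"
    unfolding f_h_def by (rule Curl_projection_weak_Curl[OF h \<beta>(2) H_div0_H_div[OF f]])
  have fhL: "f_h \<in> L2 \<Omega>" "f_h \<in> RT0 \<Omega> \<T>"
    unfolding f_h_def using div_projection_L2 div_projection_RT0 H_div0_H_div[OF f] by auto
  \<comment> \<open>\<open>f_h\<close> agrees almost everywhere with the weak Curl of the projected
    potential, hence is divergence-free.\<close>
  have fh0: "f_h \<in> H_div0 \<Omega>"
  proof -
    have "ae_eq \<Omega> (weak_Curl \<Omega> (\<pi>Curl \<beta>)) f_h" by (rule weak_Curl_unique[OF h' w fhL(1)])
    then show ?thesis
      using weak_Curl_H_div0[OF h'] H_CurlD[OF h'] fhL(1) test_L2[OF test_functions_grad]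
        L2_inner_cong[of \<Omega> "weak_Curl \<Omega> (\<pi>Curl \<beta>)" f_h]
      by (auto simp: H_div0_iff)
  qed
  then have "f_h \<in> X_h \<Omega> \<T>" using fhL by (simp add: X_h_def)
  then obtain v \<tau>h where v: "v \<in> V_h \<Omega> \<T>" and \<tau>h: "\<tau>h \<in> S_f \<Omega> \<T> f_h"
    and k: "L2_norm \<Omega> (\<lambda>x. \<tau>h x - weak_rot \<Omega> v x) \<le> kappa_h \<Omega> \<T> * L2_norm \<Omega> f_h + e"
    using kappa_h_approx[OF _ e] by blast
  have \<tau>h': "\<tau>h \<in> H_Curl \<Omega>" "is_weak_Curl \<Omega> \<tau>h (\<lambda>x. sgn_d *\<^sub>R f_h x)"
    using \<tau>h S_h_H_Curl by (auto simp: S_f_def)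
  have L: "\<beta> \<in> L2 \<Omega>" "\<pi>Curl \<beta> \<in> L2 \<Omega>" "\<tau>h \<in> L2 \<Omega>" using H_CurlD h h' \<tau>h' by auto
  have vr: "weak_rot \<Omega> v \<in> L2 \<Omega>" using v V_h_H0_rot H_rotD by (auto simp: H0_rot_iff)
  define \<tau>0 where "\<tau>0 x = 1 *\<^sub>R \<beta> x + (-1) *\<^sub>R \<pi>Curl \<beta> x" for x
  \<comment> \<open>The Curls add up to \<open>sgn_d\<close> times \<open>f - f_h\<close> plus
    \<open>sgn_d\<close> times \<open>f_h\<close>, so the projection of \<open>f\<close> cancels and
    \<tau> is admissible for the original data.\<close>
  define \<tau> where "\<tau> x = sgn_d *\<^sub>R \<tau>0 x + 1 *\<^sub>R \<tau>h x" for x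
  have \<tau>0L: "\<tau>0 \<in> L2 \<Omega>" unfolding \<tau>0_def[abs_def] by (intro L2_lincomb L)
  have \<tau>0h: "\<tau>0 \<in> H_Curl \<Omega>" unfolding \<tau>0_def[abs_def] by (rule H_Curl_lincomb[OF h h'])
  have \<tau>H: "\<tau> \<in> H_Curl \<Omega>" unfolding \<tau>_def[abs_def] by (rule H_Curl_lincomb[OF \<tau>0h \<tau>h'(1)])
  have "is_weak_Curl \<Omega> \<tau>0 (\<lambda>x. 1 *\<^sub>R f x + (-1) *\<^sub>R f_h x)"
    unfolding \<tau>0_def[abs_def] by (intro is_weak_Curl_lincomb L fL fhL \<beta> w)
  then have "is_weak_Curl \<Omega> \<tau> (\<lambda>x. sgn_d *\<^sub>R (1 *\<^sub>R f x + (-1) *\<^sub>R f_h x) + 1 *\<^sub>R (sgn_d *\<^sub>R f_h x))"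
    unfolding \<tau>_def[abs_def] by (intro is_weak_Curl_lincomb L2_lincomb \<tau>0L L fL fhL \<tau>h' L2_scaleR)
  then have \<tau>w: "is_weak_Curl \<Omega> \<tau> (\<lambda>x. sgn_d *\<^sub>R f x)" by (simp add: algebra_simps)
  have "a_norm \<Omega> (\<lambda>x. u x - u_h x) \<le> L2_norm \<Omega> (\<lambda>x. \<tau> x - weak_rot \<Omega> v x)"
    by (rule hypercircle_bound[OF f u \<tau>H \<tau>w V_h_H0_rot uh v])
  also have "\<dots> = L2_norm \<Omega> (\<lambda>x. sgn_d *\<^sub>R \<tau>0 x + (\<tau>h x - weak_rot \<Omega> v x))"
    by (simp add: \<tau>_def add_diff_eq)
  also have "\<dots> \<le> L2_norm \<Omega> (\<lambda>x. sgn_d *\<^sub>R \<tau>0 x) + L2_norm \<Omega> (\<lambda>x. \<tau>h x - weak_rot \<Omega> v x)"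
    by (intro L2_norm_triangle L2_scaleR \<tau>0L L2_diff L vr)
  also have "\<dots> \<le> R * L2_norm \<Omega> f + (kappa_h \<Omega> \<T> * L2_norm \<Omega> f_h + e)"
    using R[OF \<beta>(1) f \<beta>(2,3)] k by (simp add: L2_norm_scaleR abs_sgn_d \<tau>0_def)
  also have "\<dots> \<le> R * L2_norm \<Omega> f + (kappa_h \<Omega> \<T> * (C1div * sqrt (real (C_OL \<T>)) * L2_norm \<Omega> f) + e)"
    unfolding f_h_def
    by (intro add_left_mono add_right_mono mult_left_mono div_projection_bound f kappa_h_nonneg)
  finally show "a_norm \<Omega> (\<lambda>x. u x - u_h x) \<le> (R + kappa_h \<Omega> \<T> * C1div * sqrt (real (C_OL \<T>))) * L2_norm \<Omega> f + e"
    by (simp add: algebra_simps)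
qed

end

section \<open>The Galerkin projection and the constant \<open>M\<^sub>h\<close>\<close>

context mesh
begin

text \<open>The indicator makes the coordinate function bounded on the whole space, as
  \<open>L2_bounded_function\<close> requires, without changing it on the interior.\<close>

lemma affine_moment_L2:
  assumes T: "T \<in> \<T>"
  shows "(\<lambda>x. indicator (interior T) x * x $ j) \<in> L2 (interior T)"
proof -
  let ?S = "interior T"
  have Ss: "?S \<in> sets lebesgue" by (simp add: borel_open)
  obtain B where B: "\<And>x. x \<in> T \<Longrightarrow> norm x \<le> B"
    using compact_imp_bounded[OF compact_element[OF T]] bounded_iff by metis
  show ?thesis
  proof (rule L2_bounded_function[OF interior_element_lmeasurable[OF T]])
    have "(\<lambda>x. x $ j) \<in> borel_measurable (lebesgue_on ?S)"
      by (intro continuous_imp_measurable_on_sets_lebesgue continuous_intros Ss)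
    moreover have "(indicator ?S :: real^'n \<Rightarrow> real) \<in> borel_measurable (lebesgue_on ?S)"
      using Ss by (intro borel_measurable_indicator) (auto simp: sets_restrict_space_iff)
    ultimately show "(\<lambda>x. indicator ?S x * x $ j) \<in> borel_measurable (lebesgue_on ?S)" by (rule borel_measurable_times[rotated])
    show "norm (indicator ?S x * x $ j) \<le> \<bar>B\<bar>" for x
    proof (cases "x \<in> ?S")
      case True
      then have "norm x \<le> B" using B interior_subset by blast
      then show ?thesis using True component_le_norm_cart[of x j] by simp
    qed simp
  qed
qed

text \<open>Replacing one factor of \<open>v x \<bullet> v x\<close> by its affine expression turns
  the squared norm into a linear combination of the moments of \<open>v\<close> against 1 and the
  coordinates.\<close>

lemma affine_zero_if_moments_zero:
  assumes T: "T \<in> \<T>" and v: "v \<in> L2 \<Omega>" and aff: "AE x in lebesgue_on T. v x = \<alpha> + (A *v x + b)"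
    and m0: "\<And>i. L2_inner (interior T) (\<lambda>x. v x $ i) (\<lambda>x. 1) = 0"
    and m1: "\<And>i j. L2_inner (interior T) (\<lambda>x. v x $ i) (\<lambda>x. indicator (interior T) x * x $ j) = 0"
  shows "L2_norm T v = 0"
proof -
  let ?S = "interior T" and ?X = "\<lambda>j x. indicator (interior T) x * x $ j"
  have Sl: "?S \<in> lmeasurable" by (rule interior_element_lmeasurable[OF T])
  have Ss: "?S \<in> sets lebesgue" using Sl by auto
  have Ts: "T \<in> sets lebesgue" using compact_element[OF T] by (simp add: borel_compact)
  have vS: "v \<in> L2 ?S" by (rule L2_subset[OF v interior_element_subset[OF T] Ss mesh_sets])
  have one: "(\<lambda>x. 1::real) \<in> L2 ?S" by (rule L2_const[OF Sl])
  have XL: "?X j \<in> L2 ?S" for j by (rule affine_moment_L2[OF T])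
  define c where "c = \<alpha> + b"
  define h where "h x = (\<Sum>i\<in>UNIV. c $ i * (v x $ i * 1) + (\<Sum>j\<in>UNIV. A $ i $ j * (v x $ i * ?X j x)))" for x
  have i0: "integrable (lebesgue_on ?S) (\<lambda>x. v x $ i * 1)" for i
    using L2_integrable_inner[OF L2_nth[OF vS] one] by simp
  have i1: "integrable (lebesgue_on ?S) (\<lambda>x. v x $ i * ?X j x)" for i j
    using L2_integrable_inner[OF L2_nth[OF vS] XL] by simp
  have hi: "integrable (lebesgue_on ?S) h"
    unfolding h_def by (intro Bochner_Integration.integrable_sum Bochner_Integration.integrable_add integrable_mult_right i0 i1)
  have "integral\<^sup>L (lebesgue_on ?S) h =
      (\<Sum>i\<in>UNIV. c $ i * integral\<^sup>L (lebesgue_on ?S) (\<lambda>x. v x $ i * 1) +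
        (\<Sum>j\<in>UNIV. A $ i $ j * integral\<^sup>L (lebesgue_on ?S) (\<lambda>x. v x $ i * ?X j x)))"
    unfolding h_def
    by (subst Bochner_Integration.integral_sum Bochner_Integration.integral_add
        | intro Bochner_Integration.integrable_sum Bochner_Integration.integrable_add integrable_mult_right i0 i1 sum.cong refl
        | simp only: integral_mult_right_zero)+
  also have "\<dots> = 0" using m0 m1 by (simp add: L2_inner_def)
  finally have h0: "integral\<^sup>L (lebesgue_on ?S) h = 0" .
  have "AE x in lebesgue. x \<in> T \<longrightarrow> v x = \<alpha> + (A *v x + b)"
    using aff Ts by (simp add: AE_restrict_space_iff)
  then have "AE x in lebesgue. x \<in> ?S \<longrightarrow> v x \<bullet> v x = h x"
  proof eventually_elim
    case (elim x)
    show ?case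
    proof
      assume x: "x \<in> ?S"
      then have e: "v x = c + A *v x" using elim interior_subset by (auto simp: c_def add_ac)
      have "v x \<bullet> v x = v x \<bullet> (c + A *v x)" using e by simp
      also have "\<dots> = (\<Sum>i\<in>UNIV. v x $ i * (c $ i + (\<Sum>j\<in>UNIV. A $ i $ j * x $ j)))"
        by (simp add: inner_vec_def matrix_vector_mult_def)
      also have "\<dots> = h x"
        unfolding h_def using x by (intro sum.cong refl) (simp add: sum_distrib_left algebra_simps)
      finally show "v x \<bullet> v x = h x" .
    qed
  qed
  then have "AE x in lebesgue_on ?S. v x \<bullet> v x = h x" using Ss by (simp add: AE_restrict_space_iff)
  then have "L2_inner ?S v v = integral\<^sup>L (lebesgue_on ?S) h"
    unfolding L2_inner_def using L2_integrable_inner[OF vS vS] hi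
    by (intro integral_cong_AE borel_measurable_integrable)
  then have "(L2_norm ?S v)\<^sup>2 = 0" using h0 by (simp add: L2_norm_power2_inner)
  then show ?thesis using L2_norm_element[OF T v] by simp
qed

end

context maxwell_mesh
begin

lemma N0_element:
  assumes "v \<in> N0 \<Omega> \<T>" "T \<in> \<T>"
  shows "\<exists>\<beta> A b \<alpha>. (\<forall>x. \<beta> x = A *v x + b) \<and> (\<forall>x\<in>T. \<beta> x \<bullet> x = 0) \<and> (AE x in lebesgue_on T. v x = \<alpha> + \<beta> x)"
proof -
  have "\<exists>\<alpha> \<beta>. (\<exists>A b. \<forall>x. \<beta> x = A *v x + b) \<and> (\<forall>x\<in>T. \<beta> x \<bullet> x = 0) \<and> (AE x in lebesgue_on T. v x = \<alpha> + \<beta> x)"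
    using assms unfolding N0_def by simp
  then show ?thesis by (elim exE conjE) (intro exI conjI)
qed

lemma N0_lincomb:
  assumes "v \<in> N0 \<Omega> \<T>" "w \<in> N0 \<Omega> \<T>"
  shows "(\<lambda>x. r *\<^sub>R v x + s *\<^sub>R w x) \<in> N0 \<Omega> \<T>"
  unfolding N0_def
proof (intro CollectI conjI ballI)
  show "(\<lambda>x. r *\<^sub>R v x + s *\<^sub>R w x) \<in> H_rot \<Omega>"
    using assms by (intro H_rot_lincomb) (auto simp: N0_def)
  fix T assume T: "T \<in> \<T>"
  obtain \<alpha> \<beta> A b where v: "\<forall>x. \<beta> x = A *v x + b" "\<forall>x\<in>T. \<beta> x \<bullet> x = 0" "AE x in lebesgue_on T. v x = \<alpha> + \<beta> x"
    using N0_element[OF assms(1) T] by (elim exE conjE)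
  obtain \<alpha>' \<beta>' A' b' where w: "\<forall>x. \<beta>' x = A' *v x + b'" "\<forall>x\<in>T. \<beta>' x \<bullet> x = 0" "AE x in lebesgue_on T. w x = \<alpha>' + \<beta>' x"
    using N0_element[OF assms(2) T] by (elim exE conjE)
  let ?\<beta> = "\<lambda>x. r *\<^sub>R \<beta> x + s *\<^sub>R \<beta>' x"
  show "\<exists>\<alpha> \<beta>. (\<exists>A b. \<forall>x. \<beta> x = A *v x + b) \<and> (\<forall>x\<in>T. \<beta> x \<bullet> x = 0) \<and>
      (AE x in lebesgue_on T. r *\<^sub>R v x + s *\<^sub>R w x = \<alpha> + \<beta> x)"
  proof (intro exI[of _ "r *\<^sub>R \<alpha> + s *\<^sub>R \<alpha>'"] exI[of _ ?\<beta>] conjI)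
    have "?\<beta> x = (r *\<^sub>R A + s *\<^sub>R A') *v x + (r *\<^sub>R b + s *\<^sub>R b')" for x
      by (simp add: v(1)[rule_format] w(1)[rule_format] matrix_vector_mult_add_rdistrib scaleR_matrix_vector_assoc[symmetric] scaleR_add_right)
    then show "\<exists>A b. \<forall>x. ?\<beta> x = A *v x + b" by blast
    show "\<forall>x\<in>T. ?\<beta> x \<bullet> x = 0" using v(2) w(2) by (simp add: inner_add_left)
    show "AE x in lebesgue_on T. r *\<^sub>R v x + s *\<^sub>R w x = r *\<^sub>R \<alpha> + s *\<^sub>R \<alpha>' + ?\<beta> x"
      using v(3) w(3) by eventually_elim (simp add: algebra_simps)
  qed
qed

lemma weak_grad_L2: "v \<in> H1 \<Omega> \<Longrightarrow> weak_grad \<Omega> v \<in> L2 \<Omega>"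
  by (rule L2_vecI) (simp add: weak_grad_def weak_pdD)

lemma V_h_lincomb:
  assumes "v \<in> V_h \<Omega> \<T>" "w \<in> V_h \<Omega> \<T>"
  shows "(\<lambda>x. r *\<^sub>R v x + s *\<^sub>R w x) \<in> V_h \<Omega> \<T>"
proof -
  have L: "v \<in> L2 \<Omega>" "w \<in> L2 \<Omega>" using assms V_h_H0_rot H_rotD by (auto simp: H0_rot_iff)
  have "L2_inner \<Omega> (weak_grad \<Omega> \<eta>) (\<lambda>x. r *\<^sub>R v x + s *\<^sub>R w x) = 0" if "\<eta> \<in> S1_0 \<Omega> \<T>" for \<eta>
  proof -
    have "weak_grad \<Omega> \<eta> \<in> L2 \<Omega>" using that by (intro weak_grad_L2) (auto simp: S1_0_def S1_def)
    then show ?thesis using assms that L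
      by (simp add: V_h_def L2_inner_add_right L2_scaleR L2_inner_scaleR_right)
  qed
  then show ?thesis using assms by (simp add: V_h_def N0_D_def N0_lincomb H0_rot_lincomb)
qed

text \<open>On each element a discrete field is affine almost everywhere, so finitely many moments
  determine it up to a null set, and a null field has zero energy. This is the separation that
  \<open>finite_functionals_projection\<close> asks for.\<close>

lemma Galerkin_projection_exists:
  assumes u: "u \<in> H_rot \<Omega>"
  shows "\<exists>w\<in>V_h \<Omega> \<T>. \<forall>v\<in>V_h \<Omega> \<T>. a \<Omega> (\<lambda>x. u x - w x) v = 0"
proof -
  \<comment> \<open>\<open>None\<close> indexes the weight 1 and \<open>Some j\<close> the
    \<open>j\<close>-th coordinate.\<close>
  define m :: "(real^'n) set \<Rightarrow> 'n option \<Rightarrow> real^'n \<Rightarrow> real" where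
    "m T j = (case j of None \<Rightarrow> (\<lambda>x. 1) | Some j \<Rightarrow> (\<lambda>x. indicator (interior T) x * x $ j))" for T j
  define l where "l k v = (case k of (T, i, j) \<Rightarrow> L2_inner (interior T) (\<lambda>x. v x $ i) (m T j))"
    for k :: "(real^'n) set \<times> 'n \<times> 'n option" and v :: "real^'n \<Rightarrow> real^'n"
  have VL: "v \<in> L2 \<Omega>" "v \<in> H_rot \<Omega>" if "v \<in> V_h \<Omega> \<T>" for v
    using that V_h_H0_rot H_rotD by (auto simp: H0_rot_iff)
  show ?thesis
  proof (rule finite_functionals_projection[where I="\<T> \<times> UNIV \<times> UNIV" and H="H_rot \<Omega>" and B="a \<Omega>" and l=l])
    show "finite (\<T> \<times> (UNIV :: 'n set) \<times> (UNIV :: 'n option set))" using finite_mesh by simp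
    show "l k (\<lambda>x. r *\<^sub>R v x + s *\<^sub>R w x) = r * l k v + s * l k w"
      if k: "k \<in> \<T> \<times> UNIV \<times> UNIV" and vw: "v \<in> V_h \<Omega> \<T>" "w \<in> V_h \<Omega> \<T>" for k v w r s
    proof -
      obtain T i j where k: "k = (T, i, j)" "T \<in> \<T>" using k by auto
      have Sl: "interior T \<in> lmeasurable" by (rule interior_element_lmeasurable[OF k(2)])
      have c: "(\<lambda>x. v x $ i) \<in> L2 (interior T)" "(\<lambda>x. w x $ i) \<in> L2 (interior T)"
        using L2_element[OF k(2)] VL vw by (auto intro: L2_nth)
      have mL: "m T j \<in> L2 (interior T)"
      proof (cases j)
        case None
        then show ?thesis using L2_const[OF Sl] by (simp add: m_def)
      next
        case (Some j')
        then show ?thesis using affine_moment_L2[OF k(2)] by (simp add: m_def)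
      qed
      show ?thesis
        using L2_inner_add_left[OF L2_scaleR[OF c(1), of r] L2_scaleR[OF c(2), of s] mL]
        by (simp add: l_def k(1) L2_inner_scaleR_left[where 'b=real, simplified])
    qed
    show "a \<Omega> v v = 0" if v: "v \<in> V_h \<Omega> \<T>" and l0: "\<And>k. k \<in> \<T> \<times> UNIV \<times> UNIV \<Longrightarrow> l k v = 0" for v
    proof -
      have "L2_norm T v = 0" if T: "T \<in> \<T>" for T
      proof -
        have "v \<in> N0 \<Omega> \<T>" using v by (simp add: V_h_def N0_D_def)
        from N0_element[OF this T] obtain \<alpha> \<beta> A b where \<beta>: "\<forall>x. \<beta> x = A *v x + b" "AE x in lebesgue_on T. v x = \<alpha> + \<beta> x"
          by (elim exE conjE)
        show ?thesis
        proof (rule affine_zero_if_moments_zero[OF T VL(1)[OF v]])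
          show "AE x in lebesgue_on T. v x = \<alpha> + (A *v x + b)" using \<beta>(2) unfolding \<beta>(1)[rule_format] .
          show "L2_inner (interior T) (\<lambda>x. v x $ i) (\<lambda>x. 1) = 0" for i
            using l0[of "(T, i, None)"] T by (simp add: l_def m_def)
          show "L2_inner (interior T) (\<lambda>x. v x $ i) (\<lambda>x. indicator (interior T) x * x $ j) = 0" for i j
            using l0[of "(T, i, Some j)"] T by (simp add: l_def m_def)
        qed
      qed
      then have "L2_norm \<Omega> v = 0" using sum_L2_norm_elements[OF VL(1)[OF v]] by simp
      then have z: "ae_eq \<Omega> v (\<lambda>x. 0)" using L2_norm_eq_0_iff[OF VL(1)[OF v]] by simp
      have "is_weak_rot \<Omega> v (\<lambda>x. 0)"
        using L2_inner_cong[OF z VL(1)[OF v] L2_zero test_L2[OF Curl_test]] by (simp add: is_weak_rot_def)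
      then have "ae_eq \<Omega> (weak_rot \<Omega> v) (\<lambda>x. 0)" by (rule weak_rot_unique[OF VL(2)[OF v] _ L2_zero])
      then show ?thesis
        using L2_inner_cong[of \<Omega> "weak_rot \<Omega> v" "\<lambda>x. 0" "weak_rot \<Omega> v"] H_rotD[OF VL(2)[OF v]] by (simp add: a_def)
    qed
  qed (use V_h_H0_rot H0_rot_iff zero_V_h V_h_lincomb H_rot_lincomb(1) a_lincomb a_commute a_nonneg u in auto)
qed

text \<open>A manufactured solution: start from a smooth divergence-free \<open>u\<close> and read
  off \<open>f\<close> from the strong form of the equation. It forces every admissible bound in
  \<open>M_h\<close> to be nonnegative, so that the infimum exists.\<close>

lemma exists_nontrivial_solution: "\<exists>f u. f \<in> H_div0 \<Omega> \<and> solves \<Omega> (V \<Omega>) f u \<and> 0 < L2_norm \<Omega> f"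
proof -
  obtain \<phi> x where \<phi>: "\<phi> \<in> test_functions \<Omega>" and x: "Curl \<phi> x \<noteq> 0" using Curl_nontrivial by blast
  define u where "u = Curl \<phi>"
  define f where "f x = sgn_d *\<^sub>R Curl (rot u) x" for x
  have ut: "u \<in> test_functions \<Omega>" unfolding u_def by (rule Curl_test[OF \<phi>])
  have rt: "rot u \<in> test_functions \<Omega>" by (rule rot_test[OF ut])
  have f0: "f \<in> H_div0 \<Omega>" unfolding f_def[abs_def] by (rule scaleR_H_div0[OF Curl_test_H_div0[OF rt]])
  have uH: "u \<in> H0_rot \<Omega>" "ae_eq \<Omega> (weak_rot \<Omega> u) (rot u)" by (rule test_H0_rot[OF ut])+
  have wr: "weak_rot \<Omega> u \<in> L2 \<Omega>" using uH H_rotD by (auto simp: H0_rot_iff)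
  have eq: "a \<Omega> u v = L2_inner \<Omega> f v" if "v \<in> H0_rot \<Omega>" for v
  proof -
    have v: "v \<in> L2 \<Omega>" "weak_rot \<Omega> v \<in> L2 \<Omega>" "is_weak_rot \<Omega> v (weak_rot \<Omega> v)"
      using that H_rotD by (auto simp: H0_rot_iff)
    have "a \<Omega> u v = L2_inner \<Omega> (rot u) (weak_rot \<Omega> v)"
      unfolding a_def by (rule L2_inner_cong[OF uH(2) wr test_L2[OF rt] v(2)])
    also have "\<dots> = L2_inner \<Omega> f v"
    proof -
      have "L2_inner \<Omega> v (Curl (rot u)) = sgn_d * L2_inner \<Omega> (weak_rot \<Omega> v) (rot u)"
        using v(3) rt by (simp add: is_weak_rot_def)
      then show ?thesis
        by (simp add: f_def[abs_def] L2_inner_scaleR_left L2_inner_commute[of \<Omega> _ v] L2_inner_commute[of \<Omega> "rot u"] sgn_d_cancel)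
    qed
    finally show ?thesis .
  qed
  have sol: "solves \<Omega> (V \<Omega>) f u"
    unfolding solves_def V_def using uH Curl_test_H_div0[OF \<phi>] eq by (auto simp: u_def)
  have "L2_norm \<Omega> f \<noteq> 0"
  proof
    assume "L2_norm \<Omega> f = 0"
    \<comment> \<open>If \<open>f\<close> vanished, testing with \<open>u\<close> would kill
      \<open>rot u\<close>, and pairing that with \<phi> would kill \<open>u\<close> itself, since
      \<open>u\<close> is the Curl of \<phi>. A continuous function that is nonzero somewhere cannot
      vanish almost everywhere.\<close>
    then have "L2_inner \<Omega> f u = 0"
      using L2_Cauchy_Schwarz[of f \<Omega> u] f0 test_L2[OF ut] by (simp add: H_div0_iff)
    then have "(L2_norm \<Omega> (weak_rot \<Omega> u))\<^sup>2 = 0" using eq[OF uH(1)] by (simp add: L2_norm_power2_inner a_def)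
    then have "L2_norm \<Omega> (rot u) = 0" using L2_norm_cong[OF uH(2) wr test_L2[OF rt]] by simp
    then have "L2_inner \<Omega> (rot u) \<phi> = 0"
      using L2_Cauchy_Schwarz[OF test_L2[OF rt] test_L2[OF \<phi>]] by simp
    then have "L2_inner \<Omega> u u = 0" using adjoint[OF ut \<phi>] by (simp add: u_def)
    then have "ae_eq \<Omega> u (\<lambda>x. 0)"
      using L2_norm_eq_0_iff[OF test_L2[OF ut]] by (simp add: L2_norm_power2_inner[symmetric])
    then have ae: "AE y in lebesgue. y \<in> \<Omega> \<longrightarrow> u y = 0"
      using domain_sets by (simp add: ae_eq_def AE_restrict_space_iff)
    have "open {y. u y \<noteq> 0}"
      by (intro open_Collect_neq test_functions_continuous[OF ut] continuous_on_const)
    moreover have "{y. u y \<noteq> 0} \<noteq> {}" using x by (auto simp: u_def)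
    moreover have "negligible {y. u y \<noteq> 0}"
    proof -
      have "AE y in lebesgue. u y = 0"
        using ae by eventually_elim (use test_functions_zero_outside[OF ut] in blast)
      then show ?thesis by (simp add: negligible_iff_null_sets AE_iff_null_sets eventually_ae_filter completion.AE_iff_null_sets)
          (use completion.complete_measure_axioms in \<open>metis (mono_tags, lifting) null_sets_completion_subset mem_Collect_eq subsetI\<close>)
    qed
    ultimately show False using open_not_negligible by blast
  qed
  then have "0 < L2_norm \<Omega> f" by (simp add: less_le)
  then show ?thesis using f0 sol by blast
qed

text \<open>\<open>LEAST\<close> has its intended value only if the infimum of the admissible bounds
  is admissible. \<open>G_h\<close> satisfies the hypotheses of \<open>est\<close> by existence of
  the Galerkin projection, so \<open>M\<close> itself is admissible.\<close>

lemma M_h_le: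
  assumes est: "\<And>f u u_h. f \<in> H_div0 \<Omega> \<Longrightarrow> solves \<Omega> (V \<Omega>) f u \<Longrightarrow> u_h \<in> V_h \<Omega> \<T> \<Longrightarrow>
      (\<And>v. v \<in> V_h \<Omega> \<T> \<Longrightarrow> a \<Omega> (\<lambda>x. u x - u_h x) v = 0) \<Longrightarrow> a_norm \<Omega> (\<lambda>x. u x - u_h x) \<le> M * L2_norm \<Omega> f"
  shows "M_h \<Omega> \<T> \<le> M"
proof -
  define e where "e u = a_norm \<Omega> (\<lambda>x. u x - G_h \<Omega> \<T> u x)" for u
  define P where "P M \<longleftrightarrow> (\<forall>f\<in>H_div0 \<Omega>. \<forall>u. solves \<Omega> (V \<Omega>) f u \<longrightarrow> e u \<le> M * L2_norm \<Omega> f)" for M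
  define S where "S = {M. P M}"
  have PM: "P M"
    unfolding P_def
  proof (intro ballI allI impI)
    fix f u assume f: "f \<in> H_div0 \<Omega>" and u: "solves \<Omega> (V \<Omega>) f u"
    then have "u \<in> H_rot \<Omega>" by (auto simp: solves_def V_def H0_rot_iff)
    then have "\<exists>w. w \<in> V_h \<Omega> \<T> \<and> (\<forall>v\<in>V_h \<Omega> \<T>. a \<Omega> (\<lambda>x. u x - w x) v = 0)"
      using Galerkin_projection_exists by (simp only: Bex_def)
    then have G: "G_h \<Omega> \<T> u \<in> V_h \<Omega> \<T> \<and> (\<forall>v\<in>V_h \<Omega> \<T>. a \<Omega> (\<lambda>x. u x - G_h \<Omega> \<T> u x) v = 0)"
      unfolding G_h_def by (rule someI_ex)
    show "e u \<le> M * L2_norm \<Omega> f"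
      unfolding e_def
    proof (rule est[OF f u conjunct1[OF G]])
      fix v assume "v \<in> V_h \<Omega> \<T>"
      then show "a \<Omega> (\<lambda>x. u x - G_h \<Omega> \<T> u x) v = 0" by (rule bspec[OF conjunct2[OF G]])
    qed
  qed
  obtain f0 u0 where 0: "f0 \<in> H_div0 \<Omega>" "solves \<Omega> (V \<Omega>) f0 u0" "0 < L2_norm \<Omega> f0"
    using exists_nontrivial_solution by blast
  have "0 \<le> y" if "P y" for y
  proof -
    have "0 \<le> e u0" by (simp add: e_def a_norm_eq)
    also have "\<dots> \<le> y * L2_norm \<Omega> f0" using that 0(1,2) unfolding P_def by blast
    finally show ?thesis using 0(3) by (simp add: zero_le_mult_iff)
  qed
  then have bdd: "bdd_below S" by (intro bdd_belowI[of _ 0]) (auto simp: S_def)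
  have ne: "S \<noteq> {}" using PM by (auto simp: S_def)
  \<comment> \<open>Each condition is a lower bound for \<open>M\<close> after division by the norm
    of \<open>f\<close>, and such bounds pass to the infimum. If the norm is 0, the condition does
    not depend on \<open>M\<close> and \<open>PM\<close> settles it.\<close>
  have "P (Inf S)"
    unfolding P_def
  proof (intro ballI allI impI)
    fix f u assume fu: "f \<in> H_div0 \<Omega>" "solves \<Omega> (V \<Omega>) f u"
    show "e u \<le> Inf S * L2_norm \<Omega> f"
    proof (cases "L2_norm \<Omega> f = 0")
      case True
      then show ?thesis using PM fu by (auto simp: P_def)
    next
      case False
      then have pos: "0 < L2_norm \<Omega> f" by (simp add: less_le)
      have "e u / L2_norm \<Omega> f \<le> Inf S"
        using fu pos by (intro cInf_greatest[OF ne]) (auto simp: S_def P_def divide_le_eq)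
      then show ?thesis using pos by (simp add: divide_le_eq)
    qed
  qed
  then have "(LEAST M. P M) = Inf S"
  proof (rule Least_equality)
    show "Inf S \<le> y" if "P y" for y
      using that by (intro cInf_lower[OF _ bdd]) (simp add: S_def)
  qed
  moreover have "M_h \<Omega> \<T> = (LEAST M. P M)" by (simp add: M_h_def P_def e_def)
  ultimately show ?thesis using cInf_lower[OF _ bdd, of M] PM by (simp add: S_def)
qed

text \<open>One estimate serves both conclusions: the Galerkin orthogonality holds for a discrete
  solution because the continuous equation extends to all of \<open>H0_rot\<close>, and for
  \<open>G_h\<close> by its definition.\<close>

lemma computable_error_bound:
  assumes R: "\<And>\<beta> f. \<beta> \<in> H1 \<Omega> \<Longrightarrow> f \<in> H_div0 \<Omega> \<Longrightarrow> is_weak_Curl \<Omega> \<beta> f \<Longrightarrow> D_norm \<Omega> \<beta> \<le> C_RD * L2_norm \<Omega> f \<Longrightarrow>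
      L2_norm \<Omega> (\<lambda>x. \<beta> x - \<pi>Curl \<beta> x) \<le> R * sqrt (real (C_OL \<T>)) * L2_norm \<Omega> f"
    and M: "M \<ge> (R + kappa_h \<Omega> \<T> * C1div) * sqrt (real (C_OL \<T>))"
  shows "(\<forall>f\<in>H_div0 \<Omega>. \<forall>u u_h. solves \<Omega> (V \<Omega>) f u \<and> solves \<Omega> (V_h \<Omega> \<T>) f u_h \<longrightarrow>
      a_norm \<Omega> (\<lambda>x. u x - u_h x) \<le> M * L2_norm \<Omega> f) \<and> M_h \<Omega> \<T> \<le> M"
proof -
  have est: "a_norm \<Omega> (\<lambda>x. u x - u_h x) \<le> M * L2_norm \<Omega> f"
    if "f \<in> H_div0 \<Omega>" "solves \<Omega> (V \<Omega>) f u" "u_h \<in> V_h \<Omega> \<T>" "\<And>v. v \<in> V_h \<Omega> \<T> \<Longrightarrow> a \<Omega> (\<lambda>x. u x - u_h x) v = 0" for f u u_h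
  proof -
    have "a_norm \<Omega> (\<lambda>x. u x - u_h x) \<le> (R * sqrt (real (C_OL \<T>)) + kappa_h \<Omega> \<T> * C1div * sqrt (real (C_OL \<T>))) * L2_norm \<Omega> f"
      by (rule discretization_error[OF R that])
    also have "\<dots> \<le> M * L2_norm \<Omega> f"
      using M by (intro mult_right_mono) (auto simp: algebra_simps)
    finally show ?thesis .
  qed
  have "a_norm \<Omega> (\<lambda>x. u x - u_h x) \<le> M * L2_norm \<Omega> f"
    if f: "f \<in> H_div0 \<Omega>" and u: "solves \<Omega> (V \<Omega>) f u" and uh: "solves \<Omega> (V_h \<Omega> \<T>) f u_h" for f u u_h
  proof (rule est[OF f u])
    show "u_h \<in> V_h \<Omega> \<T>" using uh by (simp add: solves_def)
    fix v assume v: "v \<in> V_h \<Omega> \<T>"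
    then have v0: "v \<in> H0_rot \<Omega>" using V_h_H0_rot by blast
    have "u \<in> H_rot \<Omega>" "u_h \<in> H_rot \<Omega>" "v \<in> H_rot \<Omega>"
      using u uh v0 V_h_H0_rot by (auto simp: solves_def V_def H0_rot_iff)
    then have "a \<Omega> (\<lambda>x. u x - u_h x) v = a \<Omega> u v - a \<Omega> u_h v" by (rule a_diff)
    then show "a \<Omega> (\<lambda>x. u x - u_h x) v = 0"
      using solves_V_H0_rot[OF f u v0] uh v by (simp add: solves_def)
  qed
  moreover have "M_h \<Omega> \<T> \<le> M" by (rule M_h_le) (rule est)
  ultimately show ?thesis by blast
qed

end

section \<open>The two- and three-dimensional operators\<close>

lemma pd_component:
  fixes v :: "real^'n \<Rightarrow> real^'m"
  assumes "v differentiable (at x)"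
  shows "pd i (\<lambda>x. v x $ j) x = pd i v x $ j"
  by (rule pd_bounded_linear[OF bounded_linear_vec_nth assms])

lemma test_functions_component:
  fixes v :: "real^'n \<Rightarrow> real^'m"
  shows "v \<in> test_functions S \<Longrightarrow> (\<lambda>x. v x $ j) \<in> test_functions S"
  by (rule test_functions_bounded_linear[OF _ bounded_linear_vec_nth])

lemma test_pd_component:
  fixes v :: "real^'n \<Rightarrow> real^'m"
  assumes "v \<in> test_functions S"
  shows "pd i (\<lambda>x. v x $ j) = (\<lambda>x. pd i v x $ j)"
  by (intro ext pd_component test_functions_differentiable[OF assms])

lemma test_functions_uminus: "\<phi> \<in> test_functions S \<Longrightarrow> (\<lambda>x. - \<phi> x) \<in> test_functions S"
  by (rule test_functions_bounded_linear[OF _ bounded_linear_minus[OF bounded_linear_ident]])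

lemma test_functions_diff:
  "\<phi> \<in> test_functions S \<Longrightarrow> \<psi> \<in> test_functions S \<Longrightarrow> (\<lambda>x. \<phi> x - \<psi> x) \<in> test_functions S"
  using test_functions_add[OF _ test_functions_uminus, of \<phi> S \<psi>] by simp

lemma test_functions_pd_component:
  fixes v :: "real^'n \<Rightarrow> real^'m"
  shows "v \<in> test_functions S \<Longrightarrow> (\<lambda>x. pd i v x $ j) \<in> test_functions S"
  by (rule test_functions_component[OF test_functions_pd])

lemma test_pd_commute:
  fixes \<phi> :: "real^'n \<Rightarrow> real"
  assumes "\<phi> \<in> test_functions S"
  shows "pd i (pd j \<phi>) x = pd j (pd i \<phi>) x"
  by (rule pd_pd_commute[OF test_functions_smooth[OF assms]])

lemma L2_inner_pd_by_parts:
  fixes \<phi> \<psi> :: "real^'n \<Rightarrow> real"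
  assumes "\<phi> \<in> test_functions S" "\<psi> \<in> test_functions S" "S \<in> lmeasurable"
  shows "L2_inner S (pd i \<phi>) \<psi> = - L2_inner S \<phi> (pd i \<psi>)"
  using test_functions_integration_by_parts[OF assms] by (simp add: L2_inner_def)

lemma L2_inner_const_pd:
  fixes \<phi> :: "real^'n \<Rightarrow> real"
  assumes "\<phi> \<in> test_functions S" "S \<in> sets lebesgue"
  shows "L2_inner S (\<lambda>x. c) (pd i \<phi>) = 0"
  using integral_pd_eq_0[OF assms] by (simp add: L2_inner_def)

lemma L2_inner_components:
  fixes v w :: "real^'n \<Rightarrow> real^'m"
  assumes "v \<in> L2 S" "w \<in> L2 S"
  shows "L2_inner S v w = (\<Sum>i\<in>UNIV. L2_inner S (\<lambda>x. v x $ i) (\<lambda>x. w x $ i))"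
  using L2_integrable_inner[OF L2_nth[OF assms(1)] L2_nth[OF assms(2)]]
  by (simp add: L2_inner_def inner_vec_def Bochner_Integration.integral_sum)

lemma L2_inner_weak_pd_test:
  fixes v w :: "real^'n \<Rightarrow> real"
  assumes "is_weak_pd S i v w" "\<phi> \<in> test_functions S"
  shows "L2_inner S v (pd i \<phi>) = - L2_inner S w \<phi>"
  using assms by (simp add: is_weak_pd_def L2_inner_def mult.commute)

text \<open>A bump that is nonzero at \<open>p\<close> and zero where the line in direction
  \<open>i\<close> reaches the side of the box cannot be constant on that line.\<close>

lemma exists_test_function_pd_nonzero:
  fixes \<Omega> :: "(real^'n) set"
  assumes "open \<Omega>" "\<Omega> \<noteq> {}"
  shows "\<exists>\<phi>::real^'n \<Rightarrow> real. \<phi> \<in> test_functions \<Omega> \<and> (\<exists>x. pd i \<phi> x \<noteq> 0)"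
proof -
  obtain p where "p \<in> \<Omega>" using assms by blast
  then obtain a b where p: "p \<in> box a b" "cbox a b \<subseteq> \<Omega>"
    using open_contains_cbox[OF assms(1)] by metis
  let ?\<phi> = "box_bump 0 a b"
  have t: "?\<phi> \<in> test_functions \<Omega>" by (rule box_bump_test_function[OF p(2)])
  have "\<exists>x. pd i ?\<phi> x \<noteq> 0"
  proof (rule ccontr)
    assume "\<not> ?thesis"
    then have z: "pd i ?\<phi> x = 0" for x by simp
    have "((\<lambda>t. ?\<phi> (p + t *\<^sub>R axis i 1)) has_real_derivative 0) (at t)" for t
      using pd_line[OF test_functions_differentiable[OF t], where y=p and i=i and t=t] z by simp
    then have "?\<phi> (p + (b $ i - p $ i) *\<^sub>R axis i 1) = ?\<phi> (p + 0 *\<^sub>R axis i 1)"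
      by (intro DERIV_isconst_all) blast
    moreover have "p + (b $ i - p $ i) *\<^sub>R axis i 1 \<notin> box a b"
      by (auto simp: mem_box_cart axis_def intro!: exI[of _ i])
    then have "?\<phi> (p + (b $ i - p $ i) *\<^sub>R axis i 1) = 0" using box_bump_nonzero_iff by blast
    moreover have "?\<phi> p \<noteq> 0" using p(1) box_bump_nonzero_iff by blast
    ultimately show False by simp
  qed
  then show ?thesis using t by blast
qed

lemma H1_components:
  fixes v :: "real^'n \<Rightarrow> real^'m"
  assumes S: "S \<in> lmeasurable" and v: "v \<in> H1 S"
  shows "is_weak_pd S i (\<lambda>x. v x $ j) (\<lambda>x. weak_pd S i v x $ j)"
  using is_weak_pd_component_shift[OF S H1_L2[OF v] weak_pdD[OF v], of i 0 "axis j 1"]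
  by (simp add: inner_axis)

lemma H1_lincomb:
  fixes v w :: "real^'n \<Rightarrow> real"
  assumes S: "S \<in> lmeasurable" and v: "v \<in> H1 S" and w: "w \<in> H1 S"
  shows "(\<lambda>x. r *\<^sub>R v x + s *\<^sub>R w x) \<in> H1 S"
proof -
  have "is_weak_pd S i (\<lambda>x. r *\<^sub>R v x + s *\<^sub>R w x) (\<lambda>x. r *\<^sub>R weak_pd S i v x + s *\<^sub>R weak_pd S i w x)" for i
    unfolding is_weak_pd_def
  proof (intro allI impI)
    fix \<phi> :: "real^'n \<Rightarrow> real" assume \<phi>: "\<phi> \<in> test_functions S"
    have "L2_inner S (\<lambda>x. r *\<^sub>R v x + s *\<^sub>R w x) (pd i \<phi>) = - L2_inner S (\<lambda>x. r *\<^sub>R weak_pd S i v x + s *\<^sub>R weak_pd S i w x) \<phi>"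
      using L2_inner_weak_pd_test[OF weak_pdD(2)[OF v] \<phi>, of i] L2_inner_weak_pd_test[OF weak_pdD(2)[OF w] \<phi>, of i]
        test_functions_L2[OF \<phi> S] test_functions_L2[OF test_functions_pd[OF \<phi>] S] H1_L2[OF v] H1_L2[OF w] weak_pdD(1)[OF v] weak_pdD(1)[OF w]
      by (simp only: L2_inner_add_left L2_scaleR L2_inner_scaleR_left)
    then show "integral\<^sup>L (lebesgue_on S) (\<lambda>x. pd i \<phi> x *\<^sub>R (r *\<^sub>R v x + s *\<^sub>R w x)) =
        - integral\<^sup>L (lebesgue_on S) (\<lambda>x. \<phi> x *\<^sub>R (r *\<^sub>R weak_pd S i v x + s *\<^sub>R weak_pd S i w x))"
      by (simp add: L2_inner_def mult.commute)
  qed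
  then show ?thesis
    unfolding H1_def using L2_lincomb[OF H1_L2[OF v] H1_L2[OF w]] L2_lincomb[OF weak_pdD(1)[OF v] weak_pdD(1)[OF w]] by blast
qed

lemma const_H1:
  assumes S: "S \<in> lmeasurable"
  shows "(\<lambda>x. c::real) \<in> H1 S"
proof -
  have "is_weak_pd S i (\<lambda>x. c) (\<lambda>x. 0)" for i
    using fmeasurableD[OF S] by (auto simp: is_weak_pd_def integral_pd_eq_0)
  then show ?thesis unfolding H1_def using L2_const[OF S] L2_zero by blast
qed

lemma test_functions_vector_2:
  fixes p q :: "real^'n \<Rightarrow> real"
  assumes "p \<in> test_functions S" "q \<in> test_functions S"
  shows "(\<lambda>x. vector [p x, q x] :: real^2) \<in> test_functions S"
proof -
  have "(\<lambda>x. \<chi> i::2. (if i = 1 then p else q) x) \<in> test_functions S"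
    by (rule test_functions_vec) (use assms in simp)
  moreover have "(\<lambda>x. \<chi> i::2. (if i = 1 then p else q) x) = (\<lambda>x. vector [p x, q x])"
    by (simp add: fun_eq_iff vec_eq_iff forall_2)
  ultimately show ?thesis by simp
qed

lemma test_functions_vector_3:
  fixes p q r :: "real^'n \<Rightarrow> real"
  assumes "p \<in> test_functions S" "q \<in> test_functions S" "r \<in> test_functions S"
  shows "(\<lambda>x. vector [p x, q x, r x] :: real^3) \<in> test_functions S"
proof -
  have "(\<lambda>x. \<chi> i::3. (if i = 1 then p else if i = 2 then q else r) x) \<in> test_functions S"
    by (rule test_functions_vec) (use assms in simp)
  moreover have "(\<lambda>x. \<chi> i::3. (if i = 1 then p else if i = 2 then q else r) x) = (\<lambda>x. vector [p x, q x, r x])"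
    by (simp add: fun_eq_iff vec_eq_iff forall_3)
  ultimately show ?thesis by simp
qed

lemma rot2_test: "\<psi> \<in> test_functions S \<Longrightarrow> rot2 \<psi> \<in> test_functions S"
  unfolding rot2_def[abs_def] by (intro test_functions_diff test_functions_pd_component)

lemma Curl2_test: "\<phi> \<in> test_functions S \<Longrightarrow> Curl2 \<phi> \<in> test_functions S"
  unfolding Curl2_def[abs_def] by (intro test_functions_vector_2 test_functions_uminus test_functions_pd)

lemma curl3_test: "\<psi> \<in> test_functions S \<Longrightarrow> curl3 \<psi> \<in> test_functions S"
  unfolding curl3_def[abs_def] by (intro test_functions_vector_3 test_functions_diff test_functions_pd_component)

lemma sgn_d2: "d2.sgn_d = -1" and sgn_d3: "d3.sgn_d = 1"
  by (simp_all add: d2.sgn_d_def d3.sgn_d_def)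

lemma L2_inner_diff_right_pd:
  fixes g :: "real^'n \<Rightarrow> real" and \<psi> :: "real^'n \<Rightarrow> real^'m"
  assumes S: "S \<in> lmeasurable" and g: "g \<in> L2 S" and \<psi>: "\<psi> \<in> test_functions S"
  shows "L2_inner S g (\<lambda>x. pd i \<psi> x $ j - pd k \<psi> x $ l) =
    L2_inner S g (pd i (\<lambda>x. \<psi> x $ j)) - L2_inner S g (pd k (\<lambda>x. \<psi> x $ l))"
  unfolding test_pd_component[OF \<psi>]
  by (rule L2_inner_diff_right[OF test_functions_L2[OF test_functions_pd_component[OF \<psi>] S]
        test_functions_L2[OF test_functions_pd_component[OF \<psi>] S] g])

text \<open>\<open>w1\<close> and \<open>w2\<close> stand for the partial derivatives of \<phi>. The
  same computation then yields Green's formula for test functions, the weak Curl of H1 functions,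
  and the comparison of norms in \<open>J_norm_Curl2\<close>.\<close>

lemma Curl2_weak:
  fixes S :: "(real^2) set" and \<phi> :: "real^2 \<Rightarrow> real"
  assumes S: "S \<in> lmeasurable" and \<phi>: "\<phi> \<in> L2 S" and w: "w1 \<in> L2 S" "w2 \<in> L2 S"
    and pd: "\<And>\<eta>. \<eta> \<in> test_functions S \<Longrightarrow> L2_inner S \<phi> (pd 1 \<eta>) = - L2_inner S w1 \<eta>"
      "\<And>\<eta>. \<eta> \<in> test_functions S \<Longrightarrow> L2_inner S \<phi> (pd 2 \<eta>) = - L2_inner S w2 \<eta>"
  shows "d2.is_weak_Curl S \<phi> (\<lambda>x. vector [- w2 x, w1 x])" "(\<lambda>x. vector [- w2 x, w1 x] :: real^2) \<in> L2 S"
proof -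
  show L: "(\<lambda>x. vector [- w2 x, w1 x] :: real^2) \<in> L2 S"
  proof (rule L2_vecI)
    fix i :: 2
    consider "i = 1" | "i = 2" using exhaust_2 by blast
    then show "(\<lambda>x. (vector [- w2 x, w1 x] :: real^2) $ i) \<in> L2 S"
      by cases (use w in \<open>simp_all add: L2_uminus\<close>)
  qed
  show "d2.is_weak_Curl S \<phi> (\<lambda>x. vector [- w2 x, w1 x])"
    unfolding d2.is_weak_Curl_def sgn_d2
  proof
    fix \<psi> :: "real^2 \<Rightarrow> real^2" assume \<psi>: "\<psi> \<in> test_functions S"
    have c: "(\<lambda>x. \<psi> x $ j) \<in> test_functions S" for j by (rule test_functions_component[OF \<psi>])
    have "L2_inner S \<phi> (rot2 \<psi>) = - L2_inner S w1 (\<lambda>x. \<psi> x $ 2) + L2_inner S w2 (\<lambda>x. \<psi> x $ 1)"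
      unfolding rot2_def[abs_def] L2_inner_diff_right_pd[OF S \<phi> \<psi>] using pd[OF c] by simp
    moreover have "L2_inner S (\<lambda>x. vector [- w2 x, w1 x]) \<psi> = - L2_inner S w2 (\<lambda>x. \<psi> x $ 1) + L2_inner S w1 (\<lambda>x. \<psi> x $ 2)"
      using L2_inner_scaleR_left[of S "-1" w2 "\<lambda>x. \<psi> x $ 1"]
      by (simp add: L2_inner_components[OF L test_functions_L2[OF \<psi> S]] sum_2)
    ultimately show "L2_inner S \<phi> (rot2 \<psi>) = - 1 * L2_inner S (\<lambda>x. vector [- w2 x, w1 x]) \<psi>" by simp
  qed
qed

text \<open>\<open>w i j\<close> stands for the \<open>i\<close>-th derivative of the
  \<open>j\<close>-th component. Instances are smooth fields, constants with \<open>w = 0\<close>,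
  and H1 fields.\<close>

lemma curl3_weak:
  fixes S :: "(real^3) set" and \<phi> :: "real^3 \<Rightarrow> real^3"
  assumes S: "S \<in> lmeasurable" and \<phi>: "\<phi> \<in> L2 S" and w: "\<And>i j. w i j \<in> L2 S"
    and pd: "\<And>\<eta> i j. \<eta> \<in> test_functions S \<Longrightarrow> L2_inner S (\<lambda>x. \<phi> x $ j) (pd i \<eta>) = - L2_inner S (w i j) \<eta>"
  defines "W \<equiv> \<lambda>x. vector [w 2 3 x - w 3 2 x, w 3 1 x - w 1 3 x, w 1 2 x - w 2 1 x] :: real^3"
  shows "d3.is_weak_rot S \<phi> W" "W \<in> L2 S"
proof -
  show L: "W \<in> L2 S"
  proof (rule L2_vecI)
    fix i :: 3
    consider "i = 1" | "i = 2" | "i = 3" using exhaust_3 by blast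
    then show "(\<lambda>x. W x $ i) \<in> L2 S"
      by cases (use w in \<open>simp_all add: W_def L2_diff\<close>)
  qed
  show "d3.is_weak_rot S \<phi> W"
    unfolding d3.is_weak_rot_def sgn_d3
  proof
    fix \<psi> :: "real^3 \<Rightarrow> real^3" assume \<psi>: "\<psi> \<in> test_functions S"
    have c: "(\<lambda>x. \<psi> x $ j) \<in> test_functions S" for j by (rule test_functions_component[OF \<psi>])
    have cL: "(\<lambda>x. \<psi> x $ j) \<in> L2 S" for j by (rule test_functions_L2[OF c S])
    have \<phi>c: "(\<lambda>x. \<phi> x $ j) \<in> L2 S" for j by (rule L2_nth[OF \<phi>])
    have d: "L2_inner S (\<lambda>x. \<phi> x $ m) (\<lambda>x. pd i \<psi> x $ j - pd k \<psi> x $ l) =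
        - L2_inner S (w i m) (\<lambda>x. \<psi> x $ j) + L2_inner S (w k m) (\<lambda>x. \<psi> x $ l)" for m i j k l
      unfolding L2_inner_diff_right_pd[OF S \<phi>c \<psi>] using pd[OF c] by simp
    have "L2_inner S \<phi> (curl3 \<psi>) =
        L2_inner S (\<lambda>x. \<phi> x $ 1) (\<lambda>x. pd 2 \<psi> x $ 3 - pd 3 \<psi> x $ 2) +
        L2_inner S (\<lambda>x. \<phi> x $ 2) (\<lambda>x. pd 3 \<psi> x $ 1 - pd 1 \<psi> x $ 3) +
        L2_inner S (\<lambda>x. \<phi> x $ 3) (\<lambda>x. pd 1 \<psi> x $ 2 - pd 2 \<psi> x $ 1)"
      unfolding L2_inner_components[OF \<phi> test_functions_L2[OF curl3_test[OF \<psi>] S]] by (simp add: sum_3 curl3_def)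
    also have "\<dots> = L2_inner S W \<psi>"
      unfolding L2_inner_components[OF L test_functions_L2[OF \<psi> S]] d
      by (simp add: sum_3 W_def L2_inner_diff_left w cL)
    finally show "L2_inner S \<phi> (curl3 \<psi>) = 1 * L2_inner S W \<psi>" by simp
  qed
qed

section \<open>The two concrete settings\<close>

lemma maxwell_d2:
  fixes \<Omega> :: "(real^2) set"
  assumes \<Omega>: "open \<Omega>" "bounded \<Omega>" "\<Omega> \<noteq> {}"
  shows "maxwell rot2 Curl2 H1 S1 \<Omega>"
proof
  have S: "\<Omega> \<in> lmeasurable" using \<Omega>(2,1) by (rule lmeasurable_open)
  show "open \<Omega>" "bounded \<Omega>" "\<Omega> \<noteq> {}" by (rule \<Omega>)+
  show "rot2 \<psi> \<in> test_functions \<Omega>" if "\<psi> \<in> test_functions \<Omega>" for \<psi> by (rule rot2_test[OF that])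
  show "Curl2 \<phi> \<in> test_functions \<Omega>" if "\<phi> \<in> test_functions \<Omega>" for \<phi> by (rule Curl2_test[OF that])
  show "L2_inner \<Omega> \<psi> (Curl2 \<phi>) = d2.sgn_d * L2_inner \<Omega> (rot2 \<psi>) \<phi>"
    if \<psi>: "\<psi> \<in> test_functions \<Omega>" and \<phi>: "\<phi> \<in> test_functions \<Omega>" for \<psi> \<phi>
  proof -
    have L: "pd i \<phi> \<in> L2 \<Omega>" for i by (rule test_functions_L2[OF test_functions_pd[OF \<phi>] S])
    have w: "d2.is_weak_Curl \<Omega> \<phi> (Curl2 \<phi>)"
      unfolding Curl2_def[abs_def]
    proof (rule Curl2_weak(1)[OF S test_functions_L2[OF \<phi> S] L L])
      show "L2_inner \<Omega> \<phi> (pd 1 \<eta>) = - L2_inner \<Omega> (pd 1 \<phi>) \<eta>" "L2_inner \<Omega> \<phi> (pd 2 \<eta>) = - L2_inner \<Omega> (pd 2 \<phi>) \<eta>"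
        if "\<eta> \<in> test_functions \<Omega>" for \<eta>
        using L2_inner_pd_by_parts[OF \<phi> that S] by simp_all
    qed
    then have "L2_inner \<Omega> \<phi> (rot2 \<psi>) = d2.sgn_d * L2_inner \<Omega> (Curl2 \<phi>) \<psi>" using \<psi> by (simp add: d2.is_weak_Curl_def)
    then show ?thesis by (simp add: sgn_d2 L2_inner_commute)
  qed
  show "rot2 (grad \<eta>) = (\<lambda>x. 0)" if \<eta>: "\<eta> \<in> test_functions \<Omega>" for \<eta>
    using test_pd_component[OF test_functions_grad[OF \<eta>], symmetric] test_pd_commute[OF \<eta>]
    by (simp add: rot2_def[abs_def] fun_eq_iff)
  show "L2_inner \<Omega> (\<lambda>x. c) (rot2 \<psi>) = 0" if \<psi>: "\<psi> \<in> test_functions \<Omega>" for \<psi> c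
    unfolding rot2_def[abs_def] L2_inner_diff_right_pd[OF S L2_const[OF S] \<psi>]
    using L2_inner_const_pd[OF test_functions_component[OF \<psi>] fmeasurableD[OF S]] by simp
  show "\<exists>\<phi>\<in>test_functions \<Omega>. \<exists>x. Curl2 \<phi> x \<noteq> 0"
  proof -
    obtain \<phi> :: "real^2 \<Rightarrow> real" and x where "\<phi> \<in> test_functions \<Omega>" "pd 1 \<phi> x \<noteq> 0"
      using exists_test_function_pd_nonzero[OF \<Omega>(1,3)] by blast
    then show ?thesis by (intro bexI[of _ \<phi>] exI[of _ x]) (auto simp: Curl2_def vec_eq_iff forall_2)
  qed
  show "\<phi> \<in> L2 \<Omega> \<and> (\<exists>w\<in>L2 \<Omega>. d2.is_weak_Curl \<Omega> \<phi> w)" if "\<phi> \<in> H1 \<Omega>" for \<phi>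
    using Curl2_weak[OF S H1_L2[OF that] weak_pdD(1)[OF that] weak_pdD(1)[OF that]]
      L2_inner_weak_pd_test[OF weak_pdD(2)[OF that]] H1_L2[OF that] by blast
  show "(\<lambda>x. r *\<^sub>R \<phi> x + s *\<^sub>R \<phi>' x) \<in> H1 \<Omega>" if "\<phi> \<in> H1 \<Omega>" "\<phi>' \<in> H1 \<Omega>"
    for \<phi> \<phi>' :: "real^2 \<Rightarrow> real" and r s
    by (rule H1_lincomb[OF S that])
  show "S1 \<Omega> \<T> \<subseteq> H1 \<Omega>" for \<T> by (auto simp: S1_def)
  show "(\<lambda>x. c) \<in> S1 \<Omega> \<T>" for c \<T>
    unfolding S1_def using const_H1[OF S, of c] by (intro CollectI conjI ballI exI[of _ 0] exI[of _ c]) auto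
qed simp

lemma maxwell_d3:
  fixes \<Omega> :: "(real^3) set"
  assumes \<Omega>: "open \<Omega>" "bounded \<Omega>" "\<Omega> \<noteq> {}"
  shows "maxwell curl3 curl3 d3.H_rot d3.N0 \<Omega>"
proof
  have S: "\<Omega> \<in> lmeasurable" using \<Omega>(2,1) by (rule lmeasurable_open)
  \<comment> \<open>With \<open>rot\<close> and \<open>Curl\<close> the same operator, both weak
    notions have the same defining identity.\<close>
  have Curl_rot: "d3.is_weak_Curl = d3.is_weak_rot"
    by (simp add: fun_eq_iff d3.is_weak_Curl_def d3.is_weak_rot_def)
  have int0: "L2_inner \<Omega> (\<lambda>x. c) (curl3 \<psi>) = 0" if \<psi>: "\<psi> \<in> test_functions \<Omega>" for \<psi> c
  proof -
    have "d3.is_weak_rot \<Omega> (\<lambda>x. c) (\<lambda>x. vector [0 - 0, 0 - 0, 0 - 0])"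
      by (rule curl3_weak(1)[OF S L2_const[OF S], where w="\<lambda>i j x. 0"])
        (simp_all add: L2_inner_const_pd[OF _ fmeasurableD[OF S]])
    moreover have "(vector [0 - 0, 0 - 0, 0 - 0] :: real^3) = 0" by (simp add: vec_eq_iff forall_3)
    ultimately show ?thesis using \<psi> by (simp add: d3.is_weak_rot_def)
  qed
  show "open \<Omega>" "bounded \<Omega>" "\<Omega> \<noteq> {}" by (rule \<Omega>)+
  show "curl3 \<psi> \<in> test_functions \<Omega>" if "\<psi> \<in> test_functions \<Omega>" for \<psi> by (rule curl3_test[OF that])
  show "L2_inner \<Omega> \<psi> (curl3 \<phi>) = d3.sgn_d * L2_inner \<Omega> (curl3 \<psi>) \<phi>"
    if \<psi>: "\<psi> \<in> test_functions \<Omega>" and \<phi>: "\<phi> \<in> test_functions \<Omega>" for \<psi> \<phi>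
  proof -
    have "d3.is_weak_rot \<Omega> \<psi> (\<lambda>x. vector [pd 2 \<psi> x $ 3 - pd 3 \<psi> x $ 2, pd 3 \<psi> x $ 1 - pd 1 \<psi> x $ 3, pd 1 \<psi> x $ 2 - pd 2 \<psi> x $ 1])"
    proof (rule curl3_weak(1)[OF S test_functions_L2[OF \<psi> S], where w="\<lambda>i j x. pd i \<psi> x $ j"])
      show "(\<lambda>x. pd i \<psi> x $ j) \<in> L2 \<Omega>" for i j by (rule test_functions_L2[OF test_functions_pd_component[OF \<psi>] S])
      show "L2_inner \<Omega> (\<lambda>x. \<psi> x $ j) (pd i \<eta>) = - L2_inner \<Omega> (\<lambda>x. pd i \<psi> x $ j) \<eta>"
        if "\<eta> \<in> test_functions \<Omega>" for \<eta> i j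
        using L2_inner_pd_by_parts[OF test_functions_component[OF \<psi>] that S, of i j]
        by (simp add: test_pd_component[OF \<psi>])
    qed
    then have "d3.is_weak_rot \<Omega> \<psi> (curl3 \<psi>)" by (simp add: curl3_def[abs_def])
    then show ?thesis using \<phi> by (simp add: d3.is_weak_rot_def)
  qed
  show "curl3 (grad \<eta>) = (\<lambda>x. 0)" if \<eta>: "\<eta> \<in> test_functions \<Omega>" for \<eta>
    using test_pd_component[OF test_functions_grad[OF \<eta>], symmetric] test_pd_commute[OF \<eta>]
    by (simp add: curl3_def[abs_def] fun_eq_iff vec_eq_iff forall_3)
  show "L2_inner \<Omega> (\<lambda>x. c) (curl3 \<psi>) = 0" if \<psi>: "\<psi> \<in> test_functions \<Omega>" for \<psi> c
    by (rule int0[OF that])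
  show "\<exists>\<phi>\<in>test_functions \<Omega>. \<exists>x. curl3 \<phi> x \<noteq> 0"
  proof -
    obtain \<phi> :: "real^3 \<Rightarrow> real" and x where \<phi>: "\<phi> \<in> test_functions \<Omega>" "pd 2 \<phi> x \<noteq> 0"
      using exists_test_function_pd_nonzero[OF \<Omega>(1,3)] by blast
    \<comment> \<open>The third component of the curl of this field is minus the second partial
      derivative of \<phi>.\<close>
    define \<psi> where "\<psi> x = (vector [\<phi> x, 0, 0] :: real^3)" for x
    have \<psi>: "\<psi> \<in> test_functions \<Omega>"
      unfolding \<psi>_def[abs_def] by (intro test_functions_vector_3 \<phi> test_functions_zero)
    have "pd 2 \<psi> x $ 1 = pd 2 \<phi> x" "pd 1 \<psi> x $ 2 = 0"
      unfolding test_pd_component[OF \<psi>, THEN fun_cong, symmetric] by (simp_all add: \<psi>_def)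
    then have "curl3 \<psi> x \<noteq> 0" using \<phi>(2) by (auto simp: curl3_def vec_eq_iff forall_3)
    then show ?thesis using \<psi> by blast
  qed
  show "\<phi> \<in> L2 \<Omega> \<and> (\<exists>w\<in>L2 \<Omega>. d3.is_weak_Curl \<Omega> \<phi> w)" if "\<phi> \<in> d3.H_rot \<Omega>" for \<phi>
    using that by (simp add: d3.H_rot_def Curl_rot)
  show "H1 \<Omega> \<subseteq> d3.H_rot \<Omega>"
  proof
    fix v :: "real^3 \<Rightarrow> real^3" assume v: "v \<in> H1 \<Omega>"
    have w: "(\<lambda>x. weak_pd \<Omega> i v x $ j) \<in> L2 \<Omega>" for i j by (rule L2_nth[OF weak_pdD(1)[OF v]])
    show "v \<in> d3.H_rot \<Omega>"
      unfolding d3.H_rot_def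
      using H1_L2[OF v] curl3_weak[OF S H1_L2[OF v] w L2_inner_weak_pd_test[OF H1_components[OF S v]]] by blast
  qed
  show "(\<lambda>x. r *\<^sub>R \<phi> x + s *\<^sub>R \<phi>' x) \<in> d3.H_rot \<Omega>" if \<phi>: "\<phi> \<in> d3.H_rot \<Omega>" "\<phi>' \<in> d3.H_rot \<Omega>" for \<phi> \<phi>' r s
  proof -
    obtain w w' where w: "w \<in> L2 \<Omega>" "d3.is_weak_rot \<Omega> \<phi> w" "w' \<in> L2 \<Omega>" "d3.is_weak_rot \<Omega> \<phi>' w'" "\<phi> \<in> L2 \<Omega>" "\<phi>' \<in> L2 \<Omega>"
      using \<phi> by (auto simp: d3.H_rot_def)
    have "d3.is_weak_rot \<Omega> (\<lambda>x. r *\<^sub>R \<phi> x + s *\<^sub>R \<phi>' x) (\<lambda>x. r *\<^sub>R w x + s *\<^sub>R w' x)"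
      using w by (simp add: d3.is_weak_rot_def L2_inner_add_left L2_scaleR L2_inner_scaleR_left
          test_functions_L2[where S=\<Omega> and T=\<Omega>, OF _ S] curl3_test algebra_simps)
    then show ?thesis using w L2_lincomb[OF w(5,6)] L2_lincomb[OF w(1,3)] unfolding d3.H_rot_def by blast
  qed
  show "d3.N0 \<Omega> \<T> \<subseteq> d3.H_rot \<Omega>" for \<T> by (auto simp: d3.N0_def)
  show "(\<lambda>x. c) \<in> d3.N0 \<Omega> \<T>" for c \<T>
    unfolding d3.N0_def d3.H_rot_def
  proof (intro CollectI conjI ballI bexI[of _ "\<lambda>x. 0"] L2_zero L2_const[OF S])
    show "d3.is_weak_rot \<Omega> (\<lambda>x. c) (\<lambda>x. 0)" by (simp add: d3.is_weak_rot_def int0)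
    show "\<exists>\<alpha> \<beta>. (\<exists>A b. \<forall>x. \<beta> x = A *v x + b) \<and> (\<forall>x\<in>T. \<beta> x \<bullet> x = 0) \<and> (AE x in lebesgue_on T. c = \<alpha> + \<beta> x)" for T
      by (intro exI[of _ c] exI[of _ "\<lambda>x. 0"] conjI exI[of _ 0]) auto
  qed
qed

text \<open>In the plane the weak Curl is the weak gradient turned by a right angle. By uniqueness
  \<open>f\<close> is this rotated gradient almost everywhere, so the pointwise norms agree and the
  identity holds on every measurable part of \<Omega>.\<close>

lemma J_norm_Curl2:
  fixes \<Omega> :: "(real^2) set"
  assumes \<Omega>: "open \<Omega>" "\<Omega> \<in> lmeasurable" and \<beta>: "\<beta> \<in> H1 \<Omega>" and f: "d2.is_weak_Curl \<Omega> \<beta> f" "f \<in> L2 \<Omega>"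
    and mx: "maxwell rot2 Curl2 H1 S1 \<Omega>" and S: "S \<subseteq> \<Omega>" "S \<in> sets lebesgue"
  shows "J_norm \<Omega> S \<beta> = L2_norm S f"
proof -
  let ?w = "\<lambda>x. vector [- weak_pd \<Omega> 2 \<beta> x, weak_pd \<Omega> 1 \<beta> x] :: real^2"
  have Os: "\<Omega> \<in> sets lebesgue" using \<Omega> by auto
  have w: "d2.is_weak_Curl \<Omega> \<beta> ?w" "?w \<in> L2 \<Omega>"
    using Curl2_weak[OF \<Omega>(2) H1_L2[OF \<beta>] weak_pdD(1)[OF \<beta>] weak_pdD(1)[OF \<beta>]]
      L2_inner_weak_pd_test[OF weak_pdD(2)[OF \<beta>]] by blast+
  have ae: "ae_eq S f ?w"
    by (rule ae_eq_subset[OF maxwell.is_weak_Curl_unique[OF mx f(1) w(1) f(2) w(2)] S Os])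
  have "(L2_norm S f)\<^sup>2 = (L2_norm S ?w)\<^sup>2"
    by (simp add: L2_norm_cong[OF ae L2_subset[OF f(2) S Os] L2_subset[OF w(2) S Os]])
  also have "\<dots> = (\<integral>x. (weak_pd \<Omega> 2 \<beta> x)\<^sup>2 + (weak_pd \<Omega> 1 \<beta> x)\<^sup>2 \<partial>lebesgue_on S)"
    unfolding L2_norm_power2 power2_norm_eq_inner by (simp add: inner_vec_def sum_2 power2_eq_square)
  also have "\<dots> = (J_norm \<Omega> S \<beta>)\<^sup>2"
    using L2_integrable_power2[OF L2_subset[OF weak_pdD(1)[OF \<beta>] S Os]]
    by (simp add: J_norm_power2 L2_norm_power2 sum_2 add.commute)
  finally show ?thesis by simp
qed

lemma mesh_intro:
  assumes "bounded \<Omega>" "open \<Omega>" "\<Omega> \<noteq> {}" "contractible \<Omega>" "lipschitz_boundary \<Omega>" "regular_triangulation \<Omega> \<T>"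
  shows "mesh \<Omega> \<T>"
  using assms contractible_imp_connected by unfold_locales auto

theorem theorem3p6:
  shows
   "(\<forall>(\<Omega> :: (real^2) set) \<T> \<pi>div \<pi>Curl C1div C2div C1Curl C2Curl C_RD ct M.
       bounded \<Omega> \<and> open \<Omega> \<and> \<Omega> \<noteq> {} \<and> contractible \<Omega> \<and> polytopal \<Omega> \<and> lipschitz_boundary \<Omega> \<and>
       regular_triangulation \<Omega> \<T> \<and>
       d2.commuting_projections \<Omega> \<T> \<pi>div \<pi>Curl C1div C2div C1Curl C2Curl \<and>
       d2.is_potential_constant \<Omega> C_RD \<and> C_RD = 1 \<and>
       is_patch_poincare_constant \<T> ct \<and>
       M \<ge> (h_max \<T> * ((1 + C1Curl) * ct + C2Curl) + d2.kappa_h \<Omega> \<T> * C1div) * sqrt (real (C_OL \<T>))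
     \<longrightarrow>
       (\<forall>f \<in> H_div0 \<Omega>. \<forall>u u_h.
          d2.solves \<Omega> (d2.V \<Omega>) f u \<and> d2.solves \<Omega> (d2.V_h \<Omega> \<T>) f u_h \<longrightarrow>
          d2.a_norm \<Omega> (\<lambda>x. u x - u_h x) \<le> M * L2_norm \<Omega> f) \<and>
       d2.M_h \<Omega> \<T> \<le> M)
    \<and>
    (\<forall>(\<Omega> :: (real^3) set) \<T> \<pi>div \<pi>Curl C1div C2div C1Curl C2Curl C_RD ct M.
       bounded \<Omega> \<and> open \<Omega> \<and> \<Omega> \<noteq> {} \<and> contractible \<Omega> \<and> polytopal \<Omega> \<and> lipschitz_boundary \<Omega> \<and>
       regular_triangulation \<Omega> \<T> \<and>
       d3.commuting_projections \<Omega> \<T> \<pi>div \<pi>Curl C1div C2div C1Curl C2Curl \<and>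
       d3.is_potential_constant \<Omega> C_RD \<and>
       is_patch_poincare_constant \<T> ct \<and>
       M \<ge> (h_max \<T> * sqrt (2 * (((1 + C1Curl) * ct * C_RD)\<^sup>2 + C2Curl\<^sup>2))
              + d3.kappa_h \<Omega> \<T> * C1div) * sqrt (real (C_OL \<T>))
     \<longrightarrow>
       (\<forall>f \<in> H_div0 \<Omega>. \<forall>u u_h.
          d3.solves \<Omega> (d3.V \<Omega>) f u \<and> d3.solves \<Omega> (d3.V_h \<Omega> \<T>) f u_h \<longrightarrow>
          d3.a_norm \<Omega> (\<lambda>x. u x - u_h x) \<le> M * L2_norm \<Omega> f) \<and>
       d3.M_h \<Omega> \<T> \<le> M)"
proof (intro conjI[of "All _" "All _"] allI)
  fix \<Omega> :: "(real^2) set" and \<T> \<pi>div \<pi>Curl and C1div C2div C1Curl C2Curl C_RD ct M :: real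
  show "bounded \<Omega> \<and> open \<Omega> \<and> \<Omega> \<noteq> {} \<and> contractible \<Omega> \<and> polytopal \<Omega> \<and> lipschitz_boundary \<Omega> \<and>
       regular_triangulation \<Omega> \<T> \<and>
       d2.commuting_projections \<Omega> \<T> \<pi>div \<pi>Curl C1div C2div C1Curl C2Curl \<and>
       d2.is_potential_constant \<Omega> C_RD \<and> C_RD = 1 \<and>
       is_patch_poincare_constant \<T> ct \<and>
       M \<ge> (h_max \<T> * ((1 + C1Curl) * ct + C2Curl) + d2.kappa_h \<Omega> \<T> * C1div) * sqrt (real (C_OL \<T>))
     \<longrightarrow>
       (\<forall>f \<in> H_div0 \<Omega>. \<forall>u u_h.
          d2.solves \<Omega> (d2.V \<Omega>) f u \<and> d2.solves \<Omega> (d2.V_h \<Omega> \<T>) f u_h \<longrightarrow>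
          d2.a_norm \<Omega> (\<lambda>x. u x - u_h x) \<le> M * L2_norm \<Omega> f) \<and>
       d2.M_h \<Omega> \<T> \<le> M"
    (is "?A \<longrightarrow> ?B")
  proof
    assume A: ?A
    have mx: "maxwell rot2 Curl2 H1 S1 \<Omega>" using A by (intro maxwell_d2) auto
    have me: "mesh \<Omega> \<T>" using A by (intro mesh_intro) auto
    have mm: "maxwell_mesh rot2 Curl2 H1 S1 \<Omega> \<T> \<pi>div \<pi>Curl C1div C2div C1Curl C2Curl C_RD ct"
      using A by (intro maxwell_mesh.intro mx me maxwell_mesh_axioms.intro) (auto simp: is_patch_poincare_constant_def)
    show ?B
    proof (rule maxwell_mesh.computable_error_bound[OF mm])
      show "(h_max \<T> * ((1 + C1Curl) * ct + C2Curl) + d2.kappa_h \<Omega> \<T> * C1div) * sqrt (real (C_OL \<T>)) \<le> M" using A by blast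
      fix \<beta> f assume \<beta>: "\<beta> \<in> H1 \<Omega>" "f \<in> H_div0 \<Omega>" "d2.is_weak_Curl \<Omega> \<beta> f"
      have fL: "f \<in> L2 \<Omega>" using \<beta>(2) by (simp add: H_div0_iff)
      show "L2_norm \<Omega> (\<lambda>x. \<beta> x - \<pi>Curl \<beta> x) \<le> h_max \<T> * ((1 + C1Curl) * ct + C2Curl) * sqrt (real (C_OL \<T>)) * L2_norm \<Omega> f"
      \<comment> \<open>Patchwise equality of Jacobian and data is what gives the constant for d = 2
        its form without a root.\<close>
      proof (rule maxwell_mesh.Curl_projection_error_isometric[OF mm \<beta>(1,3) fL])
        fix T
        show "J_norm \<Omega> (patch \<T> T) \<beta> = L2_norm (patch \<T> T) f"
          using mesh.mesh_lmeasurable[OF me] mesh.patch_lmeasurable[OF me] mesh.patch_subset[OF me] A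
          by (intro J_norm_Curl2 \<beta> fL mx) auto
      qed
    qed
  qed
next
  fix \<Omega> :: "(real^3) set" and \<T> \<pi>div \<pi>Curl and C1div C2div C1Curl C2Curl C_RD ct M :: real
  show "bounded \<Omega> \<and> open \<Omega> \<and> \<Omega> \<noteq> {} \<and> contractible \<Omega> \<and> polytopal \<Omega> \<and> lipschitz_boundary \<Omega> \<and>
       regular_triangulation \<Omega> \<T> \<and>
       d3.commuting_projections \<Omega> \<T> \<pi>div \<pi>Curl C1div C2div C1Curl C2Curl \<and>
       d3.is_potential_constant \<Omega> C_RD \<and>
       is_patch_poincare_constant \<T> ct \<and>
       M \<ge> (h_max \<T> * sqrt (2 * (((1 + C1Curl) * ct * C_RD)\<^sup>2 + C2Curl\<^sup>2))
              + d3.kappa_h \<Omega> \<T> * C1div) * sqrt (real (C_OL \<T>))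
     \<longrightarrow>
       (\<forall>f \<in> H_div0 \<Omega>. \<forall>u u_h.
          d3.solves \<Omega> (d3.V \<Omega>) f u \<and> d3.solves \<Omega> (d3.V_h \<Omega> \<T>) f u_h \<longrightarrow>
          d3.a_norm \<Omega> (\<lambda>x. u x - u_h x) \<le> M * L2_norm \<Omega> f) \<and>
       d3.M_h \<Omega> \<T> \<le> M"
    (is "?A \<longrightarrow> ?B")
  proof
    assume A: ?A
    have mx: "maxwell curl3 curl3 d3.H_rot d3.N0 \<Omega>" using A by (intro maxwell_d3) auto
    have me: "mesh \<Omega> \<T>" using A by (intro mesh_intro) auto
    have mm: "maxwell_mesh curl3 curl3 d3.H_rot d3.N0 \<Omega> \<T> \<pi>div \<pi>Curl C1div C2div C1Curl C2Curl C_RD ct"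
      using A by (intro maxwell_mesh.intro mx me maxwell_mesh_axioms.intro) (auto simp: is_patch_poincare_constant_def)
    show ?B
    proof (rule maxwell_mesh.computable_error_bound[OF mm])
      show "(h_max \<T> * sqrt (2 * (((1 + C1Curl) * ct * C_RD)\<^sup>2 + C2Curl\<^sup>2)) + d3.kappa_h \<Omega> \<T> * C1div) * sqrt (real (C_OL \<T>)) \<le> M"
        using A by blast
      fix \<beta> f assume \<beta>: "\<beta> \<in> H1 \<Omega>" "f \<in> H_div0 \<Omega>" "d3.is_weak_Curl \<Omega> \<beta> f" "D_norm \<Omega> \<beta> \<le> C_RD * L2_norm \<Omega> f"
      have fL: "f \<in> L2 \<Omega>" using \<beta>(2) by (simp add: H_div0_iff)
      show "L2_norm \<Omega> (\<lambda>x. \<beta> x - \<pi>Curl \<beta> x) \<le>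
          h_max \<T> * sqrt (2 * (((1 + C1Curl) * ct * C_RD)\<^sup>2 + C2Curl\<^sup>2)) * sqrt (real (C_OL \<T>)) * L2_norm \<Omega> f"
        by (rule maxwell_mesh.Curl_projection_error_general[OF mm \<beta>(1,3) fL \<beta>(4)])
    qed
  qed
qed

end
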